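(* Let $w = w(n)$ be such that $w = O(n^{c})$ for some positive constant $c < 1/2$. Then there are 3-CNF formulas $F_{n,w}$ with $O(wn)$ clauses over $O(n)$ variables such that the following holds: (1) $F_{n,w}$ has a resolution refutation in simultaneous size $n^{O(w)}$, width $O(w)$ and space $O(w)$; (2) any refutation of $F_{n,w}$ in resolution, in polynomial calculus resolution (PCR), or in Sherali-Adams must have size $n^{\Omega(w)}$.
   Context: A literal is a Boolean variable $x$ or its negation $\bar x$; a clause is a disjunction (set) of literals; a CNF formula is a conjunction (set) of clauses; a 3-CNF formula has clauses with at most 3 literals. Resolution: a resolution derivation of a clause $C$ from a CNF $F$ is a sequence of clauses $(C_1,\dots,C_\tau)$ with $C_\tau=C$ where each $C_t$ is either a clause of $F$, or $A\lor B$ where $C_i=A\lor x$ and $C_j=B\lor\bar x$ with $i,j<t$ (resolution), or a superset of some $C_i$, $i<t$ (weakening). A refutation is a derivation of the empty clause. Its size is $\tau$, its width is the maximum number of literals in a clause. Associate a DAG with edges from the premises of each inference/weakening step to its conclusion; the space at time $t$ is the number of clauses $C_i$ with $i\le t$ having an edge to some $C_j$ with $j\ge t$, plus $C_t$ itself; the space of the refutation is the maximum over $t$. PCR: fix a field $\mathbb F$. A CNF over $x_1,\dots,x_n$ is translated into polynomials in $\mathbb F[x_1,\dots,x_n,\bar x_1,\dots,\bar x_n]$ (the $\bar x_i$ being formally independent variables; true is $0$, false is $1$): the clause $\bigvee_{i\in I}x_i\lor\bigvee_{j\in J}\bar x_j$ becomes $\prod_{i\in I}x_i\prod_{j\in J}\bar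 x_j$. A PCR derivation is a sequence of polynomials each of which is a Boolean axiom $x^2-x$ (for any variable, including twins), a complementarity axiom $1-x-\bar x$, a translated clause, a linear combination $\alpha p_i+\beta p_j$ ($\alpha,\beta\in\mathbb F$) of earlier polynomials, or $x p_i$ for an earlier $p_i$ and a variable $x$. A refutation derives $1$. Its size is the total number of terms (monomials with nonzero coefficient) of all polynomials in it. Sherali-Adams (SA): a clause $\bigvee_{i\in I}x_i\lor\bigvee_{j\in J}\bar x_j$ is encoded as the real inequality $\sum_{i\in I}x_i+\sum_{j\in J}(1-x_j)-1\ge0$ (true is $1$). An SA derivation of $r\ge0$ from $q_1\ge0,\dots,q_m\ge0$ is an expression $\sum_{t=1}^{\tau}\alpha_t\prod_{i\in I_t}x_i\prod_{j\in J_t}(1-x_j)\,p_t$ with reals $\alpha_t\ge0$ and each $p_t$ one of the $q_j$, an axiom $x_i^2-x_i$ or $x_i-x_i^2$, or the constant $1$, which expands to $r$. A refutation is a derivation of $-1\ge0$ from the encoding of the clauses. Its size is the sum, over $t$, of the number of terms of the polynomial to which $\prod_{i\in I_t}x_i\prod_{j\in J_t}(1-x_j)p_t$ expands. *)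

theory Defs
  imports
    Complex_Main
    "HOL-Library.Poly_Mapping"
    "HOL-Library.Landau_Symbols"
begin

section \<open>CNF formulas\<close>

datatype 'v lit = Pos (var: 'v) | Neg (var: 'v)

type_synonym 'v clause = "'v lit set"
type_synonym 'v cnf = "'v clause set"

definition three_cnf :: "'v cnf \<Rightarrow> bool" where
  "three_cnf F \<longleftrightarrow> finite F \<and> (\<forall>C\<in>F. finite C \<and> card C \<le> 3)"

definition vars :: "'v cnf \<Rightarrow> 'v set" where
  "vars F = (\<Union>C\<in>F. var ` C)"

section \<open>Resolution\<close>

text \<open>
  Every line of a derivation carries the rule it was obtained by together with the (0-based)
  positions of the premises; this fixes the edges of the associated DAG. Repetitions of the same
  clause are different lines, and in particular an axiom may be introduced several times.
\<close>

datatype rule = Axiom | Resolve nat nat | Weaken nat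

fun premise_idx :: "rule \<Rightarrow> nat set" where
  "premise_idx Axiom = {}"
| "premise_idx (Resolve i j) = {i, j}"
| "premise_idx (Weaken i) = {i}"

type_synonym 'v res_proof = "('v clause \<times> rule) list"

fun res_step :: "'v cnf \<Rightarrow> (nat \<Rightarrow> 'v clause) \<Rightarrow> 'v clause \<Rightarrow> rule \<Rightarrow> bool" where
  "res_step F D C Axiom \<longleftrightarrow> C \<in> F"
| "res_step F D C (Resolve i j) \<longleftrightarrow>
     (\<exists>x A B. D i = insert (Pos x) A \<and> D j = insert (Neg x) B \<and> C = A \<union> B)"
| "res_step F D C (Weaken i) \<longleftrightarrow> D i \<subseteq> C"

definition res_derivation :: "'v cnf \<Rightarrow> 'v clause \<Rightarrow> 'v res_proof \<Rightarrow> bool" where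
  "res_derivation F C \<pi> \<longleftrightarrow>
     \<pi> \<noteq> [] \<and> fst (last \<pi>) = C \<and>
     (\<forall>t<length \<pi>. finite (fst (\<pi> ! t)) \<and>
        (\<forall>i\<in>premise_idx (snd (\<pi> ! t)). i < t) \<and>
        res_step F (\<lambda>i. fst (\<pi> ! i)) (fst (\<pi> ! t)) (snd (\<pi> ! t)))"

definition res_refutation :: "'v cnf \<Rightarrow> 'v res_proof \<Rightarrow> bool" where
  "res_refutation F \<pi> \<longleftrightarrow> res_derivation F {} \<pi>"

definition res_size :: "'v res_proof \<Rightarrow> nat" where
  "res_size \<pi> = length \<pi>"

definition res_width :: "'v res_proof \<Rightarrow> nat" where
  "res_width \<pi> = Max ((\<lambda>t. card (fst (\<pi> ! t))) ` {..<length \<pi>})"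

definition res_space_at :: "'v res_proof \<Rightarrow> nat \<Rightarrow> nat" where
  "res_space_at \<pi> t =
     card ({i. i \<le> t \<and> (\<exists>j. t \<le> j \<and> j < length \<pi> \<and> i \<in> premise_idx (snd (\<pi> ! j)))} \<union> {t})"

definition res_space :: "'v res_proof \<Rightarrow> nat" where
  "res_space \<pi> = Max (res_space_at \<pi> ` {..<length \<pi>})"

section \<open>Polynomials\<close>

text \<open>
  Polynomials are finitely supported maps from monomials to coefficients, and monomials are
  finitely supported maps from variables to exponents; multiplication is the convolution product
  of \<^theory>\<open>HOL-Library.Poly_Mapping\<close>.
\<close>

type_synonym ('x, 'k) mpoly = "('x \<Rightarrow>\<^sub>0 nat) \<Rightarrow>\<^sub>0 'k"

definition PVar :: "'x \<Rightarrow> ('x, 'k::comm_ring_1) mpoly" where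
  "PVar x = Poly_Mapping.single (Poly_Mapping.single x 1) 1"

definition PConst :: "'k \<Rightarrow> ('x, 'k::comm_ring_1) mpoly" where
  "PConst a = Poly_Mapping.single 0 a"

definition num_terms :: "('x, 'k::comm_ring_1) mpoly \<Rightarrow> nat" where
  "num_terms p = card (Poly_Mapping.keys p)"

section \<open>Polynomial calculus resolution\<close>

text \<open>
  The literals themselves are the formal variables: \<open>Pos x\<close> plays the role of \<open>x\<close> and
  \<open>Neg x\<close> that of its twin. Since true is 0, a clause is the product of its literals.
  The lines live in the polynomial ring over the variables of the formula and their twins, so
  Boolean axioms, complementarity axioms and multiplication only involve those.
\<close>

definition pcr_clause :: "'v clause \<Rightarrow> ('v lit, 'k::field) mpoly" where
  "pcr_clause C = (\<Prod>l\<in>C. PVar l)"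

definition pcr_step :: "'v cnf \<Rightarrow> ('v lit, 'k::field) mpoly list \<Rightarrow> nat \<Rightarrow> bool" where
  "pcr_step F ps t \<longleftrightarrow>
     (\<exists>l. var l \<in> vars F \<and> ps ! t = PVar l ^ 2 - PVar l) \<or>
     (\<exists>x\<in>vars F. ps ! t = 1 - PVar (Pos x) - PVar (Neg x)) \<or>
     (\<exists>C\<in>F. ps ! t = pcr_clause C) \<or>
     (\<exists>i<t. \<exists>j<t. \<exists>\<alpha> \<beta>. ps ! t = PConst \<alpha> * ps ! i + PConst \<beta> * ps ! j) \<or>
     (\<exists>i<t. \<exists>l. var l \<in> vars F \<and> ps ! t = PVar l * ps ! i)"

definition pcr_refutation :: "'v cnf \<Rightarrow> ('v lit, 'k::field) mpoly list \<Rightarrow> bool" where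
  "pcr_refutation F ps \<longleftrightarrow> ps \<noteq> [] \<and> last ps = 1 \<and> (\<forall>t<length ps. pcr_step F ps t)"

definition pcr_size :: "('v lit, 'k::field) mpoly list \<Rightarrow> nat" where
  "pcr_size ps = (\<Sum>p\<leftarrow>ps. num_terms p)"

section \<open>Sherali-Adams\<close>

text \<open>Here true is 1, and a polynomial \<open>q\<close> stands for the inequality \<open>q \<ge> 0\<close>.\<close>

definition sa_clause :: "'v clause \<Rightarrow> ('v, real) mpoly" where
  "sa_clause C = (\<Sum>x\<in>{x. Pos x \<in> C}. PVar x) + (\<Sum>x\<in>{x. Neg x \<in> C}. 1 - PVar x) - 1"

text \<open>
  A proof is the list of its summands: \<open>(\<alpha>, I, J, p)\<close> stands for
  \<open>\<alpha> * (\<Prod>i\<in>I. x\<^sub>i) * (\<Prod>j\<in>J. 1 - x\<^sub>j) * p\<close>. The sets \<open>I\<close> and \<open>J\<close> need not be disjoint.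
\<close>

type_synonym 'v sa_proof = "(real \<times> 'v set \<times> 'v set \<times> ('v, real) mpoly) list"

definition sa_product :: "'v set \<Rightarrow> 'v set \<Rightarrow> ('v, real) mpoly \<Rightarrow> ('v, real) mpoly" where
  "sa_product I J p = (\<Prod>i\<in>I. PVar i) * (\<Prod>j\<in>J. 1 - PVar j) * p"

definition sa_axioms :: "'v set \<Rightarrow> ('v, real) mpoly set" where
  "sa_axioms V = (\<lambda>x. PVar x ^ 2 - PVar x) ` V \<union> (\<lambda>x. PVar x - PVar x ^ 2) ` V \<union> {1}"

definition sa_derivation ::
    "'v set \<Rightarrow> ('v, real) mpoly set \<Rightarrow> ('v, real) mpoly \<Rightarrow> 'v sa_proof \<Rightarrow> bool" where
  "sa_derivation V Q r \<pi> \<longleftrightarrow>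
     (\<forall>(\<alpha>, I, J, p)\<in>set \<pi>. 0 \<le> \<alpha> \<and> finite I \<and> I \<subseteq> V \<and> finite J \<and> J \<subseteq> V \<and> p \<in> Q \<union> sa_axioms V) \<and>
     (\<Sum>(\<alpha>, I, J, p)\<leftarrow>\<pi>. PConst \<alpha> * sa_product I J p) = r"

definition sa_refutation :: "'v cnf \<Rightarrow> 'v sa_proof \<Rightarrow> bool" where
  "sa_refutation F \<pi> \<longleftrightarrow> sa_derivation (vars F) (sa_clause ` F) (- 1) \<pi>"

definition sa_size :: "'v sa_proof \<Rightarrow> nat" where
  "sa_size \<pi> = (\<Sum>(\<alpha>, I, J, p)\<leftarrow>\<pi>. num_terms (sa_product I J p))"

end

theory Submission
  imports
    Defs
    "HOL-Library.FuncSet"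
    "HOL-Library.Nat_Bijection"
    "HOL-Library.Countable"
begin

text \<open>
  Take an unsatisfiable 3-CNF on \<open>k = \<Theta>(w)\<close> variables with \<open>6 k\<close> clauses whose clause-variable graph is a
  boundary expander for sets of linear size. Give every variable and every clause of it a row of
  \<open>m \<approx> \<surd>(n / k)\<close> places and a pointer to one of them; the value of a variable, respectively the index
  of a true literal of a clause, is only read off at the place pointed to. Branching on all pointers and
  values refutes the lifted formula in size \<open>m\<close> to the \<open>O(w)\<close> and in width and space \<open>O(w)\<close>.

  For the lower bounds, choose the pointers and the values at all other places at random. A clause (or
  monomial, or Sherali-Adams product) that mentions many places of a row is killed by one of these values, and
  one that mentions few places is unlikely to mention the active one. Hence it survives with dependence on
  more than \<open>3 w\<close> base variables with probability at most \<open>2\<close> to the \<open>O(w)\<close> over \<open>m\<close> to the \<open>w\<close>. After a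
  restriction that is good for the whole refutation, all lines have low degree over the base formula. This is
  impossible: for resolution and Sherali-Adams by the pseudo-expectation of the system of parity constraints that imply
  the base clauses, and for PCR over any field by the reduction operator of Alekhnovich and Razborov.
\<close>

section \<open>Expanding unsatisfiable clause sets\<close>

text \<open>The base formula alone has refutations of size 2 to the O(w). The pointers turn each row
  on which a surviving line depends into a factor of about \<open>2 / m\<close>, and
  \<open>m\<close> is at least a fixed power of \<open>n\<close> because the exponent
  \<open>c\<close> is below 1/2. The counting losses are only single exponential in w, so a smaller
  constant in the exponent of \<open>n\<close> absorbs them. Clauses get rows of their own so that
  only pairs of places interact, which keeps the width at 3 and the number of clauses at O(k m^2).
  Two degree arguments are needed because an unsatisfiable linear system is refuted in degree 1 in
  characteristic 2, so the parities are of no use for PCR over an arbitrary field. The PCR argument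
  keeps the base clauses themselves and relies on the fact that one variable private to a clause
  suffices to satisfy it. Both arguments rest on the same gap: two sets of at most \<open>q\<close>
  constraints combine to at most \<open>2 * q\<close>, where expansion still applies. If the
  boundary of the combination lies in a set of at most \<open>q / 2\<close> variables, expansion
  brings its size back to at most \<open>q\<close>.\<close>

definition boundary :: "(nat \<Rightarrow> nat set) \<Rightarrow> nat set \<Rightarrow> nat set" where
  "boundary N I = {x. \<exists>!g. g \<in> I \<and> x \<in> N g}"

text \<open>Double counting of incidences: a variable of the neighbourhood outside the boundary lies
  in at least two of the \<open>N g\<close>, and there are at most \<open>3 * card I\<close>
  incidences. A neighbourhood of about \<open>7/4 * card I\<close> variables thus forces a boundary
  of half the size of \<open>I\<close>.\<close>

lemma boundary_ge:
  assumes "finite I" and N: "\<And>g. g \<in> I \<Longrightarrow> finite (N g) \<and> card (N g) \<le> 3"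
  shows "2 * card (\<Union>g\<in>I. N g) \<le> card (boundary N I) + 3 * card I"
proof -
  let ?U = "\<Union>g\<in>I. N g"
  let ?m = "\<lambda>x. card {g \<in> I. x \<in> N g}"
  have U: "finite ?U" using assms by auto
  have bU: "boundary N I \<subseteq> ?U" by (auto simp: boundary_def)
  have one: "x \<in> boundary N I \<or> 2 \<le> ?m x" if "x \<in> ?U" for x
  proof (rule disjCI)
    assume "\<not> 2 \<le> ?m x"
    moreover have "?m x \<noteq> 0" using that assms(1) by auto
    ultimately have "?m x = 1" by linarith
    then obtain g where g: "{g \<in> I. x \<in> N g} = {g}" by (auto simp: card_1_singleton_iff)
    have "\<exists>!g. g \<in> I \<and> x \<in> N g"
    proof (rule ex1I[of _ g])
      show "g \<in> I \<and> x \<in> N g" using g by blast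
      show "g' = g" if "g' \<in> I \<and> x \<in> N g'" for g' using g that by blast
    qed
    then show "x \<in> boundary N I" by (simp add: boundary_def)
  qed
  have pos: "1 \<le> ?m x" if "x \<in> ?U" for x
    using that assms(1) by (auto simp: Suc_le_eq card_gt_0_iff)
  have "2 * card ?U = (\<Sum>x\<in>?U. 2)" by simp
  also have "\<dots> \<le> (\<Sum>x\<in>?U. ?m x + of_bool (x \<in> boundary N I))"
    by (rule sum_mono) (use one pos in \<open>fastforce\<close>)
  also have "\<dots> = (\<Sum>x\<in>?U. ?m x) + card (?U \<inter> boundary N I)"
    using U by (simp add: sum.distrib of_bool_def sum.If_cases Int_def)
  also have "?U \<inter> boundary N I = boundary N I" using bU by blast
  also have "(\<Sum>x\<in>?U. ?m x) = (\<Sum>x\<in>?U. \<Sum>g\<in>I. of_bool (x \<in> N g))"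
    using assms(1) by (simp add: of_bool_def sum.If_cases Int_def)
  also have "\<dots> = (\<Sum>g\<in>I. \<Sum>x\<in>?U. of_bool (x \<in> N g))" by (rule sum.swap)
  also have "\<dots> = (\<Sum>g\<in>I. card (N g))"
  proof (rule sum.cong)
    fix g assume "g \<in> I"
    then have "?U \<inter> N g = N g" by blast
    then show "(\<Sum>x\<in>?U. of_bool (x \<in> N g)) = card (N g)"
      using U by (simp add: of_bool_def sum.If_cases flip: Int_def)
  qed simp
  also have "\<dots> \<le> (\<Sum>g\<in>I. 3)" by (rule sum_mono) (use N in blast)
  finally show ?thesis by simp
qed

section \<open>Counting non-expanding systems\<close>

lemma power_self_le_fact: "n ^ n \<le> 3 ^ n * (fact n :: nat)"
proof -
  have "summable (\<lambda>i. inverse (fact i) * (real n) ^ i)" by (rule summable_exp)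
  \<comment> \<open>\<open>n ^ n / fact n\<close> is a single term of the exponential series at
    \<open>n\<close>, and the sum of the series is at most \<open>3 ^ n\<close>.\<close>
  then have "(\<Sum>i\<in>{n}. inverse (fact i) * (real n) ^ i) \<le> suminf (\<lambda>i. inverse (fact i) * (real n) ^ i)"
    by (intro sum_le_suminf) auto
  also have "\<dots> = exp (real n)" by (simp add: exp_def scaleR_conv_of_real divide_inverse mult.commute)
  also have "\<dots> = exp 1 ^ n" by (simp add: exp_of_nat_mult[symmetric])
  also have "\<dots> \<le> 3 ^ n" by (intro power_mono exp_le) simp
  finally have "real n ^ n \<le> 3 ^ n * fact n" by (simp add: field_simps)
  then have "real (n ^ n) \<le> real (3 ^ n * fact n)" by simp
  then show ?thesis by (simp only: of_nat_le_iff)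
qed

lemma choose_le_power: "(n choose s) * s ^ s \<le> (3 * n) ^ s"
proof -
  have "(n choose s) * s ^ s \<le> (n choose s) * (3 ^ s * fact s)"
    by (intro mult_le_mono2 power_self_le_fact)
  also have "\<dots> = 3 ^ s * ((n choose s) * fact s)" by simp
  also have "\<dots> \<le> 3 ^ s * n ^ s" by (intro mult_le_mono2 binomial_fact_pow)
  finally show ?thesis by (simp add: power_mult_distrib)
qed

text \<open>Without \<open>2 ^ s\<close>, the left side is a union bound for the systems in which
  some \<open>s\<close> constraints have all their variables among some \<open>\<tau>\<close>
  variables; \<open>2 ^ s\<close> is the slack that lets the bounds for all sizes be summed. As a
  fraction of all systems this is about \<open>648 ^ s\<close> times the \<open>e\<close>-th power
  of \<open>2 * s / k\<close>, and \<open>s \<le> 4 * e\<close> is the origin of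
  \<open>648 ^ 4\<close>.\<close>

lemma non_expanding_count:
  fixes k M s \<tau> e :: nat
  assumes s: "1 \<le> s" "2 * 648 ^ 4 * s \<le> k" and M: "M = 6 * k" and e: "e = (s + 3) div 4"
    and \<tau>: "\<tau> = 2 * s - e" and sM: "s \<le> M"
  shows "(M choose s) * (k choose \<tau>) * \<tau> ^ (3 * s) * k ^ (3 * M - 3 * s) * 2 ^ s \<le> k ^ (3 * M)"
proof -
  have es: "e \<le> s" "s \<le> 4 * e" using s(1) e by linarith+
  have t: "3 * s = \<tau> + (s + e)" "\<tau> \<le> 2 * s" using es \<tau> by linarith+
  have "s ^ s * ((M choose s) * (k choose \<tau>) * \<tau> ^ (3 * s) * k ^ (3 * M - 3 * s) * 2 ^ s)
      = ((M choose s) * s ^ s) * ((k choose \<tau>) * \<tau> ^ \<tau>) * \<tau> ^ (s + e) * k ^ (3 * M - 3 * s) * 2 ^ s"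
    unfolding t(1) by (simp add: power_add)
  also have "\<dots> \<le> (3 * M) ^ s * (3 * k) ^ \<tau> * (2 * s) ^ (s + e) * k ^ (3 * M - 3 * s) * 2 ^ s"
    by (intro mult_le_mono choose_le_power power_mono t(2)) auto
  also have "\<dots> \<le> (3 * M) ^ s * (3 ^ (2 * s) * k ^ \<tau>) * (2 * s) ^ (s + e) * k ^ (3 * M - 3 * s) * 2 ^ s"
  proof -
    have "(3::nat) ^ \<tau> \<le> 3 ^ (2 * s)" by (intro power_increasing t(2)) simp
    then show ?thesis unfolding power_mult_distrib[of 3 k] by (intro mult_le_mono order_refl)
  qed
  also have "\<dots> = s ^ s * (648 ^ s * (2 * s) ^ e) * (k ^ s * k ^ \<tau> * k ^ (3 * M - 3 * s))"
  proof -
    \<comment> \<open>18 comes from \<open>3 * M = 18 * k\<close>, 9 from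
      \<open>3 ^ (2 * s)\<close>, one 2 from \<open>\<tau> \<le> 2 * s\<close> and the other is the
      summation slack.\<close>
    have "(648::nat) = 18 * 9 * 2 * 2" by simp
    then have "(648::nat) ^ s = 18 ^ s * 9 ^ s * 2 ^ s * 2 ^ s" by (metis power_mult_distrib)
    moreover have "(3::nat) ^ (2 * s) = 9 ^ s" by (simp add: power_mult)
    ultimately show ?thesis unfolding M by (simp add: power_mult_distrib power_add)
  qed
  also have "\<dots> \<le> s ^ s * k ^ e * (k ^ s * k ^ \<tau> * k ^ (3 * M - 3 * s))"
  proof -
    have "648 ^ s * (2 * s) ^ e \<le> (648 ^ 4) ^ e * (2 * s) ^ e"
      unfolding power_mult[symmetric] using es(2) by (intro mult_le_mono1 power_increasing) auto
    also have "\<dots> = (648 ^ 4 * (2 * s)) ^ e" by (simp only: power_mult_distrib)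
    also have "\<dots> \<le> k ^ e" by (rule power_mono) (use s(2) in auto)
    finally show ?thesis by (intro mult_le_mono order_refl)
  qed
  also have "\<dots> = s ^ s * k ^ (3 * M)"
  proof -
    have "3 * M = e + (s + \<tau> + (3 * M - 3 * s))" using t sM by linarith
    then show ?thesis by (metis power_add mult.assoc)
  qed
  finally have "s ^ s * ((M choose s) * (k choose \<tau>) * \<tau> ^ (3 * s) * k ^ (3 * M - 3 * s) * 2 ^ s)
      \<le> s ^ s * k ^ (3 * M)" .
  moreover have "0 < s ^ s" using s(1) by simp
  ultimately show ?thesis using mult_le_cancel1 by blast
qed

theorem expander_exists:
  fixes k r :: nat
  assumes r: "2 * 648 ^ 4 * r \<le> k" and k: "1 \<le> k"
  obtains h :: "nat \<Rightarrow> nat \<Rightarrow> nat"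
  where "\<And>g j. g < 6 * k \<Longrightarrow> j < 3 \<Longrightarrow> h g j < k"
    and "\<And>I. I \<subseteq> {..<6 * k} \<Longrightarrow> card I \<le> r \<Longrightarrow>
          card I \<le> 2 * card (boundary (\<lambda>g. h g ` {..<3}) I)"
proof -
  define M where "M = 6 * k"
  define \<Omega> where "\<Omega> = {..<3 * M} \<rightarrow>\<^sub>E {..<k}"
  define e where "e s = (s + 3) div 4" for s :: nat
  define \<tau> where "\<tau> s = 2 * s - e s" for s
  \<comment> \<open>A system is one map on \<open>3 * M\<close> positions, constraint
    \<open>g\<close> owning the positions \<open>3 * g + j\<close>; all choices of variables thus
    form a single \<open>PiE\<close>.\<close>
  define B where "B s I T = (PiE {..<3 * M} (\<lambda>i. if i div 3 \<in> I then T else {..<k}))" for s :: nat and I T :: "nat set"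
  define pow where "pow n s = {I. I \<subseteq> {..<n} \<and> card I = s}" for n s :: nat
  define Bad where "Bad s = (\<Union>I\<in>pow M s. \<Union>T\<in>pow k (\<tau> s). B s I T)" for s
  have fin: "finite (pow n s)" for n s by (simp add: pow_def)
  have cpow: "card (pow n s) = n choose s" for n s
    unfolding pow_def using n_subsets[of "{..<n}" s] by simp
  have cB: "card (B s I T) = \<tau> s ^ (3 * s) * k ^ (3 * M - 3 * s)"
    if I: "I \<in> pow M s" and T: "T \<in> pow k (\<tau> s)" for s I T
  proof -
    have fI: "finite I" "I \<subseteq> {..<M}" "card I = s" using I by (auto simp: pow_def intro: finite_subset)
    have eq: "{..<3 * M} \<inter> {i. i div 3 \<in> I} = (\<lambda>(g, j). 3 * g + j) ` (I \<times> {..<3})" (is "?L = ?R")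
    proof
      show "?L \<subseteq> ?R"
      proof
        fix i assume "i \<in> ?L"
        then have "(i div 3, i mod 3) \<in> I \<times> {..<3}" by auto
        then show "i \<in> ?R" by (rule rev_image_eqI) simp
      qed
      show "?R \<subseteq> ?L" using fI(2) by auto
    qed
    have inj: "inj_on (\<lambda>(g, j). 3 * g + j) (I \<times> {..<3::nat})"
      by (auto simp: inj_on_def) presburger+
    have c1: "card ({..<3 * M} \<inter> {i. i div 3 \<in> I}) = 3 * s"
      unfolding eq card_image[OF inj] by (simp add: card_cartesian_product fI)
    have c2: "card ({..<3 * M} \<inter> - {i. i div 3 \<in> I}) = 3 * M - 3 * s"
      using c1 card_Diff_subset_Int[of "{..<3 * M}" "{i. i div 3 \<in> I}"] by (simp add: Diff_eq)
    show ?thesis unfolding B_def using T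
      by (simp add: card_PiE if_distrib prod.If_cases c1 c2 pow_def cong: if_cong)
  qed
  have fB: "finite (B s I T)" if "T \<in> pow k t" for s t I T
    unfolding B_def using that by (intro finite_PiE) (auto simp: pow_def intro: finite_subset)
  have cBad: "card (Bad s) * 2 ^ s \<le> k ^ (3 * M)" if s: "s \<in> {1..r}" for s
  proof -
    have rk: "2 * 648 ^ 4 * s \<le> k" using s r by simp
    have "card (Bad s) \<le> (\<Sum>I\<in>pow M s. card (\<Union>T\<in>pow k (\<tau> s). B s I T))"
      unfolding Bad_def by (rule card_UN_le[OF fin])
    also have "\<dots> \<le> (\<Sum>I\<in>pow M s. \<Sum>T\<in>pow k (\<tau> s). card (B s I T))"
      by (intro sum_mono card_UN_le[OF fin])
    also have "\<dots> = (M choose s) * (k choose \<tau> s) * (\<tau> s ^ (3 * s) * k ^ (3 * M - 3 * s))"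
      by (simp add: cB cpow)
    finally have "card (Bad s) * 2 ^ s \<le> (M choose s) * (k choose \<tau> s) * \<tau> s ^ (3 * s) * k ^ (3 * M - 3 * s) * 2 ^ s"
      by (simp add: mult.assoc)
    also have "\<dots> \<le> k ^ (3 * M)"
      by (rule non_expanding_count[of s k M "e s" "\<tau> s"]) (use s rk in \<open>auto simp: M_def e_def \<tau>_def\<close>)
    finally show ?thesis .
  qed
  have "real (card (\<Union>s\<in>{1..r}. Bad s)) \<le> (\<Sum>s\<in>{1..r}. real (card (Bad s)))"
    by (metis card_UN_le finite_atLeastAtMost of_nat_le_iff of_nat_sum)
  also have "\<dots> \<le> (\<Sum>s\<in>{1..r}. real (k ^ (3 * M)) * (1/2) ^ s)"
  proof (rule sum_mono)
    fix s assume "s \<in> {1..r}"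
    from cBad[OF this] have "real (card (Bad s) * 2 ^ s) \<le> real (k ^ (3 * M))" by (simp only: of_nat_le_iff)
    then show "real (card (Bad s)) \<le> real (k ^ (3 * M)) * (1/2) ^ s"
      by (simp add: power_divide field_simps)
  qed
  also have "\<dots> = real (k ^ (3 * M)) * (\<Sum>s\<in>{1..r}. (1/2) ^ s)" by (simp add: sum_distrib_left)
  also have "(\<Sum>s\<in>{1..r}. (1/2::real) ^ s) = 1 - (1/2) ^ r" by (induction r) auto
  \<comment> \<open>The geometric sum stays strictly below 1, so some system expands for all sizes
    up to \<open>r\<close> at once.\<close>
  also have "real (k ^ (3 * M)) * (1 - (1/2) ^ r) < real (k ^ (3 * M))" using k by simp
  also have "real (k ^ (3 * M)) = real (card \<Omega>)" by (simp add: \<Omega>_def card_funcsetE)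
  finally have lt: "card (\<Union>s\<in>{1..r}. Bad s) < card \<Omega>" by simp
  have "finite (\<Union>s\<in>{1..r}. Bad s)" unfolding Bad_def using fin fB by auto
  then have "\<not> \<Omega> \<subseteq> (\<Union>s\<in>{1..r}. Bad s)" using lt card_mono leD by blast
  then obtain f where f: "f \<in> \<Omega>" "\<And>s. s \<in> {1..r} \<Longrightarrow> f \<notin> Bad s" by blast
  define h where "h g j = f (3 * g + j)" for g j
  have hk: "h g j < k" if "g < 6 * k" "j < 3" for g j
    using f(1) that by (auto simp: h_def \<Omega>_def M_def PiE_iff)
  show ?thesis
  proof (rule that[of h])
    show "h g j < k" if "g < 6 * k" "j < 3" for g j using hk[OF that] .
  next
    fix I assume I: "I \<subseteq> {..<6 * k}" "card I \<le> r"
    let ?N = "\<lambda>g. h g ` {..<3}"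
    let ?U = "\<Union>g\<in>I. ?N g"
    define s where "s = card I"
    have fI: "finite I" using I(1) finite_subset by blast
    show "card I \<le> 2 * card (boundary ?N I)"
    proof (cases "s = 0")
      case False
      then have s: "s \<in> {1..r}" using I(2) by (simp add: s_def)
      have Uk: "?U \<subseteq> {..<k}" using hk I(1) by blast
      have "2 * s \<le> k" using s r by simp
      then have \<tau>k: "\<tau> s \<le> k" by (simp add: \<tau>_def)
      \<comment> \<open>The strict inequality adds 2 to the bound on the boundary, and this covers
        the rounding up in \<open>e s\<close>, which costs at most 3/2.\<close>
      have "\<tau> s < card ?U"
      proof (rule ccontr)
        assume "\<not> \<tau> s < card ?U"
        then have "card ?U \<le> \<tau> s" by simp
        then obtain T where T: "?U \<subseteq> T" "T \<subseteq> {..<k}" "card T = \<tau> s"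
          using exists_subset_between[of ?U "\<tau> s" "{..<k}"] Uk \<tau>k by auto
        have "f i \<in> T" if "i div 3 \<in> I" for i
        proof -
          have "f i = h (i div 3) (i mod 3)" by (simp add: h_def)
          moreover have "h (i div 3) (i mod 3) \<in> ?U" using that by fastforce
          ultimately show ?thesis using T(1) by auto
        qed
        then have "f \<in> B s I T" using f(1) by (auto simp: B_def \<Omega>_def PiE_iff)
        moreover have "I \<in> pow M s" "T \<in> pow k (\<tau> s)" using I T by (auto simp: pow_def M_def s_def)
        ultimately have "f \<in> Bad s" unfolding Bad_def by blast
        then show False using f(2)[OF s] by blast
      qed
      moreover have "2 * card ?U \<le> card (boundary ?N I) + 3 * card I"
        by (rule boundary_ge[OF fI]) (auto intro: order_trans[OF card_image_le])
      ultimately show ?thesis unfolding \<tau>_def e_def s_def by linarith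
    qed (simp add: s_def)
  qed
qed

text \<open>Signs are chosen greedily: some pattern on \<open>N g\<close> is taken by an eighth of the remaining assignments.\<close>

lemma unsat_signs_exist:
  fixes N :: "nat \<Rightarrow> nat set" and k :: nat
  assumes N: "\<And>g. g < 6 * k \<Longrightarrow> N g \<subseteq> {..<k} \<and> card (N g) \<le> 3" and k: "1 \<le> k"
  obtains \<sigma> where "\<And>g. \<sigma> g \<subseteq> N g" "\<And>A. \<exists>g<6 * k. A \<inter> N g = \<sigma> g"
proof -
  have step: "\<exists>s\<subseteq>N g. 8 * card {A \<in> S. A \<inter> N g \<noteq> s} \<le> 7 * card S"
    if S: "finite S" and g: "g < 6 * k" for S :: "nat set set" and g
  proof (rule ccontr)
    assume "\<not> ?thesis"
    then have all: "7 * card S < 8 * card {A \<in> S. A \<inter> N g \<noteq> s}" if "s \<subseteq> N g" for s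
      using that not_le by blast
    have fN: "finite (N g)" using N[OF g] finite_subset by blast
    then have fin: "finite (Pow (N g))" by simp
    have "S = (\<Union>s\<in>Pow (N g). {A \<in> S. A \<inter> N g = s})"
    proof (intro equalityI subsetI)
      fix A assume "A \<in> S"
      then show "A \<in> (\<Union>s\<in>Pow (N g). {A \<in> S. A \<inter> N g = s})"
        by (intro UN_I[of "A \<inter> N g"]) simp_all
    qed simp
    then have "card S = card (\<Union>s\<in>Pow (N g). {A \<in> S. A \<inter> N g = s})" by (rule arg_cong)
    also have "\<dots> \<le> (\<Sum>s\<in>Pow (N g). card {A \<in> S. A \<inter> N g = s})" by (rule card_UN_le[OF fin])
    finally have le: "8 * card S \<le> (\<Sum>s\<in>Pow (N g). 8 * card {A \<in> S. A \<inter> N g = s})"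
      by (simp add: sum_distrib_left[symmetric])
    have lt: "8 * card {A \<in> S. A \<inter> N g = s} < card S" if "s \<subseteq> N g" for s
    proof -
      have "S = {A \<in> S. A \<inter> N g = s} \<union> {A \<in> S. A \<inter> N g \<noteq> s}" by (rule set_eqI) blast
      then have "card S = card ({A \<in> S. A \<inter> N g = s} \<union> {A \<in> S. A \<inter> N g \<noteq> s})" by (rule arg_cong)
      also have "\<dots> = card {A \<in> S. A \<inter> N g = s} + card {A \<in> S. A \<inter> N g \<noteq> s}"
        using S by (intro card_Un_disjoint) auto
      finally have "card S = card {A \<in> S. A \<inter> N g = s} + card {A \<in> S. A \<inter> N g \<noteq> s}" .
      then show ?thesis using all[OF that] by linarith
    qed
    have "(\<Sum>s\<in>Pow (N g). 8 * card {A \<in> S. A \<inter> N g = s}) < (\<Sum>s\<in>Pow (N g). card S)"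
      by (rule sum_strict_mono[OF fin]) (simp_all only: lt Pow_not_empty Pow_iff not_False_eq_True simp_thms)
    also have "\<dots> = 2 ^ card (N g) * card S" using fN by (simp add: card_Pow)
    also have "\<dots> \<le> 2 ^ 3 * card S" using N[OF g] by (intro mult_le_mono1 power_increasing) auto
    also have "2 ^ 3 * card S = 8 * card S" by simp
    finally show False using leD[OF le] by contradiction
  qed
  define pick where "pick g S = (SOME s. s \<subseteq> N g \<and> 8 * card {A \<in> S. A \<inter> N g \<noteq> s} \<le> 7 * card S)" for g and S :: "nat set set"
  define St where "St = rec_nat (Pow {..<k}) (\<lambda>g S. {A \<in> S. A \<inter> N g \<noteq> pick g S})"
  define \<sigma> where "\<sigma> g = (if g < 6 * k then pick g (St g) else {})" for g
  have pick: "pick g S \<subseteq> N g \<and> 8 * card {A \<in> S. A \<inter> N g \<noteq> pick g S} \<le> 7 * card S"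
    if "finite S" "g < 6 * k" for g S
    unfolding pick_def by (rule someI_ex[OF step[OF that]])
  have St0: "St 0 = Pow {..<k}" and StS: "St (Suc g) = {A \<in> St g. A \<inter> N g \<noteq> pick g (St g)}" for g
    by (auto simp: St_def)
  have fS: "finite (St g)" for g by (induction g) (auto simp: St0 StS)
  have small: "g \<le> 6 * k \<Longrightarrow> 8 ^ g * card (St g) \<le> 7 ^ g * 2 ^ k" for g
  proof (induction g)
    case 0 then show ?case by (simp add: St0 card_Pow)
  next
    case (Suc g)
    have "8 ^ Suc g * card (St (Suc g)) = 8 ^ g * (8 * card (St (Suc g)))" by simp
    also have "\<dots> \<le> 8 ^ g * (7 * card (St g))"
      using pick[OF fS, of g g] Suc.prems by (simp add: StS)
    also have "\<dots> \<le> 7 * (7 ^ g * 2 ^ k)" using Suc by simp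
    finally show ?case by simp
  qed
  have "card (St (6 * k)) = 0"
  proof (rule ccontr)
    assume "card (St (6 * k)) \<noteq> 0"
    then have "8 ^ (6 * k) * 1 \<le> 8 ^ (6 * k) * card (St (6 * k))" by (intro mult_le_mono2) simp
    also have "\<dots> \<le> 7 ^ (6 * k) * 2 ^ k" using small by blast
    finally have "(8 ^ 6) ^ k \<le> (7 ^ 6 * 2 :: nat) ^ k" by (simp only: power_mult power_mult_distrib mult_1_right)
    \<comment> \<open>This comparison is the origin of six constraints per variable; with five it
      would fail, as \<open>2 * 7 ^ 5 > 8 ^ 5\<close>.\<close>
    moreover have "(7 ^ 6 * 2 :: nat) ^ k < (8 ^ 6) ^ k" using k by (intro power_strict_mono) auto
    ultimately show False by simp
  qed
  then have empty: "St (6 * k) = {}" using fS by simp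
  have inv: "A \<subseteq> {..<k} \<Longrightarrow> g \<le> 6 * k \<Longrightarrow> \<forall>g'<g. A \<inter> N g' \<noteq> \<sigma> g' \<Longrightarrow> A \<in> St g" for A g
    by (induction g) (auto simp: St0 StS \<sigma>_def)
  show ?thesis
  proof (rule that[of \<sigma>])
    show "\<sigma> g \<subseteq> N g" for g using pick[OF fS] by (simp add: \<sigma>_def)
    fix A
    have "\<not> (\<forall>g<6 * k. (A \<inter> {..<k}) \<inter> N g \<noteq> \<sigma> g)"
      using inv[of "A \<inter> {..<k}" "6 * k"] empty by auto
    then obtain g where g: "g < 6 * k" "(A \<inter> {..<k}) \<inter> N g = \<sigma> g" by blast
    moreover have "(A \<inter> {..<k}) \<inter> N g = A \<inter> N g" using N[OF g(1)] by blast
    ultimately show "\<exists>g<6 * k. A \<inter> N g = \<sigma> g" by auto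
  qed
qed

section \<open>The parity pseudo-expectation\<close>

text \<open>An assignment is the set of its true variables, and \<open>f\<close> is a junta on
  \<open>T\<close>. The size of such a \<open>T\<close> replaces width and degree throughout, so a
  line that a restriction makes constant counts as trivial.\<close>

definition depends :: "'a set \<Rightarrow> ('a set \<Rightarrow> 'b) \<Rightarrow> bool" where
  "depends T f \<longleftrightarrow> (\<forall>A B. A \<inter> T = B \<inter> T \<longrightarrow> f A = f B)"

lemma dependsD: "depends T f \<Longrightarrow> A \<inter> T = B \<inter> T \<Longrightarrow> f A = f B"
  unfolding depends_def by blast

lemma depends_mono: "depends T f \<Longrightarrow> T \<subseteq> T' \<Longrightarrow> depends T' f"
  unfolding depends_def by blast

lemma depends_const [simp]: "depends T (\<lambda>_. c)"
  by (simp add: depends_def)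

lemma depends_map2: "depends T f \<Longrightarrow> depends T' g \<Longrightarrow> depends (T \<union> T') (\<lambda>A. h (f A) (g A))"
proof -
  assume f: "depends T f" and g: "depends T' g"
  show ?thesis unfolding depends_def
  proof (intro allI impI)
    fix A B assume AB: "A \<inter> (T \<union> T') = B \<inter> (T \<union> T')"
    have "A \<inter> T = B \<inter> T" "A \<inter> T' = B \<inter> T'" using AB by blast+
    then have "f A = f B" "g A = g B" using dependsD[OF f] dependsD[OF g] by blast+
    then show "h (f A) (g A) = h (f B) (g B)" by (simp only:)
  qed
qed

lemma depends_map: "depends T f \<Longrightarrow> depends T (\<lambda>A. h (f A))"
  using depends_map2[of T f T f "\<lambda>a _. h a"] by simp

text \<open>\<open>\<sigma> g\<close> is the one pattern on \<open>N g\<close> that constraint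
  \<open>g\<close> forbids. Expansion is asked for up to \<open>2 * q\<close> because it is applied
  to combinations of two sets of at most \<open>q\<close> constraints.\<close>

locale expanding_system =
  fixes k M q :: nat and N \<sigma> :: "nat \<Rightarrow> nat set"
  assumes N: "g < M \<Longrightarrow> N g \<subseteq> {..<k}" "g < M \<Longrightarrow> card (N g) \<le> 3"
    and expanding: "I \<subseteq> {..<M} \<Longrightarrow> card I \<le> 2 * q \<Longrightarrow> card I \<le> 2 * card (boundary N I)"
    and q: "1 \<le> q"
begin

definition sat :: "nat \<Rightarrow> nat set \<Rightarrow> bool" where
  "sat g A \<longleftrightarrow> A \<inter> N g \<noteq> \<sigma> g"

lemma fin_constr: "I \<subseteq> {..<M} \<Longrightarrow> finite I"
  using finite_subset by blast

lemma fin_N: "g < M \<Longrightarrow> finite (N g)"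
  using N(1) finite_subset by blast

text \<open>The sign is \<open>1\<close> iff \<open>A\<close> satisfies the parity constraint that rules out the parity of \<open>\<sigma> g\<close>;
  this constraint implies \<open>sat g\<close>.\<close>

definition eps :: "nat \<Rightarrow> nat set \<Rightarrow> real" where
  "eps g A = (if even (card (A \<inter> N g) + card (\<sigma> g)) then -1 else 1)"

definition flip :: "nat \<Rightarrow> nat set \<Rightarrow> nat set" where
  "flip x A = (if x \<in> A then A - {x} else insert x A)"

lemma flip_flip [simp]: "flip x (flip x A) = A"
  by (auto simp: flip_def)

lemma eps_cases: "eps g A = 1 \<or> eps g A = -1"
  by (auto simp: eps_def)

lemma eps_sat: "eps g A = 1 \<Longrightarrow> sat g A"
proof (unfold sat_def, rule notI)
  assume "eps g A = 1" "A \<inter> N g = \<sigma> g"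
  then show False by (simp add: eps_def)
qed

lemma eps_flip:
  assumes "g < M"
  shows "eps g (flip x A) = (if x \<in> N g then - eps g A else eps g A)"
proof -
  have f: "finite (A \<inter> N g)" using fin_N[OF assms] by simp
  consider "x \<notin> N g" | "x \<in> N g" "x \<in> A" | "x \<in> N g" "x \<notin> A" by blast
  then show ?thesis
  proof cases
    case 1
    then have "flip x A \<inter> N g = A \<inter> N g" by (auto simp: flip_def)
    with 1 show ?thesis by (simp add: eps_def)
  next
    case 2
    then have "A \<inter> N g = insert x (flip x A \<inter> N g)" "x \<notin> flip x A \<inter> N g" by (auto simp: flip_def)
    moreover from this have "card (A \<inter> N g) = Suc (card (flip x A \<inter> N g))"
      using f by (metis card_insert_disjoint finite_insert)
    ultimately show ?thesis using 2 by (simp add: eps_def)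
  next
    case 3
    then have "flip x A \<inter> N g = insert x (A \<inter> N g)" "x \<notin> A \<inter> N g" by (auto simp: flip_def)
    moreover from this have "card (flip x A \<inter> N g) = Suc (card (A \<inter> N g))"
      using f by (metis card_insert_disjoint)
    ultimately show ?thesis using 3 by (simp add: eps_def)
  qed
qed

text \<open>The character of the sum of the parity constraints in \<open>I\<close>: it is
  \<open>1\<close> exactly where \<open>A\<close> satisfies this sum.\<close>

definition psi :: "nat set \<Rightarrow> nat set \<Rightarrow> real" where
  "psi I A = (\<Prod>g\<in>I. eps g A)"

lemma psi_cases: "finite I \<Longrightarrow> psi I A = 1 \<or> psi I A = -1"
  unfolding psi_def
proof (induction I rule: finite_induct)
  case (insert g I)
  then show ?case using eps_cases[of g A] by auto
qed simp

lemma psi_flip: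
  assumes "I \<subseteq> {..<M}"
  shows "psi I (flip x A) = (-1) ^ card {g \<in> I. x \<in> N g} * psi I A"
proof -
  have "psi I (flip x A) = (\<Prod>g\<in>I. (if x \<in> N g then -1 else 1) * eps g A)"
    unfolding psi_def by (rule prod.cong) (use assms eps_flip in auto)
  also have "\<dots> = (\<Prod>g\<in>I. if x \<in> N g then -1 else 1) * psi I A"
    by (simp add: prod.distrib psi_def)
  also have "(\<Prod>g\<in>I. if x \<in> N g then -1 else (1::real)) = (-1) ^ card {g \<in> I. x \<in> N g}"
    using fin_constr[OF assms] by (simp add: prod.If_cases Int_def)
  finally show ?thesis .
qed

text \<open>Sets of at most \<open>q\<close> parity constraints whose sum only involves variables of \<open>T\<close>.\<close>

definition implied :: "nat set \<Rightarrow> nat set set" where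
  "implied T = {I. I \<subseteq> {..<M} \<and> card I \<le> q \<and> (\<forall>x\<in>{..<k} - T. even (card {g \<in> I. x \<in> N g}))}"

section \<open>Sums of parity constraints\<close>

definition sym_diff :: "nat set \<Rightarrow> nat set \<Rightarrow> nat set" where
  "sym_diff I J = (I - J) \<union> (J - I)"

lemma sym_diff_cancel [simp]: "sym_diff (sym_diff I J) J = I"
  by (auto simp: sym_diff_def)

lemma psi_sym_diff:
  assumes "finite I" "finite J"
  shows "psi (sym_diff I J) A = psi I A * psi J A"
proof -
  have split: "psi I A = psi (I - J) A * psi (I \<inter> J) A" if "finite I" for I J
    unfolding psi_def using prod.Int_Diff[OF that, of _ J] by (simp add: mult.commute)
  have 1: "psi I A = psi (I - J) A * psi (I \<inter> J) A" and 2: "psi J A = psi (J - I) A * psi (I \<inter> J) A"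
    using split[OF assms(1), of J] split[OF assms(2), of I] by (simp_all add: Int_commute)
  have 3: "psi (sym_diff I J) A = psi (I - J) A * psi (J - I) A"
    unfolding psi_def sym_diff_def using assms by (intro prod.union_disjoint) auto
  have "psi (I \<inter> J) A * psi (I \<inter> J) A = 1" using psi_cases[of "I \<inter> J" A] assms by auto
  then show ?thesis unfolding 1 2 3 by (simp add: algebra_simps)
qed

lemma sum_boundary_subset:
  assumes "I \<subseteq> {..<M}" "card I \<le> 2 * q" "finite T" "boundary N I \<subseteq> T"
  shows "card I \<le> 2 * card T"
  using expanding[OF assms(1,2)] card_mono[OF assms(3,4)] by linarith

lemma boundary_implied:
  assumes "I \<subseteq> {..<M}" "\<forall>x\<in>{..<k} - T. even (card {g \<in> I. x \<in> N g})"
  shows "boundary N I \<subseteq> T"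
proof
  fix x assume x: "x \<in> boundary N I"
  then obtain g where g: "g \<in> I" "x \<in> N g" and "\<And>g'. g' \<in> I \<Longrightarrow> x \<in> N g' \<Longrightarrow> g' = g"
    by (auto simp: boundary_def)
  then have "{g \<in> I. x \<in> N g} = {g}" by blast
  then have "odd (card {g \<in> I. x \<in> N g})" by simp
  moreover have "x \<in> {..<k}" using g N(1) assms(1) by blast
  ultimately show "x \<in> T" using assms(2) by blast
qed

lemma even_card_sym_diff:
  assumes "finite I" "finite J"
  shows "even (card {g \<in> sym_diff I J. P g}) \<longleftrightarrow> (even (card {g \<in> I. P g}) \<longleftrightarrow> even (card {g \<in> J. P g}))"
proof -
  have c: "card {g \<in> I \<union> J. P g \<and> Q g} = card {g \<in> I \<union> J. P g \<and> Q g \<and> R g} + card {g \<in> I \<union> J. P g \<and> Q g \<and> \<not> R g}" for Q R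
  proof -
    have "{g \<in> I \<union> J. P g \<and> Q g} = {g \<in> I \<union> J. P g \<and> Q g \<and> R g} \<union> {g \<in> I \<union> J. P g \<and> Q g \<and> \<not> R g}"
      by blast
    moreover have "card \<dots> = card {g \<in> I \<union> J. P g \<and> Q g \<and> R g} + card {g \<in> I \<union> J. P g \<and> Q g \<and> \<not> R g}"
      using assms by (intro card_Un_disjoint) auto
    ultimately show ?thesis by (simp only:)
  qed
  have a: "{g \<in> I. P g} = {g \<in> I \<union> J. P g \<and> g \<in> I}" "{g \<in> J. P g} = {g \<in> I \<union> J. P g \<and> g \<in> J}" by blast+
  have b: "card {g \<in> sym_diff I J. P g} = card {g \<in> I \<union> J. P g \<and> g \<in> I \<and> g \<notin> J} + card {g \<in> I \<union> J. P g \<and> g \<in> J \<and> g \<notin> I}"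
  proof -
    have "{g \<in> sym_diff I J. P g} = {g \<in> I \<union> J. P g \<and> g \<in> I \<and> g \<notin> J} \<union> {g \<in> I \<union> J. P g \<and> g \<in> J \<and> g \<notin> I}"
      unfolding sym_diff_def by blast
    moreover have "card \<dots> = card {g \<in> I \<union> J. P g \<and> g \<in> I \<and> g \<notin> J} + card {g \<in> I \<union> J. P g \<and> g \<in> J \<and> g \<notin> I}"
      using assms by (intro card_Un_disjoint) auto
    ultimately show ?thesis by (simp only:)
  qed
  have e: "{g \<in> I \<union> J. P g \<and> g \<in> I \<and> g \<in> J} = {g \<in> I \<union> J. P g \<and> g \<in> J \<and> g \<in> I}" by blast
  show ?thesis unfolding a b c[of "\<lambda>g. g \<in> I" "\<lambda>g. g \<in> J"] c[of "\<lambda>g. g \<in> J" "\<lambda>g. g \<in> I"] e by auto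
qed

text \<open>The sum may involve \<open>2 * q\<close> constraints at first sight. Every variable
  outside \<open>T\<close> occurs in it an even number of times, so its boundary lies in
  \<open>T\<close>, and expansion reduces its size to \<open>2 * card T \<le> q\<close>. Hence
  \<open>implied T\<close> is a group.\<close>

lemma implied_sym_diff:
  assumes I: "I \<in> implied T" and J: "J \<in> implied T" and T: "finite T" "2 * card T \<le> q"
  shows "sym_diff I J \<in> implied T"
proof -
  have IM: "I \<subseteq> {..<M}" "J \<subseteq> {..<M}" and c: "card I \<le> q" "card J \<le> q"
    using I J by (auto simp: implied_def)
  have sM: "sym_diff I J \<subseteq> {..<M}" using IM by (auto simp: sym_diff_def)
  have fin: "finite I" "finite J" using IM fin_constr by auto
  have "card (sym_diff I J) \<le> card (I - J) + card (J - I)" unfolding sym_diff_def by (rule card_Un_le)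
  also have "\<dots> \<le> card I + card J" using fin by (intro add_mono card_mono) auto
  finally have c2: "card (sym_diff I J) \<le> 2 * q" using c by linarith
  have ev: "\<forall>x\<in>{..<k} - T. even (card {g \<in> sym_diff I J. x \<in> N g})"
    using I J even_card_sym_diff[OF fin] by (auto simp: implied_def)
  have "card (sym_diff I J) \<le> 2 * card T"
    by (rule sum_boundary_subset[OF sM c2 T(1) boundary_implied[OF sM ev]])
  then show ?thesis using sM ev T(2) by (simp add: implied_def)
qed

text \<open>Adding \<open>J\<close> permutes the group \<open>implied T\<close> and negates every
  character at \<open>P\<close>, so the sum equals its own negative.\<close>

lemma sum_psi_negate:
  assumes T: "finite T" "2 * card T \<le> q" and J: "J \<in> implied T" "psi J P = -1"
  shows "(\<Sum>I\<in>implied T. psi I P) = 0"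
proof -
  have fin: "I \<in> implied T \<Longrightarrow> finite I" for I using fin_constr by (auto simp: implied_def)
  have "(\<Sum>I\<in>implied T. psi I P) = (\<Sum>I\<in>implied T. psi (sym_diff I J) P)"
    by (rule sum.reindex_bij_witness[of _ "\<lambda>I. sym_diff I J" "\<lambda>I. sym_diff I J"])
       (use implied_sym_diff[OF _ J(1) T] in auto)
  also have "\<dots> = - (\<Sum>I\<in>implied T. psi I P)"
    unfolding sum_negf[symmetric] by (rule sum.cong) (use J psi_sym_diff fin in auto)
  finally show ?thesis by simp
qed

lemma sum_psi_nonneg:
  assumes T: "finite T" "2 * card T \<le> q"
  shows "0 \<le> (\<Sum>I\<in>implied T. psi I P)"
proof (cases "\<exists>J\<in>implied T. psi J P = -1")
  case True
  then show ?thesis using sum_psi_negate[OF T] by auto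
next
  case False
  have "finite I" if "I \<in> implied T" for I using that fin_constr by (auto simp: implied_def)
  then have "psi I P = 1" if "I \<in> implied T" for I using that False psi_cases by blast
  then show ?thesis by (intro sum_nonneg) simp
qed

section \<open>The truncated density and its marginals\<close>

definition cyl :: "nat set \<Rightarrow> nat set \<Rightarrow> nat set set" where
  "cyl T P = {A \<in> Pow {..<k}. A \<inter> T = P}"

text \<open>If some variable outside \<open>T\<close> occurs an odd number of times in the sum of
  \<open>I\<close>, flipping it is a sign-reversing involution of the cylinder. Otherwise the
  character does not see the variables outside \<open>T\<close> and is constant there.\<close>

lemma sum_psi_cyl:
  assumes "T \<subseteq> {..<k}" "P \<subseteq> T" "I \<subseteq> {..<M}" "card I \<le> q"
  shows "(\<Sum>A\<in>cyl T P. psi I A) = (if I \<in> implied T then real (card (cyl T P)) * psi I P else 0)"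
proof (cases "I \<in> implied T")
  case True
  have "psi I (P \<union> B) = psi I P" if "finite B" "B \<subseteq> {..<k} - T" for B
    using that
  proof (induction B rule: finite_induct)
    case (insert x B)
    have "x \<notin> P" using insert.prems assms(2) by auto
    then have "P \<union> insert x B = flip x (P \<union> B)" using insert.hyps by (auto simp: flip_def)
    moreover have "even (card {g \<in> I. x \<in> N g})" using True insert.prems by (auto simp: implied_def)
    ultimately show ?case using insert psi_flip[OF assms(3)] by simp
  qed simp
  moreover have "A = P \<union> (A - T)" "finite (A - T)" "A - T \<subseteq> {..<k} - T" if "A \<in> cyl T P" for A
    using that by (auto simp: cyl_def intro: finite_subset)
  ultimately have "psi I A = psi I P" if "A \<in> cyl T P" for A using that by metis
  with True show ?thesis by simp
next
  case False
  then obtain x where x: "x \<in> {..<k} - T" "odd (card {g \<in> I. x \<in> N g})"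
    using assms by (auto simp: implied_def)
  have fl: "flip x A \<in> cyl T P" if "A \<in> cyl T P" for A
    using that x(1) by (auto simp: cyl_def flip_def)
  have "(\<Sum>A\<in>cyl T P. psi I A) = (\<Sum>A\<in>cyl T P. psi I (flip x A))"
    by (rule sum.reindex_bij_witness[of _ "flip x" "flip x"])
       (use fl in auto)
  also have "\<dots> = - (\<Sum>A\<in>cyl T P. psi I A)"
    using x(2) by (simp add: psi_flip[OF assms(3)] sum_negf)
  finally show ?thesis using False by simp
qed

text \<open>Summed over all \<open>I\<close>, this would be the product of all
  \<open>1 + eps g A\<close>, that is \<open>2 ^ M\<close> times the indicator of the solutions,
  which is zero for an unsatisfiable system. Truncation at \<open>q\<close> leaves a signed density
  that few variables cannot tell from a distribution on solutions.\<close>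

definition weight :: "nat set \<Rightarrow> real" where
  "weight A = (\<Sum>I | I \<subseteq> {..<M} \<and> card I \<le> q. psi I A)"

definition pexp :: "(nat set \<Rightarrow> real) \<Rightarrow> real" where
  "pexp f = (\<Sum>A\<in>Pow {..<k}. f A * weight A) / 2 ^ k"

lemma pexp_add: "pexp (\<lambda>A. f A + g A) = pexp f + pexp g"
  by (simp add: pexp_def algebra_simps sum.distrib add_divide_distrib)

lemma pexp_cmult: "pexp (\<lambda>A. c * f A) = c * pexp f"
  by (simp add: pexp_def sum_distrib_left mult.assoc)

lemma pexp_diff: "pexp (\<lambda>A. f A - g A) = pexp f - pexp g"
  using pexp_add[of f "\<lambda>A. -1 * g A"] pexp_cmult[of "-1" g] by simp

lemma sum_weight_cyl:
  assumes "T \<subseteq> {..<k}" "P \<subseteq> T"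
  shows "(\<Sum>A\<in>cyl T P. weight A) = real (card (cyl T P)) * (\<Sum>I\<in>implied T. psi I P)"
proof -
  let ?S = "{I. I \<subseteq> {..<M} \<and> card I \<le> q}"
  have fin: "finite ?S" by (rule finite_subset[of _ "Pow {..<M}"]) auto
  have sub: "implied T \<subseteq> ?S" by (auto simp: implied_def)
  have "(\<Sum>A\<in>cyl T P. weight A) = (\<Sum>I\<in>?S. \<Sum>A\<in>cyl T P. psi I A)"
    unfolding weight_def by (rule sum.swap)
  also have "\<dots> = (\<Sum>I\<in>?S. if I \<in> implied T then real (card (cyl T P)) * psi I P else 0)"
    by (rule sum.cong) (use sum_psi_cyl[OF assms] in auto)
  also have "\<dots> = (\<Sum>I\<in>implied T. real (card (cyl T P)) * psi I P)"
    using fin sub by (simp add: sum.If_cases Int_absorb1)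
  finally show ?thesis by (simp add: sum_distrib_left)
qed

text \<open>Split by the values \<open>P\<close> on \<open>T\<close>. The mass of each cylinder is a
  nonnegative character sum, and it vanishes when \<open>P\<close> violates a constraint inside
  \<open>T\<close>. So \<open>f\<close> has to be nonnegative only at locally consistent
  \<open>P\<close>, which is how initial clauses are handled below.\<close>

theorem pexp_nonneg:
  assumes T: "T \<subseteq> {..<k}" "2 * card T \<le> q" and f: "depends T f"
    and pos: "\<And>P. P \<subseteq> T \<Longrightarrow> (\<And>g. g < M \<Longrightarrow> N g \<subseteq> T \<Longrightarrow> sat g P) \<Longrightarrow> 0 \<le> f P"
  shows "0 \<le> pexp f"
proof -
  have fT: "finite T" using T(1) finite_subset by blast
  have "(\<Sum>A\<in>Pow {..<k}. f A * weight A) = (\<Sum>P\<in>Pow T. \<Sum>A\<in>{A \<in> Pow {..<k}. A \<inter> T = P}. f A * weight A)"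
    using fT by (subst sum.group) auto
  also have "\<dots> = (\<Sum>P\<in>Pow T. f P * (\<Sum>A\<in>cyl T P. weight A))"
  proof (rule sum.cong)
    fix P assume "P \<in> Pow T"
    then have "f A = f P" if "A \<inter> T = P" for A
      using dependsD[OF f, of A P] that by blast
    then show "(\<Sum>A\<in>{A \<in> Pow {..<k}. A \<inter> T = P}. f A * weight A) = f P * (\<Sum>A\<in>cyl T P. weight A)"
      unfolding cyl_def sum_distrib_left by (intro sum.cong) auto
  qed simp
  also have "0 \<le> \<dots>"
  proof (rule sum_nonneg)
    fix P assume "P \<in> Pow T"
    then have P: "P \<subseteq> T" by simp
    let ?s = "\<Sum>I\<in>implied T. psi I P"
    have w: "(\<Sum>A\<in>cyl T P. weight A) = real (card (cyl T P)) * ?s"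
      by (rule sum_weight_cyl[OF T(1) P])
    have nn: "0 \<le> ?s" by (rule sum_psi_nonneg[OF fT T(2)])
    show "0 \<le> f P * (\<Sum>A\<in>cyl T P. weight A)"
    proof (cases "\<forall>g<M. N g \<subseteq> T \<longrightarrow> sat g P")
      case True
      then have "0 \<le> f P" using pos[OF P] by blast
      then show ?thesis using nn unfolding w by simp
    next
      case False
      then obtain g where g: "g < M" "N g \<subseteq> T" "\<not> sat g P" by blast
      have "even (card {h \<in> {g}. x \<in> N h})" if "x \<in> {..<k} - T" for x
      proof -
        have "{h \<in> {g}. x \<in> N h} = {}" using g(2) that by blast
        then show ?thesis by (simp only: card.empty even_zero)
      qed
      then have "{g} \<in> implied T" unfolding implied_def using g(1) q by simp
      moreover have "psi {g} P = -1" using g(3) eps_sat eps_cases by (auto simp: psi_def)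
      ultimately have "?s = 0" by (rule sum_psi_negate[OF fT T(2)])
      then show ?thesis unfolding w by simp
    qed
  qed
  finally show ?thesis by (simp add: pexp_def)
qed

text \<open>A nonempty set of at most \<open>q\<close> constraints has a nonempty boundary, so only
  the empty sum involves no variable, and the total mass is \<open>2 ^ k\<close>.\<close>

lemma pexp_one: "pexp (\<lambda>_. 1) = 1"
proof -
  have "I = {}" if "I \<in> implied {}" for I
  proof -
    have I: "I \<subseteq> {..<M}" "card I \<le> q" using that by (auto simp: implied_def)
    have "boundary N I \<subseteq> {}" by (rule boundary_implied) (use that in \<open>auto simp: implied_def\<close>)
    then have "card I \<le> 0" using sum_boundary_subset[of I "{}"] I by simp
    then show ?thesis using fin_constr[OF I(1)] by simp
  qed
  moreover have "{} \<in> implied {}" by (simp add: implied_def)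
  ultimately have "implied {} = {{}}" by blast
  then have "(\<Sum>A\<in>cyl {} {}. weight A) = real (card (cyl {} {}))"
    by (simp add: sum_weight_cyl psi_def)
  moreover have "cyl {} {} = Pow {..<k}" by (auto simp: cyl_def)
  ultimately show ?thesis by (simp add: pexp_def card_Pow)
qed

end

section \<open>Resolution and Sherali-Adams\<close>

definition mono_eval :: "('x \<Rightarrow> 'k::comm_ring_1) \<Rightarrow> ('x \<Rightarrow>\<^sub>0 nat) \<Rightarrow> 'k" where
  "mono_eval a \<mu> = (\<Prod>x\<in>Poly_Mapping.keys \<mu>. a x ^ Poly_Mapping.lookup \<mu> x)"

definition poly_eval :: "('x \<Rightarrow> 'k::comm_ring_1) \<Rightarrow> ('x, 'k) mpoly \<Rightarrow> 'k" where
  "poly_eval a p = (\<Sum>\<mu>\<in>Poly_Mapping.keys p. Poly_Mapping.lookup p \<mu> * mono_eval a \<mu>)"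

lemma mono_eval_superset:
  assumes "finite S" "Poly_Mapping.keys \<mu> \<subseteq> S"
  shows "mono_eval a \<mu> = (\<Prod>x\<in>S. a x ^ Poly_Mapping.lookup \<mu> x)"
  unfolding mono_eval_def using assms
  by (intro prod.mono_neutral_left) (auto simp: in_keys_iff)

lemma mono_eval_add: "mono_eval a (\<mu> + \<nu>) = mono_eval a \<mu> * mono_eval a \<nu>"
proof -
  let ?S = "Poly_Mapping.keys \<mu> \<union> Poly_Mapping.keys \<nu>"
  have "mono_eval a (\<mu> + \<nu>) = (\<Prod>x\<in>?S. a x ^ Poly_Mapping.lookup (\<mu> + \<nu>) x)"
    by (rule mono_eval_superset) (use keys_add[of \<mu> \<nu>] in auto)
  also have "\<dots> = (\<Prod>x\<in>?S. a x ^ Poly_Mapping.lookup \<mu> x) * (\<Prod>x\<in>?S. a x ^ Poly_Mapping.lookup \<nu> x)"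
    by (simp add: lookup_add power_add prod.distrib)
  also have "\<dots> = mono_eval a \<mu> * mono_eval a \<nu>"
    by (simp add: mono_eval_superset[of ?S])
  finally show ?thesis .
qed

lemma poly_eval_superset:
  assumes "finite S" "Poly_Mapping.keys p \<subseteq> S"
  shows "poly_eval a p = (\<Sum>\<mu>\<in>S. Poly_Mapping.lookup p \<mu> * mono_eval a \<mu>)"
  unfolding poly_eval_def using assms
  by (intro sum.mono_neutral_left) (auto simp: in_keys_iff)

lemma poly_eval_add: "poly_eval a (p + q) = poly_eval a p + poly_eval a q"
proof -
  let ?S = "Poly_Mapping.keys p \<union> Poly_Mapping.keys q"
  have "poly_eval a (p + q) = (\<Sum>x\<in>?S. Poly_Mapping.lookup (p + q) x * mono_eval a x)"
    by (rule poly_eval_superset) (use keys_add[of p q] in auto)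
  also have "\<dots> = (\<Sum>x\<in>?S. Poly_Mapping.lookup p x * mono_eval a x) + (\<Sum>x\<in>?S. Poly_Mapping.lookup q x * mono_eval a x)"
    by (simp add: lookup_add algebra_simps sum.distrib)
  also have "\<dots> = poly_eval a p + poly_eval a q"
    by (simp add: poly_eval_superset[of ?S])
  finally show ?thesis .
qed

lemma poly_eval_zero [simp]: "poly_eval a 0 = 0"
  by (simp add: poly_eval_def)

lemma poly_eval_sum: "poly_eval a (sum f S) = (\<Sum>s\<in>S. poly_eval a (f s))"
  by (induction S rule: infinite_finite_induct) (simp_all add: poly_eval_add)

lemma poly_eval_single: "poly_eval a (Poly_Mapping.single \<mu> c) = c * mono_eval a \<mu>"
  by (subst poly_eval_superset[of "{\<mu>}"]) auto

lemma poly_mapping_sum_single: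
  "(\<Sum>\<mu>\<in>Poly_Mapping.keys p. Poly_Mapping.single \<mu> (Poly_Mapping.lookup p \<mu>)) = (p :: _ \<Rightarrow>\<^sub>0 'k::comm_ring_1)"
  by (rule poly_mapping_eqI)
     (auto simp: lookup_sum lookup_single when_def in_keys_iff)

lemma poly_eval_mult: "poly_eval a (p * q) = poly_eval a p * poly_eval a q"
proof -
  let ?s = "\<lambda>p \<mu>. Poly_Mapping.single \<mu> (Poly_Mapping.lookup p \<mu>)"
  have "p * q = (\<Sum>\<mu>\<in>Poly_Mapping.keys p. ?s p \<mu>) * (\<Sum>\<nu>\<in>Poly_Mapping.keys q. ?s q \<nu>)"
    by (simp only: poly_mapping_sum_single)
  also have "poly_eval a \<dots> = (\<Sum>\<mu>\<in>Poly_Mapping.keys p. \<Sum>\<nu>\<in>Poly_Mapping.keys q.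
      (Poly_Mapping.lookup p \<mu> * mono_eval a \<mu>) * (Poly_Mapping.lookup q \<nu> * mono_eval a \<nu>))"
    by (simp add: sum_product poly_eval_sum mult_single poly_eval_single mono_eval_add mult.assoc mult.left_commute)
  also have "\<dots> = poly_eval a p * poly_eval a q"
    by (simp only: poly_eval_def sum_product)
  finally show ?thesis .
qed

lemma poly_eval_PConst [simp]: "poly_eval a (PConst c) = c"
  by (simp add: PConst_def poly_eval_single mono_eval_def)

lemma poly_eval_PVar [simp]: "poly_eval a (PVar x) = a x"
  by (simp add: PVar_def poly_eval_single mono_eval_def)

lemma poly_eval_one [simp]: "poly_eval a 1 = 1"
  using poly_eval_PConst[of a 1] by (simp add: PConst_def)

lemma poly_eval_uminus: "poly_eval a (- p) = - poly_eval a p"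
  using poly_eval_add[of a p "- p"] by (simp add: eq_neg_iff_add_eq_0 add.commute)

lemma poly_eval_diff: "poly_eval a (p - q) = poly_eval a p - poly_eval a q"
  using poly_eval_add[of a p "- q"] by (simp add: poly_eval_uminus)

lemma poly_eval_prod: "poly_eval a (prod f S) = (\<Prod>s\<in>S. poly_eval a (f s))"
  by (induction S rule: infinite_finite_induct) (simp_all add: poly_eval_mult)

lemma poly_eval_power: "poly_eval a (p ^ n) = poly_eval a p ^ n"
  by (induction n) (simp_all add: poly_eval_mult)

lemma poly_eval_sum_list: "poly_eval a (sum_list (map f xs)) = (\<Sum>x\<leftarrow>xs. poly_eval a (f x))"
  by (induction xs) (simp_all add: poly_eval_add)

section \<open>Restricted formulas and the support of clauses\<close>

fun lit_true :: "('v \<Rightarrow> bool) \<Rightarrow> 'v lit \<Rightarrow> bool" where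
  "lit_true a (Pos x) \<longleftrightarrow> a x"
| "lit_true a (Neg x) \<longleftrightarrow> \<not> a x"

definition falsified :: "('v \<Rightarrow> bool) \<Rightarrow> 'v clause \<Rightarrow> bool" where
  "falsified a C \<longleftrightarrow> (\<forall>l\<in>C. \<not> lit_true a l)"

lemma lit_true_var: "a (var l) = b (var l) \<Longrightarrow> lit_true a l = lit_true b l"
  by (cases l) simp_all

text \<open>\<open>\<alpha> A z\<close> is the value of the variable \<open>z\<close> of
  \<open>F\<close> after restriction, under the base assignment \<open>A\<close>. A resolution step
  involves three clauses of support \<open>d\<close>, and \<open>pexp_nonneg\<close> tolerates
  \<open>q / 2\<close> variables, hence \<open>6 * d \<le> q\<close>. With \<open>3 \<le> d\<close>
  there is also room for the at most six variables of an initial clause next to a Sherali-Adams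
  product: \<open>2 * (d + 6) \<le> 6 * d\<close>.\<close>

locale restricted_system = expanding_system +
  fixes \<alpha> :: "nat set \<Rightarrow> 'v \<Rightarrow> bool" and F :: "'v cnf" and d :: nat
  assumes var_row: "\<exists>x<k. depends {x} (\<lambda>A. \<alpha> A z)"
    and clause: "C \<in> F \<Longrightarrow> finite C \<and> card C \<le> 3 \<and> (\<exists>g<M. \<forall>A. sat g A \<longrightarrow> \<not> falsified (\<alpha> A) C)"
    and d: "3 \<le> d" "6 * d \<le> q"
begin

definition small_support :: "'v clause \<Rightarrow> bool" where
  "small_support C \<longleftrightarrow> (\<exists>T\<subseteq>{..<k}. card T \<le> d \<and> depends T (\<lambda>A. falsified (\<alpha> A) C))"

lemma clause_rows:
  assumes "C \<in> F"
  obtains T g where "T \<subseteq> {..<k}" "card T \<le> 6" "\<And>x. x \<in> var ` C \<Longrightarrow> depends T (\<lambda>A. \<alpha> A x)"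
    "g < M" "N g \<subseteq> T" "\<And>A. sat g A \<Longrightarrow> \<not> falsified (\<alpha> A) C"
proof -
  obtain r where r: "\<And>z. r z < k \<and> depends {r z} (\<lambda>A. \<alpha> A z)" using var_row by metis
  obtain g where g: "g < M" "\<And>A. sat g A \<Longrightarrow> \<not> falsified (\<alpha> A) C" using clause[OF assms] by blast
  define T where "T = r ` var ` C \<union> N g"
  show ?thesis
  proof (rule that[of T g])
    show "T \<subseteq> {..<k}" using r N(1)[OF g(1)] by (auto simp: T_def)
    have "card (r ` var ` C) \<le> card C"
      using clause[OF assms] by (metis card_image_le finite_imageI order_trans)
    then show "card T \<le> 6"
      using card_Un_le[of "r ` var ` C" "N g"] clause[OF assms] N(2)[OF g(1)] unfolding T_def by linarith
    show "depends T (\<lambda>A. \<alpha> A x)" if "x \<in> var ` C" for x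
      by (rule depends_mono[of "{r x}"]) (use r that in \<open>auto simp: T_def\<close>)
  qed (use g in \<open>auto simp: T_def\<close>)
qed

lemma depends_falsified:
  assumes "\<And>x. x \<in> var ` C \<Longrightarrow> depends T (\<lambda>A. \<alpha> A x)"
  shows "depends T (\<lambda>A. falsified (\<alpha> A) C)"
  unfolding depends_def falsified_def
proof (intro allI impI ball_cong refl)
  fix A B l assume AB: "A \<inter> T = B \<inter> T" "l \<in> C"
  then have "\<alpha> A (var l) = \<alpha> B (var l)" using dependsD[OF assms] by blast
  then show "(\<not> lit_true (\<alpha> A) l) = (\<not> lit_true (\<alpha> B) l)" using lit_true_var by metis
qed

definition fal :: "'v clause \<Rightarrow> nat set \<Rightarrow> real" where
  "fal C A = of_bool (falsified (\<alpha> A) C)"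

lemma depends_fal: "depends T (\<lambda>A. falsified (\<alpha> A) C) \<Longrightarrow> depends T (fal C)"
  unfolding fal_def by (rule depends_map)

text \<open>\<open>pexp (fal C) \<le> 0\<close> is an invariant: a locally consistent assignment
  never falsifies an initial clause, and the falsity of a resolvent is pointwise at most the sum of
  the falsities of its premises. The empty clause is always falsified and has pseudo-expectation
  1.\<close>

theorem resolution_refutation_large_support:
  assumes "res_refutation F \<pi>"
  shows "\<exists>t<length \<pi>. \<not> small_support (fst (\<pi> ! t))"
proof (rule ccontr)
  assume "\<not> ?thesis"
  then have good: "small_support (fst (\<pi> ! t))" if "t < length \<pi>" for t using that by blast
  let ?D = "\<lambda>t. fst (\<pi> ! t)"
  have ne: "\<pi> \<noteq> []" "fst (last \<pi>) = {}"
    and prem: "\<And>t i. t < length \<pi> \<Longrightarrow> i \<in> premise_idx (snd (\<pi> ! t)) \<Longrightarrow> i < t"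
    and step: "\<And>t. t < length \<pi> \<Longrightarrow> res_step F ?D (?D t) (snd (\<pi> ! t))"
    using assms by (auto simp: res_refutation_def res_derivation_def)
  obtain S where S: "\<And>t. t < length \<pi> \<Longrightarrow> S t \<subseteq> {..<k} \<and> card (S t) \<le> d \<and> depends (S t) (fal (?D t))"
    using good depends_fal unfolding small_support_def by metis
  have "pexp (fal (?D t)) \<le> 0" if "t < length \<pi>" for t
    using that
  proof (induction t rule: less_induct)
    case (less t)
    note St = S[OF less.prems]
    show ?case
    proof (cases "snd (\<pi> ! t)")
      case Axiom
      then have "?D t \<in> F" using step[OF less.prems] by simp
      then obtain T g where T: "T \<subseteq> {..<k}" "card T \<le> 6" "\<And>x. x \<in> var ` ?D t \<Longrightarrow> depends T (\<lambda>A. \<alpha> A x)"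
        "g < M" "N g \<subseteq> T" "\<And>A. sat g A \<Longrightarrow> \<not> falsified (\<alpha> A) (?D t)" by (rule clause_rows) blast
      have dep: "depends T (\<lambda>A. - 1 * fal (?D t) A)"
        by (intro depends_map[of _ _ "\<lambda>x. - 1 * x"] depends_fal depends_falsified T(3))
      have "0 \<le> pexp (\<lambda>A. - 1 * fal (?D t) A)"
        by (rule pexp_nonneg[OF T(1) _ dep]) (use T d in \<open>auto simp: fal_def\<close>)
      then show ?thesis unfolding pexp_cmult by simp
    next
      case (Resolve i j)
      then have ij: "i < t" "j < t" using prem[OF less.prems, of i] prem[OF less.prems, of j] by auto
      obtain x A B where x: "?D i = insert (Pos x) A" "?D j = insert (Neg x) B" "?D t = A \<union> B"
        using step[OF less.prems] Resolve by auto
      have ijl: "i < length \<pi>" "j < length \<pi>" using ij less.prems by auto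
      note Si = S[OF ijl(1)] and Sj = S[OF ijl(2)]
      have dep: "depends ((S i \<union> S j) \<union> S t) (\<lambda>A. (fal (?D i) A + fal (?D j) A) - fal (?D t) A)"
        by (rule depends_map2[of _ _ _ _ "(-)", OF depends_map2[of _ _ _ _ "(+)"]]) (use Si Sj St in auto)
      have c: "card ((S i \<union> S j) \<union> S t) \<le> d + d + d"
        using card_Un_le[of "S i \<union> S j" "S t"] card_Un_le[of "S i" "S j"] Si Sj St by linarith
      have "0 \<le> pexp (\<lambda>A. (fal (?D i) A + fal (?D j) A) - fal (?D t) A)"
      proof (rule pexp_nonneg[OF _ _ dep])
        show "2 * card ((S i \<union> S j) \<union> S t) \<le> q" using c d by linarith
        show "0 \<le> (fal (?D i) P + fal (?D j) P) - fal (?D t) P" for P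
          unfolding x by (cases "\<alpha> P x") (auto simp: fal_def falsified_def)
      qed (use Si Sj St in auto)
      then show ?thesis unfolding pexp_diff pexp_add
        using less.IH[OF ij(1) ijl(1)] less.IH[OF ij(2) ijl(2)] by linarith
    next
      case (Weaken i)
      then have i: "i < t" using prem[OF less.prems, of i] by auto
      then have il: "i < length \<pi>" using less.prems by auto
      have sub: "?D i \<subseteq> ?D t" using step[OF less.prems] Weaken by auto
      note Si = S[OF il]
      have dep: "depends (S i \<union> S t) (\<lambda>A. fal (?D i) A - fal (?D t) A)"
        by (rule depends_map2) (use Si St in auto)
      have c: "card (S i \<union> S t) \<le> d + d"
        using card_Un_le[of "S i" "S t"] Si St by linarith
      have "0 \<le> pexp (\<lambda>A. fal (?D i) A - fal (?D t) A)"
      proof (rule pexp_nonneg[OF _ _ dep])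
        show "2 * card (S i \<union> S t) \<le> q" using c d by linarith
        show "0 \<le> fal (?D i) P - fal (?D t) P" for P
          using sub by (auto simp: fal_def falsified_def)
      qed (use Si St in auto)
      then show ?thesis unfolding pexp_diff using less.IH[OF i il] by linarith
    qed
  qed
  moreover have "length \<pi> - 1 < length \<pi>" "?D (length \<pi> - 1) = {}"
    using ne by (simp_all add: last_conv_nth)
  ultimately have "pexp (fal {}) \<le> 0" by metis
  moreover have "fal {} = (\<lambda>_. 1)" by (simp add: fal_def falsified_def fun_eq_iff)
  ultimately show False using pexp_one by simp
qed

definition point :: "nat set \<Rightarrow> 'v \<Rightarrow> real" where
  "point A x = of_bool (\<alpha> A x)"

text \<open>On Boolean points the product is the falsity indicator of a clause. Monomials of PCR are
  read in the same way, so one notion of support serves all three systems.\<close>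

lemma poly_eval_sa_product:
  assumes "finite I" "finite J"
  shows "poly_eval (point A) (sa_product I J p) = fal (Neg ` I \<union> Pos ` J) A * poly_eval (point A) p"
proof -
  have "(\<Prod>i\<in>I. point A i) = of_bool (\<forall>i\<in>I. \<alpha> A i)"
    using assms(1) by (induction I rule: finite_induct) (auto simp: point_def)
  moreover have "(\<Prod>j\<in>J. 1 - point A j) = of_bool (\<forall>j\<in>J. \<not> \<alpha> A j)"
    using assms(2) by (induction J rule: finite_induct) (auto simp: point_def)
  moreover have "falsified (\<alpha> A) (Neg ` I \<union> Pos ` J) \<longleftrightarrow> (\<forall>i\<in>I. \<alpha> A i) \<and> (\<forall>j\<in>J. \<not> \<alpha> A j)"
    by (simp add: falsified_def ball_Un)
  ultimately show ?thesis
    by (simp add: sa_product_def poly_eval_mult poly_eval_prod poly_eval_diff fal_def)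
qed

lemma sa_clause_nonneg:
  assumes "finite C" "\<not> falsified (\<alpha> A) C"
  shows "0 \<le> poly_eval (point A) (sa_clause C)"
proof -
  let ?P = "{x. Pos x \<in> C}" and ?Q = "{x. Neg x \<in> C}"
  have fin: "finite ?P" "finite ?Q"
    using finite_vimageI[OF assms(1), of Pos] finite_vimageI[OF assms(1), of Neg]
    by (auto simp: vimage_def inj_on_def)
  have ev: "poly_eval (point A) (sa_clause C) = (\<Sum>x\<in>?P. point A x) + (\<Sum>x\<in>?Q. 1 - point A x) - 1"
    by (simp add: sa_clause_def poly_eval_add poly_eval_diff poly_eval_sum)
  have nn: "0 \<le> (\<Sum>x\<in>?P. point A x)" "0 \<le> (\<Sum>x\<in>?Q. 1 - point A x)"
    by (intro sum_nonneg; simp add: point_def)+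
  obtain l where l: "l \<in> C" "lit_true (\<alpha> A) l" using assms(2) by (auto simp: falsified_def)
  show ?thesis
  proof (cases l)
    case (Pos x)
    then have "point A x \<le> (\<Sum>x\<in>?P. point A x)"
      using l by (intro member_le_sum fin) (auto simp: point_def)
    moreover have "point A x = 1" using l Pos by (simp add: point_def)
    ultimately show ?thesis using nn unfolding ev by linarith
  next
    case (Neg x)
    then have "1 - point A x \<le> (\<Sum>x\<in>?Q. 1 - point A x)"
      using l by (intro member_le_sum[of _ _ "\<lambda>x. 1 - point A x"] fin) (auto simp: point_def)
    moreover have "point A x = 0" using l Neg by (simp add: point_def)
    ultimately show ?thesis using nn unfolding ev by linarith
  qed
qed

lemma pexp_sum_list: "pexp (\<lambda>A. \<Sum>s\<leftarrow>xs. f s A) = (\<Sum>s\<leftarrow>xs. pexp (f s))"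
  by (induction xs) (use pexp_cmult[of 0 "\<lambda>_. 0"] in \<open>simp_all add: pexp_add\<close>)

text \<open>Every summand has nonnegative pseudo-expectation, yet they add up to -1. Products that
  expand to 0 are set apart: they do not show in the size, so a restriction chosen from the size
  need not be good for them.\<close>

theorem sa_refutation_large_support:
  assumes "sa_refutation F \<pi>"
  shows "\<exists>(a, I, J, p)\<in>set \<pi>. sa_product I J p \<noteq> 0 \<and> \<not> small_support (Neg ` I \<union> Pos ` J)"
proof (rule ccontr)
  assume neg: "\<not> ?thesis"
  let ?t = "\<lambda>(a, I, J, p). PConst a * sa_product I J p"
  have summand: "0 \<le> pexp (\<lambda>A. poly_eval (point A) (?t s))" if s: "s \<in> set \<pi>" for s
  proof -
    obtain a I J p where [simp]: "s = (a, I, J, p)" by (cases s)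
    have a: "0 \<le> a" "finite I" "finite J" "p \<in> sa_clause ` F \<union> sa_axioms (vars F)"
      using assms s by (auto simp: sa_refutation_def sa_derivation_def)
    have "0 \<le> pexp (\<lambda>A. poly_eval (point A) (sa_product I J p))"
    proof (cases "sa_product I J p = 0")
      case True
      then show ?thesis using pexp_cmult[of 0 "\<lambda>_. 0"] by simp
    next
      case False
      let ?C = "Neg ` I \<union> Pos ` J"
      have "small_support ?C" using neg s False by fastforce
      then obtain S where S: "S \<subseteq> {..<k}" "card S \<le> d" "depends S (fal ?C)"
        using depends_fal unfolding small_support_def by blast
      obtain T where T: "T \<subseteq> {..<k}" "card T \<le> 6" "depends T (\<lambda>A. poly_eval (point A) p)"
        and pos: "\<And>P. (\<And>g. g < M \<Longrightarrow> N g \<subseteq> T \<Longrightarrow> sat g P) \<Longrightarrow> 0 \<le> poly_eval (point P) p"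
      proof (cases "p \<in> sa_clause ` F")
        case True
        then obtain C where C: "C \<in> F" "p = sa_clause C" by blast
        obtain T g where T: "T \<subseteq> {..<k}" "card T \<le> 6" "\<And>x. x \<in> var ` C \<Longrightarrow> depends T (\<lambda>A. \<alpha> A x)"
          "g < M" "N g \<subseteq> T" "\<And>A. sat g A \<Longrightarrow> \<not> falsified (\<alpha> A) C" by (rule clause_rows[OF C(1)]) blast
        show ?thesis
        proof (rule that[OF T(1,2)])
          show "depends T (\<lambda>A. poly_eval (point A) p)" unfolding depends_def
          proof (intro allI impI)
            fix A B assume AB: "A \<inter> T = B \<inter> T"
            have eq: "point A x = point B x" if "Pos x \<in> C \<or> Neg x \<in> C" for x
            proof -
              have "x \<in> var ` C" using that by force
              then have "\<alpha> A x = \<alpha> B x" using dependsD[OF T(3) AB] by blast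
              then show ?thesis by (simp add: point_def)
            qed
            then show "poly_eval (point A) p = poly_eval (point B) p"
              by (simp add: C(2) sa_clause_def poly_eval_add poly_eval_diff poly_eval_sum)
          qed
          show "0 \<le> poly_eval (point P) p" if "\<And>g. g < M \<Longrightarrow> N g \<subseteq> T \<Longrightarrow> sat g P" for P
            unfolding C(2) by (rule sa_clause_nonneg) (use clause[OF C(1)] T(4-6) that in blast)+
        qed
      next
        case False
        then have "p \<in> sa_axioms (vars F)" using a by blast
        \<comment> \<open>Boolean axioms vanish at all points and the axiom 1 is constant, so
          neither involves a base variable.\<close>
        then consider "\<And>A. poly_eval (point A) p = 0" | "\<And>A. poly_eval (point A) p = 1"
          by (auto simp: sa_axioms_def poly_eval_diff poly_eval_power point_def)
        then show ?thesis by cases (rule that[of "{}"]; simp add: depends_def)+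
      qed
      have dep: "depends (S \<union> T) (\<lambda>A. fal ?C A * poly_eval (point A) p)"
        by (rule depends_map2[OF S(3) T(3)])
      show ?thesis unfolding poly_eval_sa_product[OF a(2,3)]
      proof (rule pexp_nonneg[OF _ _ dep])
        show "2 * card (S \<union> T) \<le> q" using card_Un_le[of S T] S T d by linarith
        fix P assume "P \<subseteq> S \<union> T" "\<And>g. g < M \<Longrightarrow> N g \<subseteq> S \<union> T \<Longrightarrow> sat g P"
        then have "0 \<le> poly_eval (point P) p" by (intro pos) auto
        then show "0 \<le> fal ?C P * poly_eval (point P) p" by (simp add: fal_def)
      qed (use S T in auto)
    qed
    then show ?thesis using a by (simp add: poly_eval_mult pexp_cmult)
  qed
  have "0 \<le> (\<Sum>s\<leftarrow>\<pi>. pexp (\<lambda>A. poly_eval (point A) (?t s)))"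
    by (rule sum_list_nonneg) (use summand in auto)
  also have "\<dots> = pexp (\<lambda>A. poly_eval (point A) (\<Sum>s\<leftarrow>\<pi>. ?t s))"
    by (simp only: pexp_sum_list poly_eval_sum_list)
  also have "(\<Sum>s\<leftarrow>\<pi>. ?t s) = -1"
    using assms by (simp add: sa_refutation_def sa_derivation_def)
  also have "pexp (\<lambda>A. poly_eval (point A) (-1)) = - 1"
    using pexp_cmult[of "-1" "\<lambda>_. 1"] pexp_one by (simp add: poly_eval_uminus)
  finally show False by simp
qed

end

section \<open>The reduction operator for polynomial calculus\<close>

locale reduction_operator = expanding_system +
  fixes field_type :: "'f::field itself"
begin

abbreviation X :: "nat set" where "X \<equiv> {..<k}"

text \<open>Multilinear polynomials are coefficient functions on sets of variables; the monomial
  \<open>t\<close> has value 1 at \<open>A\<close> iff all its variables are true.\<close>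

definition ev :: "(nat set \<Rightarrow> 'f) \<Rightarrow> nat set \<Rightarrow> 'f" where
  "ev c A = (\<Sum>t\<in>Pow (X \<inter> A). c t)"

definition supp :: "(nat set \<Rightarrow> 'f) \<Rightarrow> nat set set" where
  "supp c = {t. c t \<noteq> 0}"

definition monom :: "nat set \<Rightarrow> nat set \<Rightarrow> 'f" where
  "monom t s = of_bool (s = t)"

definition lincomb :: "('i \<Rightarrow> 'f) \<Rightarrow> ('i \<Rightarrow> nat set \<Rightarrow> 'f) \<Rightarrow> 'i set \<Rightarrow> nat set \<Rightarrow> 'f" where
  "lincomb a f S s = (\<Sum>i\<in>S. a i * f i s)"

text \<open>The constraints are the clauses \<open>sat g\<close> rather than the parities, so the
  characteristic of the field does not matter. Implication is semantic: an element vanishes at every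
  assignment that satisfies \<open>I\<close>.\<close>

definition ideal :: "nat set \<Rightarrow> (nat set \<Rightarrow> 'f) set" where
  "ideal I = {c. supp c \<subseteq> Pow X \<and> (\<forall>A. (\<forall>g\<in>I. sat g A) \<longrightarrow> ev c A = 0)}"

lemma ev_lincomb: "ev (lincomb a f S) A = (\<Sum>i\<in>S. a i * ev (f i) A)"
  unfolding ev_def lincomb_def by (subst sum.swap) (simp add: sum_distrib_left)

lemma ev_diff: "ev (\<lambda>s. c s - c' s) A = ev c A - ev c' A"
  by (simp add: ev_def sum_subtractf)

lemma supp_lincomb: "(\<And>i. i \<in> S \<Longrightarrow> a i \<noteq> 0 \<Longrightarrow> supp (f i) \<subseteq> P) \<Longrightarrow> supp (lincomb a f S) \<subseteq> P"
  unfolding supp_def lincomb_def by (force elim: sum.not_neutral_contains_not_neutral)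

lemma ideal_lincomb:
  assumes "\<And>i. i \<in> S \<Longrightarrow> a i \<noteq> 0 \<Longrightarrow> f i \<in> ideal I"
  shows "lincomb a f S \<in> ideal I"
proof -
  have "a i * ev (f i) A = 0" if "i \<in> S" "\<forall>g\<in>I. sat g A" for i A
    using assms[OF that(1)] that(2) by (cases "a i = 0") (auto simp: ideal_def)
  then have "ev (lincomb a f S) A = 0" if "\<forall>g\<in>I. sat g A" for A
    unfolding ev_lincomb using that by (intro sum.neutral) blast
  moreover have "supp (lincomb a f S) \<subseteq> Pow X"
    by (rule supp_lincomb) (use assms in \<open>simp add: ideal_def\<close>)
  ultimately show ?thesis by (simp add: ideal_def)
qed

lemma ideal_diff:
  assumes "c \<in> ideal I" "c' \<in> ideal I"
  shows "(\<lambda>s. c s - c' s) \<in> ideal I"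
proof -
  have "supp (\<lambda>s. c s - c' s) \<subseteq> supp c \<union> supp c'" by (auto simp: supp_def)
  moreover have "supp c \<union> supp c' \<subseteq> Pow X" using assms by (simp add: ideal_def)
  ultimately have "supp (\<lambda>s. c s - c' s) \<subseteq> Pow X" by (rule order_trans)
  then show ?thesis using assms by (simp add: ideal_def ev_diff)
qed

lemma ideal_mono: "I \<subseteq> J \<Longrightarrow> ideal I \<subseteq> ideal J"
  unfolding ideal_def by blast

lemma ideal_zero: "(\<lambda>_. 0) \<in> ideal I"
  by (simp add: ideal_def supp_def ev_def)

text \<open>The encoding as a number is a term order: it is injective on finite sets and extends inclusion.\<close>

definition reducible :: "nat set \<Rightarrow> nat set \<Rightarrow> bool" where
  "reducible I t \<longleftrightarrow> (\<exists>c\<in>ideal I. c t \<noteq> 0 \<and> (\<forall>s. c s \<noteq> 0 \<longrightarrow> set_encode s \<le> set_encode t))"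

lemma encode_insert: "finite t \<Longrightarrow> x \<notin> t \<Longrightarrow> set_encode t < set_encode (insert x t)"
  by simp

section \<open>Normal forms modulo a set of constraints\<close>

lemma irreducible_zero:
  assumes c: "c \<in> ideal I" and irr: "\<And>s. c s \<noteq> 0 \<Longrightarrow> \<not> reducible I s"
  shows "c = (\<lambda>_. 0)"
proof (rule ccontr)
  assume "c \<noteq> (\<lambda>_. 0)"
  then obtain t0 where t0: "c t0 \<noteq> 0" by blast
  have sub: "supp c \<subseteq> Pow X" using c by (simp add: ideal_def)
  have fin: "finite (supp c)" by (rule finite_subset[OF sub]) simp
  have "t0 \<in> supp c" using t0 by (simp add: supp_def)
  then have "Max (set_encode ` supp c) \<in> set_encode ` supp c" using fin by (intro Max_in) auto
  then obtain t where t: "t \<in> supp c" "set_encode t = Max (set_encode ` supp c)" by force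
  have "set_encode s \<le> set_encode t" if "c s \<noteq> 0" for s
    unfolding t(2) using fin that by (intro Max_ge) (auto simp: supp_def)
  then have "reducible I t" unfolding reducible_def using c t(1) by (intro bexI[of _ c]) (auto simp: supp_def)
  then show False using irr t(1) by (auto simp: supp_def)
qed

text \<open>Division along the term order: an element of the ideal with leading term
  \<open>t\<close> rewrites \<open>t\<close> into smaller terms, which have normal forms by
  induction.\<close>

lemma nf_exists:
  assumes "t \<subseteq> X"
  shows "\<exists>r. (\<forall>s. r s \<noteq> 0 \<longrightarrow> s \<subseteq> X \<and> \<not> reducible I s) \<and> (\<lambda>s. monom t s - r s) \<in> ideal I"
  using assms
proof (induction t rule: measure_induct_rule[of set_encode])
  case (less t)
  show ?case
  proof (cases "reducible I t")
    case False
    have "(\<forall>s. monom t s \<noteq> 0 \<longrightarrow> s \<subseteq> X \<and> \<not> reducible I s)" using less.prems False by (auto simp: monom_def)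
    moreover have "(\<lambda>s. monom t s - monom t s) \<in> ideal I" using ideal_zero by simp
    ultimately show ?thesis by blast
  next
    case True
    then obtain c where c: "c \<in> ideal I" "c t \<noteq> 0" "\<And>s. c s \<noteq> 0 \<Longrightarrow> set_encode s \<le> set_encode t"
      by (auto simp: reducible_def)
    have fin: "finite s" if "s \<subseteq> X" for s using that finite_subset by blast
    have cX: "s \<subseteq> X" if "c s \<noteq> 0" for s using c(1) that by (auto simp: ideal_def supp_def)
    have low: "set_encode s < set_encode t" if "c s \<noteq> 0" "s \<noteq> t" for s
    proof -
      have "set_encode s \<noteq> set_encode t" using set_encode_eq[OF fin fin] cX that less.prems by blast
      then show ?thesis using c(3)[OF that(1)] by simp
    qed
    have "\<forall>s. \<exists>r. c s \<noteq> 0 \<and> s \<noteq> t \<longrightarrow> (\<forall>u. r u \<noteq> 0 \<longrightarrow> u \<subseteq> X \<and> \<not> reducible I u) \<and> (\<lambda>u. monom s u - r u) \<in> ideal I"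
      using less.IH low cX by meson
    then obtain r where r: "\<And>s. c s \<noteq> 0 \<Longrightarrow> s \<noteq> t \<Longrightarrow> (\<forall>u. r s u \<noteq> 0 \<longrightarrow> u \<subseteq> X \<and> \<not> reducible I u)"
      "\<And>s. c s \<noteq> 0 \<Longrightarrow> s \<noteq> t \<Longrightarrow> (\<lambda>u. monom s u - r s u) \<in> ideal I" by metis
    define a where "a s = (if s = t then 0 else - c s / c t)" for s
    define r' where "r' = lincomb a r (Pow X)"
    have irr: "u \<subseteq> X \<and> \<not> reducible I u" if "r' u \<noteq> 0" for u
    proof -
      have "supp r' \<subseteq> {u. u \<subseteq> X \<and> \<not> reducible I u}"
        unfolding r'_def by (rule supp_lincomb) (use r(1) in \<open>force simp: a_def supp_def split: if_splits\<close>)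
      then show ?thesis using that by (auto simp: supp_def)
    qed
    have eq: "monom t u - r' u = 1 / c t * c u + lincomb a (\<lambda>s u. monom s u - r s u) (Pow X) u" for u
    proof -
      have "lincomb a (\<lambda>s u. monom s u - r s u) (Pow X) u = (\<Sum>s\<in>Pow X. a s * monom s u) - r' u"
        by (simp add: lincomb_def r'_def algebra_simps sum_subtractf)
      also have "(\<Sum>s\<in>Pow X. a s * monom s u) = (if u \<in> Pow X then a u else 0)"
        by (simp add: monom_def)
      also have "\<dots> = monom t u - 1 / c t * c u"
        using c(2) cX less.prems by (auto simp: a_def monom_def)
      finally show ?thesis by simp
    qed
    have I1: "lincomb a (\<lambda>s u. monom s u - r s u) (Pow X) \<in> ideal I"
      by (rule ideal_lincomb) (use r(2) in \<open>auto simp: a_def split: if_splits\<close>)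
    have I2: "lincomb (\<lambda>_. - 1 / c t) (\<lambda>_. c) {()} \<in> ideal I"
      by (rule ideal_lincomb) (use c(1) in simp)
    have "(\<lambda>u. monom t u - r' u) = (\<lambda>u. lincomb a (\<lambda>s u. monom s u - r s u) (Pow X) u - lincomb (\<lambda>_. - 1 / c t) (\<lambda>_. c) {()} u)"
      unfolding eq by (simp add: lincomb_def add.commute)
    then have "(\<lambda>u. monom t u - r' u) \<in> ideal I" using ideal_diff[OF I1 I2] by simp
    with irr show ?thesis by blast
  qed
qed

definition nf :: "nat set \<Rightarrow> nat set \<Rightarrow> nat set \<Rightarrow> 'f" where
  "nf I t = (SOME r. (\<forall>s. r s \<noteq> 0 \<longrightarrow> s \<subseteq> X \<and> \<not> reducible I s) \<and> (\<lambda>s. monom t s - r s) \<in> ideal I)"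

lemma nf:
  assumes "t \<subseteq> X"
  shows "nf I t s \<noteq> 0 \<Longrightarrow> s \<subseteq> X \<and> \<not> reducible I s" and "(\<lambda>s. monom t s - nf I t s) \<in> ideal I"
  using someI_ex[OF nf_exists[OF assms, of I]] unfolding nf_def by blast+

text \<open>Two normal forms differ by an element of the ideal without reducible terms, whereas the
  leading term of a nonzero element is reducible.\<close>

lemma nf_unique:
  assumes "t \<subseteq> X" "\<And>s. r s \<noteq> 0 \<Longrightarrow> s \<subseteq> X \<and> \<not> reducible I s" "(\<lambda>s. monom t s - r s) \<in> ideal I"
  shows "nf I t = r"
proof -
  have "(\<lambda>s. (monom t s - r s) - (monom t s - nf I t s)) \<in> ideal I"
    by (rule ideal_diff[OF assms(3) nf(2)[OF assms(1)]])
  then have "(\<lambda>s. nf I t s - r s) \<in> ideal I" by simp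
  moreover have "\<not> reducible I s" if "nf I t s - r s \<noteq> 0" for s
    using nf(1)[OF assms(1)] assms(2) that by (cases "r s = 0") auto
  ultimately have "(\<lambda>s. nf I t s - r s) = (\<lambda>_. 0)" by (rule irreducible_zero)
  then show ?thesis by (auto simp: fun_eq_iff)
qed

text \<open>Discarding the terms with a variable outside \<open>W\<close> amounts to setting these
  variables to 0. No constraint of \<open>I\<close> notices, so the ideal is mapped into itself, and
  uniqueness shows that the normal form is unchanged.\<close>

lemma nf_support:
  assumes "t \<subseteq> X" "I \<subseteq> {..<M}" "nf I t s \<noteq> 0"
  shows "s \<subseteq> t \<union> (\<Union>g\<in>I. N g)"
proof -
  define W where "W = t \<union> (\<Union>g\<in>I. N g)"
  define cut where "cut c s = (if s \<subseteq> W then c s else 0)" for c :: "nat set \<Rightarrow> 'f" and s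
  have ev_cut: "ev (cut c) A = ev c (A \<inter> W)" for c A
  proof -
    have "ev (cut c) A = (\<Sum>t\<in>Pow (X \<inter> (A \<inter> W)). cut c t)"
      unfolding ev_def by (rule sum.mono_neutral_right) (auto simp: cut_def)
    also have "\<dots> = ev c (A \<inter> W)" unfolding ev_def by (rule sum.cong) (auto simp: cut_def)
    finally show ?thesis .
  qed
  have cut_ideal: "cut c \<in> ideal I" if c: "c \<in> ideal I" for c
  proof -
    have "ev (cut c) A = 0" if A: "\<forall>g\<in>I. sat g A" for A
    proof -
      have "(A \<inter> W) \<inter> N g = A \<inter> N g" if "g \<in> I" for g using that by (auto simp: W_def)
      then have "\<forall>g\<in>I. sat g (A \<inter> W)" using A by (simp add: sat_def)
      then show ?thesis using c by (simp add: ev_cut ideal_def)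
    qed
    moreover have "supp (cut c) \<subseteq> supp c" by (auto simp: supp_def cut_def)
    ultimately show ?thesis using c by (auto simp: ideal_def)
  qed
  have "(\<lambda>s. monom t s - cut (nf I t) s) = cut (\<lambda>s. monom t s - nf I t s)"
    by (auto simp: cut_def fun_eq_iff monom_def W_def)
  then have "(\<lambda>s. monom t s - cut (nf I t) s) \<in> ideal I" using cut_ideal nf(2)[OF assms(1)] by simp
  then have "nf I t = cut (nf I t)"
    by (intro nf_unique assms(1)) (use nf(1)[OF assms(1)] in \<open>auto simp: cut_def split: if_splits\<close>)
  then have "cut (nf I t) s \<noteq> 0" using assms(3) by metis
  then show ?thesis by (auto simp: cut_def W_def split: if_splits)
qed

text \<open>The closure of Alekhnovich and Razborov.\<close>

definition closed :: "nat set \<Rightarrow> nat set set" where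
  "closed t = {K. K \<subseteq> {..<M} \<and> card K \<le> q \<and> boundary N K \<subseteq> t}"

definition closure :: "nat set \<Rightarrow> nat set" where
  "closure t = \<Union>(closed t)"

lemma closure_M: "closure t \<subseteq> {..<M}"
  by (auto simp: closure_def closed_def)

lemma boundary_antimono: "x \<in> boundary N L \<Longrightarrow> K \<subseteq> L \<Longrightarrow> x \<in> (\<Union>g\<in>K. N g) \<Longrightarrow> x \<in> boundary N K"
  unfolding boundary_def by blast

lemma boundary_closure: "boundary N (closure t) \<subseteq> t"
proof
  fix x assume x: "x \<in> boundary N (closure t)"
  then obtain g where "g \<in> closure t" "x \<in> N g" by (auto simp: boundary_def)
  then obtain K where K: "K \<in> closed t" "g \<in> K" by (auto simp: closure_def)
  then have "x \<in> boundary N K" using boundary_antimono[OF x, of K] \<open>x \<in> N g\<close> by (auto simp: closure_def)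
  then show "x \<in> t" using K by (auto simp: closed_def)
qed

text \<open>The same gap as for sums of parities, with unions: at most \<open>2 * q\<close>
  constraints and a boundary in \<open>t\<close>, hence at most
  \<open>2 * card t \<le> q\<close>.\<close>

lemma closed_Un:
  assumes t: "finite t" "2 * card t \<le> q" and K: "K \<subseteq> {..<M}" "card K \<le> q" "L \<subseteq> {..<M}" "card L \<le> q"
    and bd: "boundary N (K \<union> L) \<subseteq> t"
  shows "K \<union> L \<in> closed t"
proof -
  have "card (K \<union> L) \<le> 2 * card t"
    by (rule sum_boundary_subset) (use K card_Un_le[of K L] t(1) bd in auto)
  then show ?thesis using t K bd by (simp add: closed_def)
qed

lemma boundary_Un: "boundary N (K \<union> L) \<subseteq> boundary N K \<union> boundary N L"
proof
  fix x assume x: "x \<in> boundary N (K \<union> L)"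
  then have "x \<in> (\<Union>g\<in>K. N g) \<or> x \<in> (\<Union>g\<in>L. N g)" by (auto simp: boundary_def)
  then show "x \<in> boundary N K \<union> boundary N L"
    using boundary_antimono[OF x, of K] boundary_antimono[OF x, of L] by blast
qed

text \<open>Closed sets are stable under union, so one of maximal size contains all others. This is
  why a union of arbitrarily many closed sets still has at most \<open>q\<close>
  constraints.\<close>

lemma closure_closed:
  assumes t: "finite t" "2 * card t \<le> q"
  shows "closure t \<in> closed t"
proof -
  have fin: "finite (closed t)" by (rule finite_subset[of _ "Pow {..<M}"]) (auto simp: closed_def)
  have "boundary N {} = {}" by (auto simp: boundary_def)
  then have "{} \<in> closed t" by (simp add: closed_def)
  then have "Max (card ` closed t) \<in> card ` closed t" using fin by (intro Max_in) auto
  then obtain K where K: "K \<in> closed t" "card K = Max (card ` closed t)" by force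
  have "L \<subseteq> K" if L: "L \<in> closed t" for L
  proof -
    have "K \<union> L \<in> closed t"
      using K(1) L boundary_Un[of K L] by (intro closed_Un[OF t]) (auto simp: closed_def)
    then have "card (K \<union> L) \<le> card K" unfolding K(2) using fin by (intro Max_ge) auto
    moreover have "finite (K \<union> L)" using K(1) L fin_constr by (auto simp: closed_def)
    ultimately have "K \<union> L = K" by (metis Un_upper1 card_seteq)
    then show ?thesis by blast
  qed
  then have "closure t = K" using K(1) by (auto simp: closure_def)
  then show ?thesis using K by simp
qed

text \<open>The hypothesis on \<open>s\<close> is what \<open>nf_support\<close> provides: a normal
  form may bring in variables of the constraints in the closure, but the closures of its terms do
  not grow.\<close>

lemma closure_mono:
  assumes t: "finite t" "2 * card t \<le> q" and s: "s \<subseteq> t \<union> (\<Union>g\<in>closure t. N g)"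
  shows "closure s \<subseteq> closure t"
proof -
  have C: "closure t \<subseteq> {..<M}" "card (closure t) \<le> q"
    using closure_closed[OF t] by (auto simp: closed_def)
  have "K \<subseteq> closure t" if K: "K \<in> closed s" for K
  proof -
    have "boundary N (K \<union> closure t) \<subseteq> t"
    proof
      fix x assume x: "x \<in> boundary N (K \<union> closure t)"
      show "x \<in> t"
      proof (cases "x \<in> (\<Union>g\<in>closure t. N g)")
        case True
        then show ?thesis using boundary_antimono[OF x, of "closure t"] boundary_closure by blast
      next
        case False
        moreover have "boundary N (closure t) \<subseteq> (\<Union>g\<in>closure t. N g)" by (auto simp: boundary_def)
        ultimately have "x \<in> boundary N K" using x boundary_Un[of K "closure t"] by blast
        then show ?thesis using K s False by (auto simp: closed_def)
      qed
    qed
    then have "K \<union> closure t \<in> closed t"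
      using K C by (intro closed_Un[OF t]) (auto simp: closed_def)
    then show ?thesis by (auto simp: closure_def)
  qed
  then show ?thesis by (auto simp: closure_def)
qed

lemma sum_Pow_insert:
  assumes "finite Y" "x \<notin> Y"
  shows "(\<Sum>t\<in>Pow (insert x Y). f t) = (\<Sum>t\<in>Pow Y. f t + f (insert x t) :: 'f)"
proof -
  have "inj_on (insert x) (Pow Y)" using assms(2) by (auto simp: inj_on_def)
  moreover have "Pow Y \<inter> insert x ` Pow Y = {}" using assms(2) by auto
  ultimately show ?thesis using assms(1)
    by (simp add: Pow_insert sum.union_disjoint sum.reindex sum.distrib)
qed

text \<open>A constraint with a variable \<open>x\<close> that occurs neither in \<open>s\<close> nor in the other constraints does not
  help to reduce \<open>s\<close>: fix \<open>x\<close> so that the constraint is satisfied.\<close>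

lemma reducible_remove:
  assumes red: "reducible I s" and g: "g \<in> I" "I \<subseteq> {..<M}" "x \<in> N g" and x: "x \<notin> s"
    and priv: "\<And>h. h \<in> I \<Longrightarrow> x \<in> N h \<Longrightarrow> h = g"
  shows "reducible (I - {g}) s"
proof -
  obtain c where c: "c \<in> ideal I" "c s \<noteq> 0" "\<And>u. c u \<noteq> 0 \<Longrightarrow> set_encode u \<le> set_encode s"
    using red by (auto simp: reducible_def)
  have cX: "supp c \<subseteq> Pow X" using c(1) by (simp add: ideal_def)
  have xX: "x \<in> X" using g N(1) by blast
  define b where "b \<longleftrightarrow> x \<notin> \<sigma> g"
  define fix_x where "fix_x u = (if x \<in> u then 0 else c u + (if b then c (insert x u) else 0))" for u
  define A' where "A' A = (if b then insert x A else A - {x})" for A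
  have ev_fix: "ev fix_x A = ev c (A' A)" for A
  proof -
    define Y where "Y = X \<inter> A - {x}"
    have Y: "finite Y" "x \<notin> Y" by (auto simp: Y_def)
    have "ev fix_x A = (\<Sum>t\<in>Pow Y. fix_x t)"
      unfolding ev_def by (rule sum.mono_neutral_right) (auto simp: Y_def fix_x_def)
    also have "\<dots> = (\<Sum>t\<in>Pow Y. c t + (if b then c (insert x t) else 0))"
      using Y by (intro sum.cong) (auto simp: fix_x_def)
    also have "\<dots> = ev c (A' A)"
    proof (cases b)
      case True
      have "X \<inter> A' A = insert x Y" using True xX by (auto simp: A'_def Y_def)
      then show ?thesis using True by (simp add: ev_def sum_Pow_insert[OF Y])
    next
      case False
      then have "X \<inter> A' A = Y" by (auto simp: A'_def Y_def)
      then show ?thesis using False by (simp add: ev_def)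
    qed
    finally show ?thesis .
  qed
  have "ev fix_x A = 0" if A: "\<forall>h\<in>I - {g}. sat h A" for A
  proof -
    have "sat h (A' A)" if h: "h \<in> I" for h
    proof (cases "h = g")
      case True
      have "x \<in> A' A \<inter> N g \<longleftrightarrow> x \<notin> \<sigma> g" using g(3) by (simp add: A'_def b_def)
      then show ?thesis unfolding True sat_def by blast
    next
      case False
      then have "x \<notin> N h" using priv h by blast
      then have "A' A \<inter> N h = A \<inter> N h" by (auto simp: A'_def)
      moreover have "sat h A" using A h False by blast
      ultimately show ?thesis by (simp add: sat_def)
    qed
    then show ?thesis using c(1) by (simp add: ev_fix ideal_def)
  qed
  moreover have "supp fix_x \<subseteq> Pow X"
  proof
    fix u assume "u \<in> supp fix_x"
    then have "u \<in> supp c \<or> insert x u \<in> supp c" by (auto simp: supp_def fix_x_def split: if_splits)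
    then show "u \<in> Pow X" using cX by blast
  qed
  ultimately have "fix_x \<in> ideal (I - {g})" by (simp add: ideal_def)
  moreover have fs: "finite s" using cX c(2) finite_subset[of s X] by (auto simp: supp_def)
  \<comment> \<open>\<open>insert x s\<close> comes after the leading term \<open>s\<close>, so the
    substitution for \<open>x\<close> adds nothing to the coefficient of \<open>s\<close>.\<close>
  have "c (insert x s) = 0"
    using c(3)[of "insert x s"] encode_insert[OF fs x] by (meson leD)
  then have "fix_x s \<noteq> 0" using x c(2) by (simp add: fix_x_def)
  moreover have "set_encode u \<le> set_encode s" if u: "fix_x u \<noteq> 0" for u
  proof (cases "c u = 0")
    case True
    then have xu: "x \<notin> u" "c (insert x u) \<noteq> 0" using u by (auto simp: fix_x_def split: if_splits)
    then have "insert x u \<subseteq> X" using cX by (auto simp: supp_def)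
    then have "finite u" using finite_subset[of u X] by auto
    then show ?thesis using encode_insert[OF _ xu(1)] c(3)[OF xu(2)] by linarith
  qed (use c(3) in blast)
  ultimately show ?thesis unfolding reducible_def by blast
qed

text \<open>Peeling: if \<open>I\<close> is larger than the closure it is not closed, so it has a
  boundary variable outside \<open>t\<close>. This variable does not occur in \<open>s\<close> and
  is private to a constraint outside the closure, which can therefore be dropped.\<close>

lemma reducible_closure:
  assumes "closure t \<subseteq> I" "I \<subseteq> {..<M}" "card I \<le> q" "s \<subseteq> t \<union> (\<Union>g\<in>closure t. N g)" "reducible I s"
  shows "reducible (closure t) s"
  using assms
proof (induction "card I" arbitrary: I rule: less_induct)
  case less
  show ?case
  proof (cases "I = closure t")
    case False
    then have "I \<notin> closed t" using less.prems(1) by (auto simp: closure_def)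
    then obtain x where x: "x \<in> boundary N I" "x \<notin> t" using less.prems by (auto simp: closed_def)
    then obtain g where g: "g \<in> I" "x \<in> N g" "\<And>h. h \<in> I \<Longrightarrow> x \<in> N h \<Longrightarrow> h = g"
      by (auto simp: boundary_def)
    have nC: "x \<notin> (\<Union>g\<in>closure t. N g)"
      using boundary_antimono[OF x(1) less.prems(1)] boundary_closure x(2) by blast
    then have "g \<notin> closure t" using g by blast
    then have sub: "closure t \<subseteq> I - {g}" using less.prems(1) by blast
    have fI: "finite I" by (rule fin_constr[OF less.prems(2)])
    have xs: "x \<notin> s" using nC x(2) less.prems(4) by blast
    have red: "reducible (I - {g}) s"
      by (rule reducible_remove[OF less.prems(5) g(1) less.prems(2) g(2) xs g(3)])
    have lt: "card (I - {g}) < card I" using fI g(1) by (rule card_Diff1_less)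
    show ?thesis
      by (rule less.hyps[OF lt sub _ _ less.prems(4) red]) (use lt less.prems in auto)
  qed (use less.prems in simp)
qed

text \<open>This makes reduction local: when the closures of all terms of a polynomial lie in one
  small set of constraints, reducing each term by its own closure is reduction modulo a single
  ideal.\<close>

lemma nf_closure:
  assumes "t \<subseteq> X" "closure t \<subseteq> I" "I \<subseteq> {..<M}" "card I \<le> q"
  shows "nf I t = nf (closure t) t"
proof (rule nf_unique[OF assms(1)])
  show "s \<subseteq> X \<and> \<not> reducible I s" if s: "nf (closure t) t s \<noteq> 0" for s
    using nf(1)[OF assms(1) s] reducible_closure[OF assms(2-4) nf_support[OF assms(1) closure_M s]] by blast
  show "(\<lambda>s. monom t s - nf (closure t) t s) \<in> ideal I"
    using nf(2)[OF assms(1)] ideal_mono[OF assms(2)] by blast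
qed

section \<open>The reduction operator and its kernel\<close>

definition NF :: "nat set \<Rightarrow> (nat set \<Rightarrow> 'f) \<Rightarrow> nat set \<Rightarrow> 'f" where
  "NF I c = lincomb c (nf I) (Pow X)"

text \<open>No fixed ideal would do: that of all constraints contains 1 when the constraints are
  unsatisfiable, while a small one misses most clauses.\<close>

definition R :: "(nat set \<Rightarrow> 'f) \<Rightarrow> nat set \<Rightarrow> 'f" where
  "R c = lincomb c (\<lambda>t. nf (closure t) t) (Pow X)"

lemma lincomb_lincomb:
  "lincomb (lincomb a f S) h T = lincomb a (\<lambda>i. lincomb (f i) h T) S"
  unfolding lincomb_def by (rule ext) (simp add: sum_distrib_left sum_distrib_right mult.assoc sum.swap[of _ T])

lemma sum_monom:
  assumes "supp c \<subseteq> Pow X"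
  shows "(\<Sum>t\<in>Pow X. c t * monom t s) = c s"
proof (cases "s \<in> Pow X")
  case True
  then have "(\<Sum>t\<in>Pow X. c t * monom t s) = (\<Sum>t\<in>{s}. c t * monom t s)"
    by (intro sum.mono_neutral_right) (auto simp: monom_def)
  then show ?thesis by (simp add: monom_def)
next
  case False
  then have "c s = 0" using assms by (auto simp: supp_def)
  moreover have "c t * monom t s = 0" if "t \<in> Pow X" for t using that False by (auto simp: monom_def)
  ultimately show ?thesis by (simp add: sum.neutral)
qed

lemma NF_ideal_zero:
  assumes "c \<in> ideal I"
  shows "NF I c = (\<lambda>_. 0)"
proof (rule irreducible_zero)
  have sub: "supp c \<subseteq> Pow X" using assms by (simp add: ideal_def)
  have eq: "c s - lincomb c (\<lambda>t s. monom t s - nf I t s) (Pow X) s = NF I c s" for s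
  proof -
    have "c s = (\<Sum>t\<in>Pow X. c t * monom t s)"
      using sum_monom[OF sub] by simp
    then show ?thesis by (simp add: lincomb_def NF_def algebra_simps sum_subtractf)
  qed
  have "lincomb c (\<lambda>t s. monom t s - nf I t s) (Pow X) \<in> ideal I"
    by (rule ideal_lincomb) (use nf(2) in blast)
  from ideal_diff[OF assms this] show "NF I c \<in> ideal I" unfolding eq .
  have "supp (NF I c) \<subseteq> {s. \<not> reducible I s}"
    unfolding NF_def by (rule supp_lincomb) (use nf(1) in \<open>force simp: supp_def\<close>)
  then show "\<not> reducible I s" if "NF I c s \<noteq> 0" for s using that by (auto simp: supp_def)
qed

lemma NF_diff: "NF I (\<lambda>s. c s - c' s) u = NF I c u - NF I c' u"
  by (simp add: NF_def lincomb_def algebra_simps sum_subtractf)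

lemma R_eq_NF:
  assumes "supp c \<subseteq> Pow X" "\<And>s. c s \<noteq> 0 \<Longrightarrow> closure s \<subseteq> I" "I \<subseteq> {..<M}" "card I \<le> q"
  shows "R c = NF I c"
proof (rule ext)
  fix u
  show "R c u = NF I c u" unfolding R_def NF_def lincomb_def
  proof (rule sum.cong)
    fix t assume "t \<in> Pow X"
    then show "c t * nf (closure t) t u = c t * nf I t u"
      using nf_closure[of t I] assms by (cases "c t = 0") auto
  qed simp
qed

definition xmul :: "nat \<Rightarrow> (nat set \<Rightarrow> 'f) \<Rightarrow> nat set \<Rightarrow> 'f" where
  "xmul x c s = (if x \<in> s then c s + c (s - {x}) else 0)"

lemma ev_xmul:
  assumes "x < k"
  shows "ev (xmul x c) A = of_bool (x \<in> A) * ev c A"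
proof (cases "x \<in> A")
  case True
  define Y where "Y = X \<inter> A - {x}"
  have Y: "finite Y" "x \<notin> Y" "X \<inter> A = insert x Y" using assms True by (auto simp: Y_def)
  have "xmul x c t = 0" "xmul x c (insert x t) = c t + c (insert x t)" if "t \<in> Pow Y" for t
    using that Y(2) by (auto simp: xmul_def insert_absorb Diff_insert_absorb intro: arg_cong[of _ _ c])
  then show ?thesis using True
    by (simp add: ev_def Y(3) sum_Pow_insert[OF Y(1,2)])
next
  case False
  then show ?thesis by (auto simp: ev_def xmul_def intro!: sum.neutral)
qed

lemma supp_xmul: "x < k \<Longrightarrow> supp c \<subseteq> Pow X \<Longrightarrow> supp (xmul x c) \<subseteq> Pow X"
proof
  fix s assume c: "x < k" "supp c \<subseteq> Pow X" and "s \<in> supp (xmul x c)"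
  then have "x \<in> s" "s \<in> supp c \<or> s - {x} \<in> supp c" by (auto simp: supp_def xmul_def split: if_splits)
  then show "s \<in> Pow X" using c by blast
qed

lemma ideal_xmul: "x < k \<Longrightarrow> c \<in> ideal I \<Longrightarrow> xmul x c \<in> ideal I"
  by (auto simp: ideal_def ev_xmul dest: supp_xmul)

lemma xmul_monom: "xmul x (monom t) = monom (insert x t)"
proof
  fix s
  have "x \<in> s \<Longrightarrow> s = t \<or> s - {x} = t \<longleftrightarrow> s = insert x t" "x \<in> s \<Longrightarrow> \<not> (s = t \<and> s - {x} = t)"
    by blast+
  moreover have "x \<notin> s \<Longrightarrow> s \<noteq> insert x t" by blast
  ultimately show "xmul x (monom t) s = monom (insert x t) s"
    by (cases "x \<in> s"; cases "s = t"; cases "s - {x} = t") (simp_all add: xmul_def monom_def)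
qed

lemma xmul_lincomb: "xmul x (lincomb a f S) = lincomb a (\<lambda>i. xmul x (f i)) S"
  by (rule ext) (simp add: xmul_def lincomb_def algebra_simps sum.distrib)

lemma R_lincomb: "R (lincomb a f S) = lincomb a (\<lambda>i. R (f i)) S"
  unfolding R_def by (rule lincomb_lincomb)

lemma R_monom: "t \<subseteq> X \<Longrightarrow> R (monom t) = nf (closure t) t"
  by (rule ext) (simp add: R_def lincomb_def monom_def)

lemma lincomb_monom: "supp c \<subseteq> Pow X \<Longrightarrow> lincomb c monom (Pow X) = c"
  by (rule ext) (simp add: lincomb_def sum_monom)

text \<open>The identity R(x R(t)) = R(x t). All closures on both sides lie in
  \<open>closure (insert x t)\<close>, where \<open>R\<close> is reduction modulo one ideal; that
  ideal contains t - R(t) and is stable under multiplication by \<open>x\<close>.\<close>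

lemma R_xmul_nf:
  assumes t: "t \<subseteq> X" and x: "x < k" and card: "2 * card (insert x t) \<le> q"
  shows "R (xmul x (nf (closure t) t)) = R (monom (insert x t))"
proof -
  let ?u = "insert x t"
  let ?I = "closure ?u"
  let ?r = "nf (closure t) t"
  have fin: "finite ?u" using t finite_subset by auto
  have I: "?I \<subseteq> {..<M}" "card ?I \<le> q" using closure_closed[OF fin card] by (auto simp: closed_def)
  have ct: "closure t \<subseteq> ?I" by (rule closure_mono[OF fin card]) blast
  have rX: "supp ?r \<subseteq> Pow X" using nf(1)[OF t] by (auto simp: supp_def)
  have sub: "closure s \<subseteq> ?I" if s: "xmul x ?r s \<noteq> 0" for s
  proof (rule closure_mono[OF fin card])
    have "?r s \<noteq> 0 \<or> ?r (s - {x}) \<noteq> 0"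
    proof (rule ccontr)
      assume "\<not> ?thesis"
      then have "?r s = 0" "?r (s - {x}) = 0" by blast+
      then have "xmul x ?r s = 0" by (simp only: xmul_def add_0_left if_cancel)
      then show False using s by contradiction
    qed
    then have "s \<subseteq> t \<union> (\<Union>g\<in>closure t. N g) \<or> s - {x} \<subseteq> t \<union> (\<Union>g\<in>closure t. N g)"
      using nf_support[OF t closure_M] by metis
    then have "s \<subseteq> insert x (t \<union> (\<Union>g\<in>closure t. N g))" by blast
    then show "s \<subseteq> ?u \<union> (\<Union>g\<in>?I. N g)" using ct by blast
  qed
  have uX: "?u \<subseteq> X" using t x by auto
  have R1: "R (xmul x ?r) = NF ?I (xmul x ?r)"
    by (rule R_eq_NF[OF supp_xmul[OF x rX] sub I])
  have R2: "R (monom ?u) = NF ?I (monom ?u)"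
    by (rule R_eq_NF[OF _ _ I]) (use uX in \<open>auto simp: supp_def monom_def split: if_splits\<close>)
  have "xmul x (\<lambda>s. monom t s - ?r s) \<in> ideal ?I"
    using ideal_xmul[OF x] nf(2)[OF t] ideal_mono[OF ct] by blast
  moreover have "xmul x (\<lambda>s. monom t s - ?r s) = (\<lambda>s. monom ?u s - xmul x ?r s)"
    unfolding xmul_monom[symmetric] by (auto simp: xmul_def)
  ultimately have "NF ?I (\<lambda>s. monom ?u s - xmul x ?r s) = (\<lambda>_. 0)"
    using NF_ideal_zero by simp
  then have "NF ?I (monom ?u) v - NF ?I (xmul x ?r) v = 0" for v
    unfolding NF_diff[symmetric] by (rule fun_cong)
  then show ?thesis unfolding R1 R2 by (simp add: fun_eq_iff)
qed

text \<open>Applied to each term, the identity turns R(x c) into R(x R(c)). The degree bound is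
  there because closures are known to be small only for small terms.\<close>

lemma R_xmul:
  assumes c: "supp c \<subseteq> Pow X" "\<And>t. c t \<noteq> 0 \<Longrightarrow> 2 * (card t + 1) \<le> q" and x: "x < k" and R: "R c = (\<lambda>_. 0)"
  shows "R (xmul x c) = (\<lambda>_. 0)"
proof -
  have "R (xmul x c) = R (xmul x (lincomb c monom (Pow X)))" by (simp add: lincomb_monom[OF c(1)])
  also have "\<dots> = lincomb c (\<lambda>t. R (monom (insert x t))) (Pow X)"
    by (simp add: xmul_lincomb R_lincomb xmul_monom)
  also have "\<dots> = lincomb c (\<lambda>t. R (xmul x (nf (closure t) t))) (Pow X)"
  proof -
    have "c t * R (monom (insert x t)) u = c t * R (xmul x (nf (closure t) t)) u" if "t \<in> Pow X" for t u
    proof (cases "c t = 0")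
      case False
      have "card (insert x t) \<le> card t + 1" by (simp add: card_insert_le_m1)
      then have "2 * card (insert x t) \<le> q"
        using c(2)[OF False] by (meson le_trans mult_le_mono2)
      then show ?thesis using R_xmul_nf[of t x] that x by simp
    qed simp
    then show ?thesis unfolding lincomb_def by (intro ext sum.cong) auto
  qed
  also have "\<dots> = R (xmul x (R c))"
    unfolding R_lincomb[symmetric] xmul_lincomb[symmetric] R_def[of c] ..
  also have "\<dots> = (\<lambda>_. 0)"
  proof -
    have "xmul x (\<lambda>_. 0) = (\<lambda>_. 0)" by (rule ext) (simp add: xmul_def)
    then show ?thesis unfolding R by (simp add: R_def lincomb_def fun_eq_iff)
  qed
  finally show ?thesis .
qed

lemma R_constraint:
  assumes c: "supp c \<subseteq> Pow W" and W: "W \<subseteq> X" "2 * card W \<le> q" and g: "g < M" "N g \<subseteq> W"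
    and sat: "\<And>A. sat g A \<Longrightarrow> ev c A = 0"
  shows "R c = (\<lambda>_. 0)"
proof -
  have fin: "finite W" using W(1) finite_subset by blast
  have I: "closure W \<subseteq> {..<M}" "card (closure W) \<le> q"
    using closure_closed[OF fin W(2)] by (auto simp: closed_def)
  have "{g} \<in> closed W" using g q by (auto simp: closed_def boundary_def)
  then have "g \<in> closure W" by (auto simp: closure_def)
  then have "c \<in> ideal (closure W)" using c W(1) sat by (auto simp: ideal_def)
  moreover have "R c = NF (closure W) c"
  proof (rule R_eq_NF[OF _ _ I])
    show "supp c \<subseteq> Pow X" using c W(1) by blast
    show "closure s \<subseteq> closure W" if "c s \<noteq> 0" for s
      by (rule closure_mono[OF fin W(2)]) (use c that in \<open>auto simp: supp_def\<close>)
  qed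
  ultimately show ?thesis using NF_ideal_zero by simp
qed

text \<open>The closure of the term 1 is empty by expansion, and modulo no constraints at all only
  the zero polynomial vanishes everywhere.\<close>

lemma R_one: "R (monom {}) \<noteq> (\<lambda>_. 0)"
proof
  assume R0: "R (monom {}) = (\<lambda>_. 0)"
  have "closure {} \<in> closed {}" by (rule closure_closed) auto
  then have "closure {} = {}"
    using sum_boundary_subset[of "closure {}" "{}"] fin_constr[OF closure_M] by (auto simp: closed_def)
  then have "nf {} {} = (\<lambda>_. 0)" using R0 R_monom[of "{}"] by simp
  then have "monom {} \<in> ideal {}" using nf(2)[of "{}" "{}"] by simp
  then have "ev (monom {}) {} = 0" by (simp add: ideal_def)
  then show False by (simp add: ev_def monom_def)
qed

section \<open>Functions of base assignments as multilinear polynomials\<close>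

lemma coeffs_exist:
  assumes "finite W" "W \<subseteq> X" "depends W f"
  shows "\<exists>c. supp c \<subseteq> Pow W \<and> (\<forall>A. ev c A = f A)"
  using assms
proof (induction W arbitrary: f rule: finite_induct)
  case empty
  have "f A = f {}" for A using dependsD[OF empty(2), of A "{}"] by simp
  moreover have "ev (\<lambda>s. f {} * monom {} s) A = f {}" for A
  proof -
    have "ev (\<lambda>s. f {} * monom {} s) A = (\<Sum>s\<in>{{}}. f {} * monom {} s)"
      unfolding ev_def by (rule sum.mono_neutral_right) (auto simp: monom_def)
    then show ?thesis by (simp add: monom_def)
  qed
  ultimately have "\<forall>A. ev (\<lambda>s. f {} * monom {} s) A = f A" by metis
  moreover have "supp (\<lambda>s. f {} * monom {} s) \<subseteq> Pow {}" by (auto simp: supp_def monom_def)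
  ultimately show ?case by blast
next
  case (insert x W)
  have dep: "depends W (\<lambda>A. f (A - {x}))" "depends W (\<lambda>A. f (insert x A))"
    unfolding depends_def by (intro allI impI dependsD[OF insert.prems(2)]; blast)+
  obtain c0 where c0: "supp c0 \<subseteq> Pow W" "\<forall>A. ev c0 A = f (A - {x})"
    using insert.IH[OF _ dep(1)] insert.prems by auto
  obtain c1 where c1: "supp c1 \<subseteq> Pow W" "\<forall>A. ev c1 A = f (insert x A)"
    using insert.IH[OF _ dep(2)] insert.prems by auto
  let ?c = "\<lambda>s. c0 s + xmul x (\<lambda>s. c1 s - c0 s) s"
  have "supp ?c \<subseteq> Pow (insert x W)"
  proof
    fix s assume s: "s \<in> supp ?c"
    show "s \<in> Pow (insert x W)"
    proof (cases "c0 s = 0")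
      case False
      then show ?thesis using c0(1) by (auto simp: supp_def)
    next
      case True
      then have "s \<in> supp c1 \<or> s - {x} \<in> supp c0 \<union> supp c1"
        using s by (auto simp: supp_def xmul_def split: if_splits)
      then show ?thesis using c0(1) c1(1) by blast
    qed
  qed
  moreover have "ev ?c A = f A" for A
  proof -
    have "ev ?c A = ev c0 A + of_bool (x \<in> A) * (ev c1 A - ev c0 A)"
      using insert.prems(1) ev_xmul[of x "\<lambda>s. c1 s - c0 s" A] by (simp add: ev_diff) (simp add: ev_def sum.distrib)
    then show ?thesis using c0(2) c1(2) by (auto simp: insert_absorb)
  qed
  ultimately show ?case by blast
qed

lemma coeffs_unique:
  assumes c: "supp c \<subseteq> Pow X" and c': "supp c' \<subseteq> Pow X" and eq: "\<And>A. ev c A = ev c' A"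
  shows "c = c'"
proof
  fix t
  show "c t = c' t"
  proof (cases "t \<subseteq> X")
    case True
    then have "finite t" using finite_subset by blast
    then show ?thesis using True
    proof (induction t rule: finite_psubset_induct)
      case (psubset t)
      have Xt: "X \<inter> t = t" "finite (Pow t)" using psubset by auto
      have split: "Pow t = insert t (Pow t - {t})" by blast
      have e: "ev b t = b t + (\<Sum>s\<in>Pow t - {t}. b s)" for b
        unfolding ev_def Xt(1) using Xt(2) by (simp add: sum.remove[of "Pow t" t])
      have "(\<Sum>s\<in>Pow t - {t}. c s) = (\<Sum>s\<in>Pow t - {t}. c' s)"
        by (rule sum.cong) (use psubset in auto)
      then show ?case using eq[of t] by (simp add: e)
    qed
  next
    case False
    then have "t \<notin> supp c" "t \<notin> supp c'" using c c' by blast+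
    then show ?thesis by (simp add: supp_def)
  qed
qed

end

lemma prod_of_bool: "finite S \<Longrightarrow> (\<Prod>l\<in>S. of_bool (P l)) = (of_bool (\<forall>l\<in>S. P l) :: 'a::comm_semiring_1)"
  by (induction S rule: finite_induct) auto

context restricted_system
begin

definition pcr_point :: "nat set \<Rightarrow> 'v lit \<Rightarrow> 'f::field" where
  "pcr_point A l = of_bool (\<not> lit_true (\<alpha> A) l)"

lemma mono_eval_pcr_point:
  "mono_eval (pcr_point A) \<mu> = of_bool (falsified (\<alpha> A) (Poly_Mapping.keys \<mu>))"
proof -
  have "mono_eval (pcr_point A) \<mu> = (\<Prod>l\<in>Poly_Mapping.keys \<mu>. of_bool (\<not> lit_true (\<alpha> A) l))"
    unfolding mono_eval_def pcr_point_def by (rule prod.cong) (auto simp: in_keys_iff)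
  also have "\<dots> = of_bool (\<forall>l\<in>Poly_Mapping.keys \<mu>. \<not> lit_true (\<alpha> A) l)"
    by (rule prod_of_bool) simp
  finally show ?thesis by (simp add: falsified_def)
qed

text \<open>The invariant is that the multilinear polynomial in the base variables that agrees with
  a line at all points lies in the kernel of \<open>R\<close>. Boolean and complementarity axioms
  become 0 at these points, and initial clauses become consequences of one base constraint.\<close>

theorem pcr_refutation_large_support:
  fixes ps :: "('v lit, 'f::field) mpoly list"
  assumes "pcr_refutation F ps"
  shows "\<exists>p\<in>set ps. \<exists>\<mu>\<in>Poly_Mapping.keys p. \<not> small_support (Poly_Mapping.keys \<mu>)"
proof (rule ccontr)
  assume neg: "\<not> ?thesis"
  interpret reduction_operator k M q N \<sigma> "TYPE('f)" ..
  let ?e = "\<lambda>p A. poly_eval (pcr_point A) p"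
  define Zero where "Zero p \<longleftrightarrow> (\<exists>c. supp c \<subseteq> Pow X \<and> (\<forall>A. ev c A = ?e p A) \<and> R c = (\<lambda>_. 0))" for p
  have low_degree: "\<exists>c. supp c \<subseteq> {s. s \<subseteq> X \<and> card s \<le> d} \<and> (\<forall>A. ev c A = ?e p A)" if p: "p \<in> set ps" for p
  proof -
    have "\<exists>c. supp c \<subseteq> {s. s \<subseteq> X \<and> card s \<le> d} \<and> (\<forall>A. ev c A = mono_eval (pcr_point A) \<mu>)"
      if \<mu>: "\<mu> \<in> Poly_Mapping.keys p" for \<mu>
    proof -
      have "small_support (Poly_Mapping.keys \<mu>)" using neg p \<mu> by blast
      then obtain T where T: "T \<subseteq> X" "card T \<le> d" "depends T (\<lambda>A. falsified (\<alpha> A) (Poly_Mapping.keys \<mu>))"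
        by (auto simp: small_support_def)
      have fin: "finite T" using T(1) finite_subset by blast
      have "depends T (\<lambda>A. mono_eval (pcr_point A) \<mu> :: 'f)"
        unfolding mono_eval_pcr_point by (rule depends_map[OF T(3)])
      from coeffs_exist[OF fin T(1) this]
      obtain c where c: "supp c \<subseteq> Pow T" "\<forall>A. ev c A = mono_eval (pcr_point A) \<mu>" by blast
      have "Pow T \<subseteq> {s. s \<subseteq> X \<and> card s \<le> d}"
        using T fin by (auto dest: card_mono)
      then show ?thesis using c by blast
    qed
    then obtain c where c: "\<And>\<mu>. \<mu> \<in> Poly_Mapping.keys p \<Longrightarrow> supp (c \<mu>) \<subseteq> {s. s \<subseteq> X \<and> card s \<le> d}"
      "\<And>\<mu> A. \<mu> \<in> Poly_Mapping.keys p \<Longrightarrow> ev (c \<mu>) A = mono_eval (pcr_point A) \<mu>" by metis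
    let ?c = "lincomb (Poly_Mapping.lookup p) c (Poly_Mapping.keys p)"
    have "supp ?c \<subseteq> {s. s \<subseteq> X \<and> card s \<le> d}" by (rule supp_lincomb) (use c(1) in blast)
    moreover have "ev ?c A = ?e p A" for A using c(2) by (simp add: ev_lincomb poly_eval_def)
    ultimately show ?thesis by blast
  qed
  have zero0: "Zero p" if "\<And>A. ?e p A = 0" for p
  proof -
    have "R (\<lambda>_. 0) = (\<lambda>_. 0)" by (simp add: R_def lincomb_def fun_eq_iff)
    then show ?thesis unfolding Zero_def using that
      by (intro exI[of _ "\<lambda>_. 0"]) (simp add: supp_def ev_def)
  qed
  have "Zero (ps ! t)" if "t < length ps" for t
    using that
  proof (induction t rule: less_induct)
    case (less t)
    have "pcr_step F ps t" using assms less.prems by (auto simp: pcr_refutation_def)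
    then consider (bool) l where "ps ! t = PVar l ^ 2 - PVar l"
      | (compl) x where "ps ! t = 1 - PVar (Pos x) - PVar (Neg x)"
      | (clause) C where "C \<in> F" "ps ! t = pcr_clause C"
      | (lin) i j a b where "i < t" "j < t" "ps ! t = PConst a * ps ! i + PConst b * ps ! j"
      | (mult) i l where "i < t" "ps ! t = PVar l * ps ! i"
      unfolding pcr_step_def by blast
    then show ?case
    proof cases
      case bool
      show ?thesis by (rule zero0) (simp add: bool poly_eval_diff poly_eval_power pcr_point_def)
    next
      case compl
      show ?thesis by (rule zero0) (simp add: compl poly_eval_diff pcr_point_def)
    next
      case (clause C)
      obtain T g where T: "T \<subseteq> X" "card T \<le> 6" "\<And>x. x \<in> var ` C \<Longrightarrow> depends T (\<lambda>A. \<alpha> A x)"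
        "g < M" "N g \<subseteq> T" "\<And>A. sat g A \<Longrightarrow> \<not> falsified (\<alpha> A) C" by (rule clause_rows[OF clause(1)]) blast
      have fC: "finite C" using clause(1) restricted_system_axioms unfolding restricted_system_def restricted_system_axioms_def by blast
      have e: "?e (ps ! t) A = of_bool (falsified (\<alpha> A) C)" for A
        by (simp add: clause(2) pcr_clause_def poly_eval_prod pcr_point_def falsified_def prod_of_bool[OF fC])
      have dep: "depends T (?e (ps ! t))" unfolding e
        by (rule depends_map[OF depends_falsified[OF T(3)]])
      have fin: "finite T" using T(1) finite_subset by blast
      obtain c where c: "supp c \<subseteq> Pow T" "\<And>A. ev c A = ?e (ps ! t) A"
        using coeffs_exist[OF fin T(1) dep] by blast
      have "R c = (\<lambda>_. 0)"
        by (rule R_constraint[OF c(1) T(1) _ T(4,5)]) (use T(2,6) d c(2) e in auto)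
      moreover have "supp c \<subseteq> Pow X" using c(1) T(1) by blast
      ultimately show ?thesis using c(2) unfolding Zero_def by blast
    next
      case (lin i j a b)
      have "Zero (ps ! i)" "Zero (ps ! j)" using less lin by auto
      then obtain c c' where c: "supp c \<subseteq> Pow X" "\<And>A. ev c A = ?e (ps ! i) A" "R c = (\<lambda>_. 0)"
        and c': "supp c' \<subseteq> Pow X" "\<And>A. ev c' A = ?e (ps ! j) A" "R c' = (\<lambda>_. 0)"
        unfolding Zero_def by blast
      let ?c = "lincomb (\<lambda>i. if i then a else b) (\<lambda>i. if i then c else c') UNIV"
      have "supp ?c \<subseteq> Pow X" by (rule supp_lincomb) (use c(1) c'(1) in auto)
      moreover have "ev ?c A = ?e (ps ! t) A" for A
        by (simp add: ev_lincomb UNIV_bool c(2) c'(2) lin poly_eval_add poly_eval_mult)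
      moreover have "R ?c = (\<lambda>_. 0)"
        unfolding R_lincomb using c(3) c'(3) by (simp add: lincomb_def UNIV_bool fun_eq_iff)
      ultimately show ?thesis unfolding Zero_def by blast
    next
      case (mult i l)
      have il: "i < length ps" using mult less.prems by simp
      have "Zero (ps ! i)" using less mult by auto
      then obtain c where c: "supp c \<subseteq> Pow X" "\<And>A. ev c A = ?e (ps ! i) A" "R c = (\<lambda>_. 0)"
        unfolding Zero_def by blast
      obtain c2 where c2: "supp c2 \<subseteq> {s. s \<subseteq> X \<and> card s \<le> d}" "\<And>A. ev c2 A = ?e (ps ! i) A"
        using low_degree[of "ps ! i"] il by auto
      \<comment> \<open>Multilinear representatives are unique, so the one in the kernel inherits
        degree at most \<open>d\<close> from the supports of the monomials. This is what
        \<open>R_xmul\<close> needs.\<close>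
      have "c2 = c" by (rule coeffs_unique) (use c c2 in auto)
      then have deg: "2 * (card s + 1) \<le> q" if "c s \<noteq> 0" for s
      proof -
        have "s \<in> supp c2" using that \<open>c2 = c\<close> by (simp add: supp_def)
        then have "card s \<le> d" using c2(1) by blast
        then have "2 * card s + 2 \<le> q" using d by linarith
        then show ?thesis by simp
      qed
      obtain x where x: "x < k" "depends {x} (\<lambda>A. \<alpha> A (var l))" using var_row by blast
      \<comment> \<open>A restricted literal depends on a single base variable, hence is the affine
        function \<open>u + v * x\<close> of it, and multiplying by it combines \<open>c\<close>
        with \<open>xmul x c\<close>.\<close>
      define u where "u = (pcr_point {} l :: 'f)"
      define v where "v = (pcr_point {x} l - pcr_point {} l :: 'f)"
      have lin: "pcr_point A l = u + of_bool (x \<in> A) * v" for A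
      proof -
        have "\<alpha> A (var l) = \<alpha> (A \<inter> {x}) (var l)" by (rule dependsD[OF x(2)]) blast
        then have "pcr_point A l = (pcr_point (A \<inter> {x}) l :: 'f)"
          unfolding pcr_point_def using lit_true_var[of "\<alpha> A" l "\<alpha> (A \<inter> {x})"] by simp
        then show ?thesis by (cases "x \<in> A") (simp_all add: u_def v_def)
      qed
      let ?c = "lincomb (\<lambda>i. if i then u else v) (\<lambda>i. if i then c else xmul x c) UNIV"
      have "supp ?c \<subseteq> Pow X" by (rule supp_lincomb) (use c(1) supp_xmul[OF x(1) c(1)] in auto)
      moreover have "ev ?c A = ?e (ps ! t) A" for A
        by (simp add: ev_lincomb UNIV_bool ev_xmul[OF x(1)] c(2) mult poly_eval_mult lin algebra_simps)
      moreover have "R ?c = (\<lambda>_. 0)"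
        unfolding R_lincomb using c(3) R_xmul[OF c(1) deg x(1) c(3)]
        by (simp add: lincomb_def UNIV_bool fun_eq_iff)
      ultimately show ?thesis unfolding Zero_def by blast
    qed
  qed
  moreover have "length ps - 1 < length ps" "ps ! (length ps - 1) = 1"
    using assms by (auto simp: pcr_refutation_def last_conv_nth)
  ultimately have "Zero 1" by metis
  then obtain c where c: "supp c \<subseteq> Pow X" "\<And>A. ev c A = 1" "R c = (\<lambda>_. 0)"
    by (auto simp: Zero_def)
  have "ev (monom {}) A = 1" for A
  proof -
    have "ev (monom {}) A = (\<Sum>s\<in>{{}}. monom {} s)"
      unfolding ev_def by (rule sum.mono_neutral_right) (auto simp: monom_def)
    then show ?thesis by (simp add: monom_def)
  qed
  then have "c = monom {}"
    by (intro coeffs_unique c(1)) (auto simp: c(2) supp_def monom_def split: if_splits)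
  then show False using c(3) R_one by simp
qed

end

section \<open>The lifted formula and its restrictions\<close>

datatype lifted_var = PV nat nat | EV nat nat | YV nat nat nat | TV nat nat nat nat

instance lifted_var :: countable
  by countable_datatype

abbreviation pv :: "nat \<Rightarrow> nat \<Rightarrow> nat" where "pv r v \<equiv> to_nat (PV r v)"
abbreviation evar :: "nat \<Rightarrow> nat \<Rightarrow> nat" where "evar r v \<equiv> to_nat (EV r v)"
abbreviation yv :: "nat \<Rightarrow> nat \<Rightarrow> nat \<Rightarrow> nat" where "yv r v j \<equiv> to_nat (YV r v j)"
abbreviation tv :: "nat \<Rightarrow> nat \<Rightarrow> nat \<Rightarrow> nat \<Rightarrow> nat" where "tv g j v v' \<equiv> to_nat (TV g j v v')"

text \<open>
  The rows are the \<open>k\<close> base variables followed by the \<open>M\<close> base clauses, and \<open>PV r v\<close> says that row \<open>r\<close>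
  points to place \<open>v\<close>. At place \<open>v\<close> the value of base variable \<open>i\<close> is \<open>YV i v 0\<close>, while \<open>YV (k + g) v j\<close> says that
  literal \<open>j\<close> of base clause \<open>g\<close> is true. \<open>EV r v\<close> (the pointer of row \<open>r\<close> is at least \<open>v\<close>) splits the wide clause
  ``row \<open>r\<close> points somewhere'' and \<open>TV g j v v'\<close> the implication between the two values into clauses of
  width 3.
\<close>

definition lifted_cnf :: "nat \<Rightarrow> nat \<Rightarrow> (nat \<Rightarrow> nat \<Rightarrow> nat) \<Rightarrow> (nat \<Rightarrow> nat set) \<Rightarrow> nat \<Rightarrow> nat cnf" where
  "lifted_cnf k M h \<sigma> m =
     (\<lambda>r. {Pos (evar r 0)}) ` {..<k + M} \<union>
     (\<lambda>r. {Neg (evar r m)}) ` {..<k + M} \<union>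
     (\<lambda>(r, v). {Neg (evar r v), Pos (pv r v), Pos (evar r (Suc v))}) ` ({..<k + M} \<times> {..<m}) \<union>
     (\<lambda>(g, v). {Pos (yv (k + g) v 0), Pos (yv (k + g) v 1), Pos (yv (k + g) v 2)}) ` ({..<M} \<times> {..<m}) \<union>
     (\<lambda>(g, j, v, v'). {Neg (pv (k + g) v), Neg (pv (h g j) v'), Pos (tv g j v v')})
       ` ({..<M} \<times> {..<3} \<times> {..<m} \<times> {..<m}) \<union>
     (\<lambda>(g, j, v, v'). {Neg (tv g j v v'), Neg (yv (k + g) v j),
         (if h g j \<in> \<sigma> g then Neg else Pos) (yv (h g j) v' 0)})
       ` ({..<M} \<times> {..<3} \<times> {..<m} \<times> {..<m})"

lemma lifted_cnf_cases:
  assumes "C \<in> lifted_cnf k M h \<sigma> m"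
  obtains (start) r where "r < k + M" "C = {Pos (evar r 0)}"
  | (stop) r where "r < k + M" "C = {Neg (evar r m)}"
  | (chain) r v where "r < k + M" "v < m" "C = {Neg (evar r v), Pos (pv r v), Pos (evar r (Suc v))}"
  | (choice) g v where "g < M" "v < m" "C = {Pos (yv (k + g) v 0), Pos (yv (k + g) v 1), Pos (yv (k + g) v 2)}"
  | (pair) g j v v' where "g < M" "j < 3" "v < m" "v' < m"
      "C = {Neg (pv (k + g) v), Neg (pv (h g j) v'), Pos (tv g j v v')}"
  | (agree) g j v v' where "g < M" "j < 3" "v < m" "v' < m"
      "C = {Neg (tv g j v v'), Neg (yv (k + g) v j), (if h g j \<in> \<sigma> g then Neg else Pos) (yv (h g j) v' 0)}"
  using assms unfolding lifted_cnf_def by auto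

lemma agree_in_lifted_cnf:
  assumes "g < M" "j < 3" "v < m" "v' < m"
  shows "{Neg (tv g j v v'), Neg (yv (k + g) v j), (if h g j \<in> \<sigma> g then Neg else Pos) (yv (h g j) v' 0)}
    \<in> lifted_cnf k M h \<sigma> m"
  unfolding lifted_cnf_def using assms
  by (intro UnI2 image_eqI[of _ _ "(g, j, v, v')"]) simp_all

lemma pair_in_lifted_cnf:
  assumes "g < M" "j < 3" "v < m" "v' < m"
  shows "{Neg (pv (k + g) v), Neg (pv (h g j) v'), Pos (tv g j v v')} \<in> lifted_cnf k M h \<sigma> m"
  unfolding lifted_cnf_def using assms
  by (intro UnI1[OF UnI2] image_eqI[of _ _ "(g, j, v, v')"]) simp_all

lemma three_cnf_lifted_cnf: "three_cnf (lifted_cnf k M h \<sigma> m)"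
  unfolding three_cnf_def
proof (intro conjI ballI)
  show "finite (lifted_cnf k M h \<sigma> m)" by (simp add: lifted_cnf_def)
  have three: "card {a, b, c} \<le> 3" for a b c :: "nat lit"
    using card_length[of "[a, b, c]"] by simp
  fix C assume "C \<in> lifted_cnf k M h \<sigma> m"
  then show "finite C" "card C \<le> 3"
    by (cases rule: lifted_cnf_cases; simp only: three finite_insert finite.emptyI card_1_singleton_iff; simp)+
qed

section \<open>Random configurations of rows\<close>

lemma mult_two_power_le: "Suc i * 2 ^ i \<le> 2 * (3::nat) ^ i"
proof (induction i)
  case (Suc i)
  show ?case
  proof (cases "i = 0")
    case False
    have "Suc (Suc i) * 2 ^ Suc i = (2 * i + 4) * 2 ^ i" by (simp add: algebra_simps)
    also have "\<dots> \<le> (3 * Suc i) * 2 ^ i" using False by (intro mult_le_mono1) simp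
    also have "\<dots> = 3 * (Suc i * 2 ^ i)" by (rule mult.assoc)
    also have "\<dots> \<le> 3 * (2 * 3 ^ i)" by (rule mult_le_mono2[OF Suc.IH])
    finally show ?thesis by simp
  qed simp
qed simp

text \<open>At a place of a clause row the value selects one of three literals; at a place of a
  variable row the formula only asks whether it is 0. Sharing the alphabet lets one count serve both
  kinds of rows.\<close>

definition row_config :: "nat \<Rightarrow> (nat \<times> (nat \<Rightarrow> nat)) set" where
  "row_config m = {..<m} \<times> ({..<m} \<rightarrow>\<^sub>E {..<3})"

lemma card_row_config: "card (row_config m) = m * 3 ^ m"
  by (simp add: row_config_def card_cartesian_product card_funcsetE)

text \<open>Read with \<open>S\<close> the places of a row mentioned by a clause and \<open>\<beta> v\<close> a value that satisfies the clause:
  with probability at most \<open>2 / m\<close> the active place \<open>a\<close> is mentioned and no random value at the other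
  places satisfies the clause.\<close>

lemma card_unkilled:
  fixes S :: "nat set" and \<beta> :: "nat \<Rightarrow> nat"
  assumes S: "S \<subseteq> {..<m}" and \<beta>: "\<And>v. v \<in> S \<Longrightarrow> \<beta> v < 3"
  shows "card {(a, b) \<in> row_config m. a \<in> S \<and> (\<forall>v\<in>S - {a}. b v \<noteq> \<beta> v)} * m \<le> 2 * card (row_config m)"
proof (cases "S = {}")
  case True
  then show ?thesis by simp
next
  case False
  let ?B = "\<lambda>a. PiE {..<m} (\<lambda>v. if v \<in> S - {a} then {..<3} - {\<beta> v} else {..<3})"
  have finS: "finite S" using S finite_subset by blast
  obtain i where i: "card S = Suc i" using False finS by (metis card_eq_0_iff not0_implies_Suc)
  have cB: "card (?B a) = 2 ^ i * 3 ^ (m - i)" if a: "a \<in> S" for a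
  proof -
    have c1: "card (S - {a}) = i" using a finS i by simp
    have c2: "card ({..<m} - (S - {a})) = m - i"
      using c1 S finS by (subst card_Diff_subset) auto
    have e: "card (if v \<in> S - {a} then {..<3} - {\<beta> v} else {..<3}) = (if v \<in> S - {a} then 2 else 3)" for v
      using \<beta> by simp
    have "card (?B a) = (\<Prod>v<m. if v \<in> S - {a} then 2 else 3)"
      by (subst card_PiE) (simp_all only: finite_lessThan e)
    also have "\<dots> = 2 ^ card ({..<m} \<inter> (S - {a})) * 3 ^ card ({..<m} - (S - {a}))"
    proof -
      have "{..<m} \<inter> {v. v \<in> S - {a}} = {..<m} \<inter> (S - {a})"
        "{..<m} \<inter> - {v. v \<in> S - {a}} = {..<m} - (S - {a})" by blast+
      then show ?thesis by (simp only: prod.If_cases[OF finite_lessThan] prod_constant)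
    qed
    also have "{..<m} \<inter> (S - {a}) = S - {a}" using S by blast
    finally show ?thesis by (simp only: c1 c2)
  qed
  have "{(a, b) \<in> row_config m. a \<in> S \<and> (\<forall>v\<in>S - {a}. b v \<noteq> \<beta> v)} \<subseteq> Sigma S ?B"
  proof
    fix x assume x: "x \<in> {(a, b) \<in> row_config m. a \<in> S \<and> (\<forall>v\<in>S - {a}. b v \<noteq> \<beta> v)}"
    obtain a b where ab: "x = (a, b)" by (cases x)
    then show "x \<in> Sigma S ?B" using x by (simp add: row_config_def PiE_iff)
  qed
  then have "card {(a, b) \<in> row_config m. a \<in> S \<and> (\<forall>v\<in>S - {a}. b v \<noteq> \<beta> v)} \<le> card (Sigma S ?B)"
    using finS by (intro card_mono finite_SigmaI finite_PiE) auto
  also have "\<dots> = (\<Sum>a\<in>S. card (?B a))" using finS by (intro card_SigmaI) (auto intro!: finite_PiE)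
  \<comment> \<open>As a probability this is \<open>(i + 1) * (2/3) ^ i / m\<close>; the factor of
    \<open>1 / m\<close> is bounded uniformly in the number \<open>i + 1\<close> of mentioned
    places.\<close>
  also have "\<dots> = Suc i * 2 ^ i * 3 ^ (m - i)" using cB i by (simp add: algebra_simps)
  also have "\<dots> \<le> 2 * 3 ^ i * 3 ^ (m - i)" by (intro mult_le_mono1 mult_two_power_le)
  also have "\<dots> = 2 * 3 ^ m"
  proof -
    have "i \<le> m" using i card_mono[OF finite_lessThan S] by simp
    then show ?thesis by (simp add: mult.assoc power_add[symmetric])
  qed
  finally show ?thesis by (simp add: card_row_config mult.commute mult.left_commute)
qed

text \<open>Rows are independent, so \<open>u\<close> given rows are all hit with probability at
  most the \<open>u\<close>-th power of \<open>2 / m\<close>; the choice of these rows is paid for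
  by \<open>2 ^ n\<close>.\<close>

lemma card_many_hits:
  fixes H :: "nat \<Rightarrow> 'a set"
  assumes fin: "finite \<Omega>" and H: "\<And>r. r < n \<Longrightarrow> H r \<subseteq> \<Omega> \<and> card (H r) * m \<le> 2 * card \<Omega>"
  shows "card {\<rho> \<in> {..<n} \<rightarrow>\<^sub>E \<Omega>. u \<le> card {r. r < n \<and> \<rho> r \<in> H r}} * m ^ u \<le> 2 ^ (n + u) * card \<Omega> ^ n"
proof -
  let ?B = "\<lambda>D. PiE {..<n} (\<lambda>r. if r \<in> D then H r else \<Omega>)"
  let ?\<D> = "{D. D \<subseteq> {..<n} \<and> card D = u}"
  have fD: "finite ?\<D>" by simp
  have "{\<rho> \<in> {..<n} \<rightarrow>\<^sub>E \<Omega>. u \<le> card {r. r < n \<and> \<rho> r \<in> H r}} \<subseteq> (\<Union>D\<in>?\<D>. ?B D)"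
  proof
    fix \<rho> assume \<rho>: "\<rho> \<in> {\<rho> \<in> {..<n} \<rightarrow>\<^sub>E \<Omega>. u \<le> card {r. r < n \<and> \<rho> r \<in> H r}}"
    then obtain D where D: "D \<subseteq> {r. r < n \<and> \<rho> r \<in> H r}" "card D = u"
      by (metis (mono_tags, lifting) mem_Collect_eq obtain_subset_with_card_n)
    then have "D \<in> ?\<D>" by auto
    moreover have "\<rho> \<in> ?B D" using \<rho> D by (auto simp: PiE_iff)
    ultimately show "\<rho> \<in> (\<Union>D\<in>?\<D>. ?B D)" by blast
  qed
  moreover have "finite (?B D)" for D
    using fin H by (intro finite_PiE) (auto intro: finite_subset)
  ultimately have "card {\<rho> \<in> {..<n} \<rightarrow>\<^sub>E \<Omega>. u \<le> card {r. r < n \<and> \<rho> r \<in> H r}} \<le> card (\<Union>D\<in>?\<D>. ?B D)"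
    using fD by (intro card_mono) auto
  also have "\<dots> \<le> (\<Sum>D\<in>?\<D>. card (?B D))" by (rule card_UN_le[OF fD])
  finally have "card {\<rho> \<in> {..<n} \<rightarrow>\<^sub>E \<Omega>. u \<le> card {r. r < n \<and> \<rho> r \<in> H r}} * m ^ u \<le> (\<Sum>D\<in>?\<D>. card (?B D)) * m ^ u"
    by (rule mult_le_mono1)
  also have "\<dots> = (\<Sum>D\<in>?\<D>. card (?B D) * m ^ u)" by (simp add: sum_distrib_right)
  also have "\<dots> \<le> (\<Sum>D\<in>?\<D>. 2 ^ u * card \<Omega> ^ n)"
  proof (rule sum_mono)
    fix D assume D: "D \<in> ?\<D>"
    then have Dn: "D \<subseteq> {..<n}" "card D = u" "finite D" using finite_subset by auto
    have "card (?B D) = (\<Prod>r<n. if r \<in> D then card (H r) else card \<Omega>)"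
      by (subst card_PiE) (auto intro: prod.cong)
    also have "\<dots> = (\<Prod>r\<in>D. card (H r)) * card \<Omega> ^ (n - u)"
    proof -
      have "{..<n} \<inter> D = D" "card ({..<n} - D) = n - u" using Dn by (auto simp: card_Diff_subset)
      moreover have "{..<n} \<inter> - D = {..<n} - D" by blast
      ultimately show ?thesis by (subst prod.If_cases) simp_all
    qed
    finally have "card (?B D) * m ^ u = (\<Prod>r\<in>D. card (H r) * m) * card \<Omega> ^ (n - u)"
      using Dn(2) by (simp add: prod.distrib)
    also have "\<dots> \<le> (\<Prod>r\<in>D. 2 * card \<Omega>) * card \<Omega> ^ (n - u)"
      using H Dn by (intro mult_le_mono1 prod_mono) auto
    also have "\<dots> = 2 ^ u * card \<Omega> ^ n"
    proof -
      have "u \<le> n" using Dn card_mono[OF finite_lessThan Dn(1)] by simp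
      then show ?thesis by (simp add: Dn(2) power_mult_distrib mult.assoc power_add[symmetric])
    qed
    finally show "card (?B D) * m ^ u \<le> 2 ^ u * card \<Omega> ^ n" .
  qed
  also have "\<dots> \<le> 2 ^ n * (2 ^ u * card \<Omega> ^ n)"
  proof -
    have "card ?\<D> \<le> card (Pow {..<n})" by (intro card_mono) auto
    then show ?thesis by (simp add: card_Pow)
  qed
  finally show ?thesis by (simp add: power_add mult.assoc)
qed

text \<open>Lines with fewer than \<open>u\<close> hit rows are the good ones. A row involves at
  most three base variables, which gives support \<open>3 * u\<close>, and
  \<open>18 * u \<le> q\<close> is the bound \<open>6 * d \<le> q\<close> for
  \<open>d = 3 * u\<close>.\<close>

locale lifted_system = expanding_system k M q "\<lambda>g. h g ` {..<3}" \<sigma>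
  for k M q :: nat and h :: "nat \<Rightarrow> nat \<Rightarrow> nat" and \<sigma> +
  fixes m u :: nat
  assumes h: "g < M \<Longrightarrow> j < 3 \<Longrightarrow> h g j < k"
    and sigma_sub: "g < M \<Longrightarrow> \<sigma> g \<subseteq> h g ` {..<3}"
    and kM: "1 \<le> k" "1 \<le> M" and u: "1 \<le> u" "18 * u \<le> q"
begin

text \<open>For a clause row this is the truth of literal \<open>j\<close> of that clause: the base
  variable \<open>h g j\<close> has to differ from the forbidden pattern
  \<open>\<sigma> g\<close>.\<close>

definition active :: "nat \<Rightarrow> nat \<Rightarrow> nat set \<Rightarrow> bool" where
  "active r j A \<longleftrightarrow> (if r < k then r \<in> A else (h (r - k) j \<in> A) \<noteq> (h (r - k) j \<in> \<sigma> (r - k)))"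

definition base_row :: "nat \<Rightarrow> nat \<Rightarrow> nat" where
  "base_row r j = (if r < k then r else h (r - k) j)"

text \<open>\<open>\<rho> r\<close> consists of the pointer of row \<open>r\<close> and of the random values at its other places.\<close>

definition asg :: "(nat \<Rightarrow> nat \<times> (nat \<Rightarrow> nat)) \<Rightarrow> nat set \<Rightarrow> nat \<Rightarrow> bool" where
  "asg \<rho> A z \<longleftrightarrow> to_nat (from_nat z :: lifted_var) = z \<and> (case from_nat z of
      PV r v \<Rightarrow> v = fst (\<rho> r)
    | EV r v \<Rightarrow> v \<le> fst (\<rho> r)
    | YV r v j \<Rightarrow> r < k + M \<and> v < m \<and> j < 3 \<and> (if v = fst (\<rho> r) then active r j A else snd (\<rho> r) v = j)
    | TV g j v v' \<Rightarrow> v = fst (\<rho> (k + g)) \<and> v' = fst (\<rho> (h g j)))"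

lemma asg_simps [simp]:
  "asg \<rho> A (pv r v) \<longleftrightarrow> v = fst (\<rho> r)"
  "asg \<rho> A (evar r v) \<longleftrightarrow> v \<le> fst (\<rho> r)"
  "asg \<rho> A (yv r v j) \<longleftrightarrow> r < k + M \<and> v < m \<and> j < 3 \<and> (if v = fst (\<rho> r) then active r j A else snd (\<rho> r) v = j)"
  "asg \<rho> A (tv g j v v') \<longleftrightarrow> v = fst (\<rho> (k + g)) \<and> v' = fst (\<rho> (h g j))"
  by (simp_all add: asg_def)

lemma base_row: "r < k + M \<Longrightarrow> j < 3 \<Longrightarrow> base_row r j < k"
  using h by (simp add: base_row_def)

lemma depends_active: "depends {base_row r j} (active r j)"
  unfolding depends_def
proof (intro allI impI)
  fix A B :: "nat set" assume "A \<inter> {base_row r j} = B \<inter> {base_row r j}"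
  then have "base_row r j \<in> A \<longleftrightarrow> base_row r j \<in> B" by blast
  then show "active r j A = active r j B" by (simp add: active_def base_row_def split: if_splits)
qed

text \<open>Only value variables at active places follow the base assignment; everything else is
  fixed by \<open>\<rho>\<close>.\<close>

lemma depends_asg:
  assumes "\<And>r v j. z = yv r v j \<Longrightarrow> r < k + M \<Longrightarrow> v < m \<Longrightarrow> j < 3 \<Longrightarrow> v = fst (\<rho> r) \<Longrightarrow> base_row r j \<in> T"
  shows "depends T (\<lambda>A. asg \<rho> A z)"
proof (cases "\<exists>r v j. z = yv r v j \<and> r < k + M \<and> v < m \<and> j < 3 \<and> v = fst (\<rho> r)")
  case True
  then obtain r v j where z: "z = yv r v j" "r < k + M" "v < m" "j < 3" "v = fst (\<rho> r)" by blast
  then have "(\<lambda>A. asg \<rho> A z) = active r j" by (simp add: fun_eq_iff)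
  moreover have "depends T (active r j)" by (rule depends_mono[OF depends_active]) (use assms z in simp)
  ultimately show ?thesis by simp
next
  case False
  have "asg \<rho> A z = asg \<rho> {} z" for A
  proof (cases "to_nat (from_nat z :: lifted_var) = z")
    case True
    show ?thesis
    proof (cases "from_nat z :: lifted_var")
      case (YV r v j)
      then have "z = yv r v j" using True by simp
      then show ?thesis using False by auto
    qed (simp_all add: asg_def)
  qed (simp add: asg_def)
  then show ?thesis unfolding depends_def by blast
qed

definition restrictions :: "(nat \<Rightarrow> nat \<times> (nat \<Rightarrow> nat)) set" where
  "restrictions = {..<k + M} \<rightarrow>\<^sub>E row_config m"

lemma restriction:
  assumes "\<rho> \<in> restrictions" "r < k + M"
  shows "fst (\<rho> r) < m" and "v < m \<Longrightarrow> snd (\<rho> r) v < 3"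
proof -
  have "\<rho> r \<in> row_config m" using assms by (auto simp: restrictions_def)
  then show "fst (\<rho> r) < m" "v < m \<Longrightarrow> snd (\<rho> r) v < 3"
    by (auto simp: row_config_def PiE_iff mem_Times_iff)
qed

text \<open>All clauses hold for every base assignment, except for the choice clause at the active
  place of the row of a base clause \<open>g\<close>, which turns into that base clause.\<close>

lemma satisfies_lifted_cnf:
  assumes \<rho>: "\<rho> \<in> restrictions" and C: "C \<in> lifted_cnf k M h \<sigma> m"
  shows "\<exists>g<M. \<forall>A. sat g A \<longrightarrow> \<not> falsified (asg \<rho> A) C"
proof -
  \<comment> \<open>A clause that always holds is charged to constraint 0, which exists since
    \<open>1 \<le> M\<close>.\<close>
  have all: "\<exists>g<M. \<forall>A. sat g A \<longrightarrow> \<not> falsified (asg \<rho> A) C" if "\<And>A. \<exists>l\<in>C. lit_true (asg \<rho> A) l"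
    using that kM(2) by (intro exI[of _ 0]) (auto simp: falsified_def)
  from C show ?thesis
  proof (cases rule: lifted_cnf_cases)
    case (start r)
    show ?thesis by (rule all) (simp add: start)
  next
    case (stop r)
    show ?thesis by (rule all) (use restriction(1)[OF \<rho> stop(1)] in \<open>simp add: stop\<close>)
  next
    case (chain r v)
    show ?thesis by (rule all) (auto simp: chain)
  next
    case (pair g j v v')
    show ?thesis by (rule all) (auto simp: pair)
  next
    case (agree g j v v')
    have hk: "h g j < k" using h agree by simp
    show ?thesis by (rule all) (use agree hk in \<open>auto simp: active_def\<close>)
  next
    case (choice g v)
    have "\<exists>l\<in>C. lit_true (asg \<rho> A) l" if sat: "sat g A" for A
    proof (cases "v = fst (\<rho> (k + g))")
      case True
      have "\<exists>j<3. active (k + g) j A"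
      proof (rule ccontr)
        assume "\<not> ?thesis"
        then have "x \<in> A \<longleftrightarrow> x \<in> \<sigma> g" if "x \<in> h g ` {..<3}" for x
          using that by (auto simp: active_def)
        then have "A \<inter> h g ` {..<3} = \<sigma> g \<inter> h g ` {..<3}" by blast
        then show False using sat sigma_sub[OF choice(1)] unfolding sat_def by blast
      qed
      then obtain j where "j < 3" "active (k + g) j A" by blast
      moreover from this have "j = 0 \<or> j = 1 \<or> j = 2" by linarith
      ultimately show ?thesis using True choice by auto
    next
      case False
      have "snd (\<rho> (k + g)) v < 3" using restriction(2)[OF \<rho>] choice by simp
      then have "snd (\<rho> (k + g)) v = 0 \<or> snd (\<rho> (k + g)) v = 1 \<or> snd (\<rho> (k + g)) v = 2" by linarith
      then show ?thesis using False choice by auto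
    qed
    then show ?thesis using choice(1) by (auto simp: falsified_def)
  qed
qed

lemma restricted:
  assumes \<rho>: "\<rho> \<in> restrictions"
  shows "restricted_system k M q (\<lambda>g. h g ` {..<3}) \<sigma> (asg \<rho>) (lifted_cnf k M h \<sigma> m) (3 * u)"
proof unfold_locales
  show "\<exists>x<k. depends {x} (\<lambda>A. asg \<rho> A z)" for z
  proof (cases "\<exists>r v j. z = yv r v j \<and> r < k + M \<and> j < 3")
    case True
    then obtain r v j where z: "z = yv r v j" "r < k + M" "j < 3" by blast
    have "depends {base_row r j} (\<lambda>A. asg \<rho> A z)" by (rule depends_asg) (use z in auto)
    then show ?thesis using base_row[OF z(2,3)] by blast
  next
    case False
    then have "depends {0} (\<lambda>A. asg \<rho> A z)" by (intro depends_asg) blast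
    then show ?thesis using kM(1) by (intro exI[of _ 0]) simp
  qed
  show "3 \<le> 3 * u" "6 * (3 * u) \<le> q" using u by simp_all
  fix C assume C: "C \<in> lifted_cnf k M h \<sigma> m"
  show "finite C \<and> card C \<le> 3 \<and> (\<exists>g<M. \<forall>A. sat g A \<longrightarrow> \<not> falsified (asg \<rho> A) C)"
    using three_cnf_lifted_cnf C satisfies_lifted_cnf[OF \<rho> C] unfolding three_cnf_def by blast
qed

definition places :: "nat clause \<Rightarrow> nat \<Rightarrow> nat set" where
  "places C r = {v. v < m \<and> (\<exists>l\<in>C. \<exists>j<3. var l = yv r v j)}"

definition kill :: "nat clause \<Rightarrow> nat \<Rightarrow> nat \<Rightarrow> nat" where
  "kill C r v = (SOME b. b < 3 \<and> (\<exists>j<3. Pos (yv r v j) \<in> C \<and> b = j \<or> Neg (yv r v j) \<in> C \<and> b \<noteq> j))"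

text \<open>A positive literal is satisfied by its own index and a negative one by any other value,
  so every mentioned place has a value that satisfies the clause when the place is inactive.\<close>

lemma kill:
  assumes "v \<in> places C r"
  shows "kill C r v < 3" "\<exists>j<3. Pos (yv r v j) \<in> C \<and> kill C r v = j \<or> Neg (yv r v j) \<in> C \<and> kill C r v \<noteq> j"
proof -
  obtain l j where l: "l \<in> C" "j < 3" "var l = yv r v j" using assms by (auto simp: places_def)
  have "\<exists>b<3. \<exists>j<3. Pos (yv r v j) \<in> C \<and> b = j \<or> Neg (yv r v j) \<in> C \<and> b \<noteq> j"
  proof (cases l)
    case (Pos x)
    then show ?thesis using l by (intro exI[of _ j]) auto
  next
    case (Neg x)
    have "(if j = 0 then 1 else 0) < (3::nat)" "(if j = 0 then 1 else 0) \<noteq> j" by simp_all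
    then show ?thesis using l Neg by (intro exI[of _ "if j = 0 then 1 else 0"]) auto
  qed
  from someI_ex[OF this[folded]] show "kill C r v < 3"
    "\<exists>j<3. Pos (yv r v j) \<in> C \<and> kill C r v = j \<or> Neg (yv r v j) \<in> C \<and> kill C r v \<noteq> j"
    unfolding kill_def by blast+
qed

definition hit :: "nat clause \<Rightarrow> nat \<Rightarrow> (nat \<times> (nat \<Rightarrow> nat)) set" where
  "hit C r = {(a, b) \<in> row_config m. a \<in> places C r \<and> (\<forall>v\<in>places C r - {a}. b v \<noteq> kill C r v)}"

text \<open>If some inactive place takes its killing value, the clause is always true and its
  support is empty. Otherwise every row whose active place is mentioned is among the fewer than
  \<open>u\<close> hit rows, and each of them contributes at most three base variables.\<close>

lemma few_hits_small_support:
  assumes \<rho>: "\<rho> \<in> restrictions" and few: "card {r. r < k + M \<and> \<rho> r \<in> hit C r} < u"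
  shows "restricted_system.small_support k (asg \<rho>) (3 * u) C"
proof -
  interpret restricted_system k M q "\<lambda>g. h g ` {..<3}" \<sigma> "asg \<rho>" "lifted_cnf k M h \<sigma> m" "3 * u"
    by (rule restricted[OF \<rho>])
  show ?thesis
  proof (cases "\<exists>r<k + M. \<exists>v\<in>places C r. v \<noteq> fst (\<rho> r) \<and> snd (\<rho> r) v = kill C r v")
    case True
    then obtain r v where r: "r < k + M" "v \<in> places C r" "v \<noteq> fst (\<rho> r)" "snd (\<rho> r) v = kill C r v" by blast
    have vm: "v < m" using r(2) by (simp add: places_def)
    obtain j where j: "j < 3" "Pos (yv r v j) \<in> C \<and> kill C r v = j \<or> Neg (yv r v j) \<in> C \<and> kill C r v \<noteq> j"
      using kill(2)[OF r(2)] by blast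
    have "\<exists>l\<in>C. lit_true (asg \<rho> A) l" for A
      using j(2)
    proof
      assume "Pos (yv r v j) \<in> C \<and> kill C r v = j"
      then show ?thesis using r vm j(1) by (intro bexI[of _ "Pos (yv r v j)"]) auto
    next
      assume "Neg (yv r v j) \<in> C \<and> kill C r v \<noteq> j"
      then show ?thesis using r vm j(1) by (intro bexI[of _ "Neg (yv r v j)"]) auto
    qed
    then have "falsified (asg \<rho> A) C = False" for A unfolding falsified_def by blast
    then have "(\<lambda>A. falsified (asg \<rho> A) C) = (\<lambda>_. False)" by (rule ext)
    then show ?thesis unfolding small_support_def by (intro exI[of _ "{}"]) simp
  next
    case False
    define L where "L = {r. r < k + M \<and> \<rho> r \<in> hit C r}"
    have alive: "r \<in> L" if "r < k + M" "fst (\<rho> r) \<in> places C r" for r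
    proof -
      have "\<rho> r \<in> row_config m" using \<rho> that(1) by (auto simp: restrictions_def)
      moreover have "snd (\<rho> r) v \<noteq> kill C r v" if "v \<in> places C r - {fst (\<rho> r)}" for v
        using that \<open>r < k + M\<close> False by blast
      ultimately have "\<rho> r \<in> hit C r"
        using that(2) unfolding hit_def by (cases "\<rho> r") auto
      then show ?thesis using that(1) by (simp add: L_def)
    qed
    define T where "T = (\<Union>r\<in>L. base_row r ` {..<3})"
    have fL: "finite L" by (simp add: L_def)
    have TX: "T \<subseteq> {..<k}" using base_row by (auto simp: T_def L_def)
    have "card T \<le> (\<Sum>r\<in>L. card (base_row r ` {..<3}))" unfolding T_def by (rule card_UN_le[OF fL])
    also have "\<dots> \<le> (\<Sum>r\<in>L. 3)" by (rule sum_mono) (use card_image_le[of "{..<3::nat}"] in auto)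
    also have "\<dots> \<le> 3 * u" using few by (simp add: L_def)
    finally have cT: "card T \<le> 3 * u" .
    have "depends T (\<lambda>A. falsified (asg \<rho> A) C)"
    proof (rule depends_falsified)
      fix z assume "z \<in> var ` C"
      then obtain l where l: "l \<in> C" "z = var l" by blast
      show "depends T (\<lambda>A. asg \<rho> A z)"
      proof (rule depends_asg)
        fix r v j assume z: "z = yv r v j" "r < k + M" "v < m" "j < 3" "v = fst (\<rho> r)"
        then have "fst (\<rho> r) \<in> places C r" using l by (auto simp: places_def)
        then show "base_row r j \<in> T" using alive[OF z(2)] z(4) by (auto simp: T_def)
      qed
    qed
    then show ?thesis unfolding small_support_def using TX cT by blast
  qed
qed

lemma good_restriction_exists:
  assumes fin: "finite \<C>" and small: "card \<C> * 2 ^ (k + M + u) < m ^ u"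
  shows "\<exists>\<rho>\<in>restrictions. \<forall>C\<in>\<C>. restricted_system.small_support k (asg \<rho>) (3 * u) C"
proof (rule ccontr)
  assume neg: "\<not> ?thesis"
  define Bad where "Bad C = {\<rho> \<in> restrictions. u \<le> card {r. r < k + M \<and> \<rho> r \<in> hit C r}}" for C
  have m: "0 < m" using small u(1) by (cases "m = 0") (auto simp: power_0_left)
  let ?w = "card (row_config m)"
  have fR: "finite (row_config m)" by (simp add: row_config_def finite_PiE)
  have cR: "card restrictions = ?w ^ (k + M)" by (simp add: restrictions_def card_funcsetE)
  have fB: "finite (Bad C)" for C
    unfolding Bad_def restrictions_def using fR by (auto intro!: finite_PiE)
  have bad: "card (Bad C) * m ^ u \<le> 2 ^ (k + M + u) * ?w ^ (k + M)" for C
    unfolding Bad_def restrictions_def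
  proof (rule card_many_hits[OF fR])
    fix r
    have "hit C r \<subseteq> row_config m" by (auto simp: hit_def)
    moreover have "card (hit C r) * m \<le> 2 * ?w"
      unfolding hit_def by (rule card_unkilled) (use kill in \<open>auto simp: places_def\<close>)
    ultimately show "hit C r \<subseteq> row_config m \<and> card (hit C r) * m \<le> 2 * ?w" by blast
  qed
  have "restrictions \<subseteq> (\<Union>C\<in>\<C>. Bad C)"
    using neg few_hits_small_support unfolding Bad_def by (force simp: not_le[symmetric])
  then have "card restrictions \<le> card (\<Union>C\<in>\<C>. Bad C)" using fin fB by (intro card_mono) auto
  also have "\<dots> \<le> (\<Sum>C\<in>\<C>. card (Bad C))" by (rule card_UN_le[OF fin])
  finally have "?w ^ (k + M) * m ^ u \<le> (\<Sum>C\<in>\<C>. card (Bad C)) * m ^ u"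
    unfolding cR by (rule mult_le_mono1)
  also have "\<dots> = (\<Sum>C\<in>\<C>. card (Bad C) * m ^ u)" by (simp add: sum_distrib_right)
  also have "\<dots> \<le> (\<Sum>C\<in>\<C>. 2 ^ (k + M + u) * ?w ^ (k + M))" by (rule sum_mono) (rule bad)
  also have "\<dots> = ?w ^ (k + M) * (card \<C> * 2 ^ (k + M + u))" by simp
  also have "\<dots> < ?w ^ (k + M) * m ^ u"
    using small m by (intro mult_strict_left_mono) (simp_all add: card_row_config)
  finally show False by simp
qed

section \<open>Size lower bounds for the lifted formula\<close>

theorem resolution_lower_bound:
  assumes "res_refutation (lifted_cnf k M h \<sigma> m) \<pi>"
  shows "m ^ u \<le> res_size \<pi> * 2 ^ (k + M + u)"
proof (rule ccontr)
  assume "\<not> ?thesis"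
  moreover have "card (fst ` set \<pi>) \<le> length \<pi>"
    by (metis card_image_le card_length finite_set order_trans)
  then have "card (fst ` set \<pi>) * 2 ^ (k + M + u) \<le> res_size \<pi> * 2 ^ (k + M + u)" by (simp add: res_size_def)
  ultimately have "card (fst ` set \<pi>) * 2 ^ (k + M + u) < m ^ u" by linarith
  then obtain \<rho> where \<rho>: "\<rho> \<in> restrictions" "\<forall>C\<in>fst ` set \<pi>. restricted_system.small_support k (asg \<rho>) (3 * u) C"
    using good_restriction_exists[of "fst ` set \<pi>"] by auto
  interpret restricted_system k M q "\<lambda>g. h g ` {..<3}" \<sigma> "asg \<rho>" "lifted_cnf k M h \<sigma> m" "3 * u"
    by (rule restricted[OF \<rho>(1)])
  show False using resolution_refutation_large_support[OF assms] \<rho>(2) by force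
qed

theorem pcr_lower_bound:
  fixes ps :: "(nat lit, 'f::field) mpoly list"
  assumes "pcr_refutation (lifted_cnf k M h \<sigma> m) ps"
  shows "m ^ u \<le> pcr_size ps * 2 ^ (k + M + u)"
proof (rule ccontr)
  assume neg: "\<not> ?thesis"
  let ?\<C> = "Poly_Mapping.keys ` (\<Union>p\<in>set ps. Poly_Mapping.keys p)"
  have "card (\<Union>p\<in>set ps. Poly_Mapping.keys p) \<le> pcr_size ps"
  proof (induction ps)
    case (Cons p ps)
    have "card (Poly_Mapping.keys p \<union> (\<Union>p\<in>set ps. Poly_Mapping.keys p))
      \<le> card (Poly_Mapping.keys p) + card (\<Union>p\<in>set ps. Poly_Mapping.keys p)" by (rule card_Un_le)
    then show ?case using Cons.IH by (simp add: pcr_size_def num_terms_def)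
  qed (simp add: pcr_size_def)
  then have "card ?\<C> \<le> pcr_size ps"
    by (meson card_image_le finite_UN_I finite_keys finite_set order_trans)
  then have "card ?\<C> * 2 ^ (k + M + u) \<le> pcr_size ps * 2 ^ (k + M + u)" by (rule mult_le_mono1)
  then have "card ?\<C> * 2 ^ (k + M + u) < m ^ u" using neg by linarith
  then obtain \<rho> where \<rho>: "\<rho> \<in> restrictions" "\<forall>C\<in>?\<C>. restricted_system.small_support k (asg \<rho>) (3 * u) C"
    using good_restriction_exists[of ?\<C>] by auto
  interpret restricted_system k M q "\<lambda>g. h g ` {..<3}" \<sigma> "asg \<rho>" "lifted_cnf k M h \<sigma> m" "3 * u"
    by (rule restricted[OF \<rho>(1)])
  show False using pcr_refutation_large_support[OF assms] \<rho>(2) by force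
qed

text \<open>A summand with a nonzero product has at least one term, so the size bounds the number of
  clauses for which the restriction has to be good.\<close>

theorem sa_lower_bound:
  assumes "sa_refutation (lifted_cnf k M h \<sigma> m) \<pi>"
  shows "m ^ u \<le> sa_size \<pi> * 2 ^ (k + M + u)"
proof (rule ccontr)
  assume neg: "\<not> ?thesis"
  let ?S = "\<lambda>\<pi>. {(a, I, J, p) \<in> set \<pi>. sa_product I J p \<noteq> 0}"
  let ?c = "\<lambda>(a, I, J, p). Neg ` I \<union> Pos ` J"
  have "card (?S \<pi>) \<le> sa_size \<pi>"
  proof (induction \<pi>)
    case (Cons s \<pi>)
    obtain a I J p where s: "s = (a, I, J, p)" by (cases s)
    have sz: "sa_size (s # \<pi>) = num_terms (sa_product I J p) + sa_size \<pi>" by (simp add: sa_size_def s)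
    have fin: "finite (?S \<pi>)" by (rule finite_subset[of _ "set \<pi>"]) auto
    show ?case
    proof (cases "sa_product I J p = 0")
      case True
      then have "?S (s # \<pi>) = ?S \<pi>" by (auto simp: s)
      then show ?thesis using Cons.IH sz by simp
    next
      case False
      then have "?S (s # \<pi>) = insert s (?S \<pi>)" by (auto simp: s)
      then have "card (?S (s # \<pi>)) \<le> Suc (card (?S \<pi>))" using fin by (simp add: card_insert_le_m1 card_insert_if)
      moreover have "1 \<le> num_terms (sa_product I J p)"
        using False by (simp add: num_terms_def Suc_le_eq card_gt_0_iff)
      ultimately show ?thesis using Cons.IH sz by linarith
    qed
  qed (simp add: sa_size_def)
  moreover have fin: "finite (?S \<pi>)" by (rule finite_subset[of _ "set \<pi>"]) auto
  ultimately have "card (?c ` ?S \<pi>) \<le> sa_size \<pi>" by (meson card_image_le order_trans)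
  then have "card (?c ` ?S \<pi>) * 2 ^ (k + M + u) \<le> sa_size \<pi> * 2 ^ (k + M + u)" by (rule mult_le_mono1)
  then have "card (?c ` ?S \<pi>) * 2 ^ (k + M + u) < m ^ u" using neg by linarith
  then obtain \<rho> where \<rho>: "\<rho> \<in> restrictions" "\<forall>C\<in>?c ` ?S \<pi>. restricted_system.small_support k (asg \<rho>) (3 * u) C"
    using good_restriction_exists[of "?c ` ?S \<pi>"] fin by auto
  interpret restricted_system k M q "\<lambda>g. h g ` {..<3}" \<sigma> "asg \<rho>" "lifted_cnf k M h \<sigma> m" "3 * u"
    by (rule restricted[OF \<rho>(1)])
  show False using sa_refutation_large_support[OF assms] \<rho>(2) by force
qed

end

section \<open>The upper bound\<close>

text \<open>One derivation meets the bounds \<open>w\<close> on width, \<open>s\<close> on space and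
  \<open>n\<close> on size, as the simultaneous upper bound requires.\<close>

definition derivable :: "'v cnf \<Rightarrow> nat \<Rightarrow> nat \<Rightarrow> nat \<Rightarrow> 'v clause \<Rightarrow> bool" where
  "derivable F w s n C \<longleftrightarrow> (\<exists>\<pi>. res_derivation F C \<pi> \<and> length \<pi> \<le> n \<and>
     (\<forall>t<length \<pi>. card (fst (\<pi> ! t)) \<le> w \<and> res_space_at \<pi> t \<le> s))"

lemma derivable_mono: "derivable F w s n C \<Longrightarrow> s \<le> s' \<Longrightarrow> n \<le> n' \<Longrightarrow> derivable F w s' n' C"
  unfolding derivable_def by (meson order_trans)

lemma derivable_finite:
  assumes "derivable F w s n C"
  shows "finite C"
proof -
  obtain \<pi> where "res_derivation F C \<pi>" using assms by (auto simp: derivable_def)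
  then have "\<pi> \<noteq> []" "fst (last \<pi>) = C" "\<forall>t<length \<pi>. finite (fst (\<pi> ! t))"
    by (auto simp: res_derivation_def)
  then show ?thesis by (metis diff_less last_conv_nth length_greater_0_conv zero_less_one)
qed

lemma derivable_axiom:
  assumes "C \<in> F" "finite C" "card C \<le> w"
  shows "derivable F w 1 1 C"
proof -
  have "res_space_at [(C, Axiom)] 0 = 1" by (simp add: res_space_at_def)
  then show ?thesis unfolding derivable_def
    by (intro exI[of _ "[(C, Axiom)]"]) (use assms in \<open>simp add: res_derivation_def\<close>)
qed

section \<open>Composing derivations\<close>

fun shift :: "nat \<Rightarrow> rule \<Rightarrow> rule" where
  "shift n Axiom = Axiom"
| "shift n (Resolve i j) = Resolve (i + n) (j + n)"
| "shift n (Weaken i) = Weaken (i + n)"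

lemma premise_shift: "premise_idx (shift n r) = (\<lambda>i. i + n) ` premise_idx r"
  by (cases r) auto

lemma res_step_shift: "res_step F D C (shift n r) = res_step F (\<lambda>i. D (i + n)) C r"
  by (cases r) auto

lemma res_step_cong: "(\<And>i. i \<in> premise_idx r \<Longrightarrow> D i = D' i) \<Longrightarrow> res_step F D C r = res_step F D' C r"
  by (cases r) auto

abbreviation live :: "'v res_proof \<Rightarrow> nat \<Rightarrow> nat set" where
  "live \<pi> t \<equiv> {i. i \<le> t \<and> (\<exists>j. t \<le> j \<and> j < length \<pi> \<and> i \<in> premise_idx (snd (\<pi> ! j)))}"

lemma res_space_at_le:
  assumes "S \<supseteq> live \<pi> t" "t \<in> S" "finite S" "card S \<le> s"
  shows "res_space_at \<pi> t \<le> s"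
proof -
  have "res_space_at \<pi> t \<le> card S" unfolding res_space_at_def using assms(1-3) by (intro card_mono) auto
  then show ?thesis using assms(4) by simp
qed

lemma derivable_axiom_weaken:
  assumes "C \<in> F" "C \<subseteq> C'" "finite C'" "card C' \<le> w"
  shows "derivable F w 2 2 C'"
proof -
  let ?\<pi> = "[(C, Axiom), (C', Weaken 0)]"
  have fin: "finite C" and card: "card C \<le> w"
    using assms(2-4) finite_subset[of C C'] card_mono[of C' C] by auto
  have "res_derivation F C' ?\<pi>"
    using assms fin by (simp add: res_derivation_def less_Suc_eq)
  moreover have "res_space_at ?\<pi> t \<le> 2" if "t < 2" for t
    by (rule res_space_at_le[of _ _ "{..t}"]) (use that in auto)
  ultimately show ?thesis
    unfolding derivable_def using assms(4) card by (intro exI[of _ ?\<pi>]) (simp add: less_Suc_eq)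
qed

text \<open>The derivation of \<open>C1\<close> comes first, and only its last line is kept while
  \<open>C2\<close> is derived, hence \<open>s2 + 1\<close>; the final inference needs both premises
  and the conclusion. The assumption \<open>step\<close> does not fix which premise carries the
  positive literal, so either may be derived first.\<close>

lemma derivable_combine:
  assumes d1: "derivable F w s1 n1 C1" and d2: "derivable F w s2 n2 C2"
    and C: "finite C" "card C \<le> w"
    and step: "\<And>i j. \<exists>r. premise_idx r = {i, j} \<and> (\<forall>D. D i = C1 \<longrightarrow> D j = C2 \<longrightarrow> res_step F D C r)"
  shows "derivable F w (max s1 (max (s2 + 1) 3)) (n1 + n2 + 1) C"
proof -
  obtain \<pi>1 where p1: "res_derivation F C1 \<pi>1" "length \<pi>1 \<le> n1"
    "\<And>t. t < length \<pi>1 \<Longrightarrow> card (fst (\<pi>1 ! t)) \<le> w \<and> res_space_at \<pi>1 t \<le> s1"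
    using d1 by (auto simp: derivable_def)
  obtain \<pi>2 where p2: "res_derivation F C2 \<pi>2" "length \<pi>2 \<le> n2"
    "\<And>t. t < length \<pi>2 \<Longrightarrow> card (fst (\<pi>2 ! t)) \<le> w \<and> res_space_at \<pi>2 t \<le> s2"
    using d2 by (auto simp: derivable_def)
  define a where "a = length \<pi>1"
  define b where "b = length \<pi>2"
  have ab: "0 < a" "0 < b" "fst (\<pi>1 ! (a - 1)) = C1" "fst (\<pi>2 ! (b - 1)) = C2"
    using p1(1) p2(1) by (auto simp: a_def b_def res_derivation_def last_conv_nth)
  have l1: "finite (fst (\<pi>1 ! t)) \<and> (\<forall>i\<in>premise_idx (snd (\<pi>1 ! t)). i < t) \<and>
        res_step F (\<lambda>i. fst (\<pi>1 ! i)) (fst (\<pi>1 ! t)) (snd (\<pi>1 ! t))" if "t < a" for t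
    using p1(1) that by (simp add: res_derivation_def a_def)
  have l2: "finite (fst (\<pi>2 ! t)) \<and> (\<forall>i\<in>premise_idx (snd (\<pi>2 ! t)). i < t) \<and>
        res_step F (\<lambda>i. fst (\<pi>2 ! i)) (fst (\<pi>2 ! t)) (snd (\<pi>2 ! t))" if "t < b" for t
    using p2(1) that by (simp add: res_derivation_def b_def)
  obtain r where r: "premise_idx r = {a - 1, a + b - 1}"
    "\<And>D. D (a - 1) = C1 \<Longrightarrow> D (a + b - 1) = C2 \<Longrightarrow> res_step F D C r"
    using step[of "a - 1" "a + b - 1"] by blast
  define \<pi> where "\<pi> = \<pi>1 @ map (\<lambda>(C, r). (C, shift a r)) \<pi>2 @ [(C, r)]"
  have len: "length \<pi> = a + b + 1" by (simp add: \<pi>_def a_def b_def)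
  have n1: "\<pi> ! t = \<pi>1 ! t" if "t < a" for t using that by (simp add: \<pi>_def a_def nth_append)
  have n2: "\<pi> ! (t + a) = (fst (\<pi>2 ! t), shift a (snd (\<pi>2 ! t)))" if "t < b" for t
    using that by (simp add: \<pi>_def a_def b_def nth_append split: prod.splits)
  have n3: "\<pi> ! (a + b) = (C, r)" by (simp add: \<pi>_def a_def b_def nth_append)
  have range: P if t: "t < a + b + 1" "t < a \<Longrightarrow> P" "\<And>t'. t' < b \<Longrightarrow> t = t' + a \<Longrightarrow> P" "t = a + b \<Longrightarrow> P" for t P
  proof -
    consider "t < a" | "a \<le> t" "t < a + b" | "t = a + b" using t(1) by linarith
    then show P
    proof cases
      case 2
      then show P using t(3)[of "t - a"] by simp
    qed (use t in auto)
  qed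
  have D1: "fst (\<pi> ! (a - 1)) = C1" using n1[of "a - 1"] ab by simp
  have D2: "fst (\<pi> ! (a + b - 1)) = C2"
  proof -
    have "b - 1 + a = a + b - 1" using ab by simp
    then show ?thesis using n2[of "b - 1"] ab by simp
  qed
  have line: "finite (fst (\<pi> ! t)) \<and> (\<forall>i\<in>premise_idx (snd (\<pi> ! t)). i < t) \<and>
        res_step F (\<lambda>i. fst (\<pi> ! i)) (fst (\<pi> ! t)) (snd (\<pi> ! t))" if t: "t < a + b + 1" for t
  proof (rule range[OF t])
    assume ta: "t < a"
    have "res_step F (\<lambda>i. fst (\<pi> ! i)) (fst (\<pi>1 ! t)) (snd (\<pi>1 ! t)) =
        res_step F (\<lambda>i. fst (\<pi>1 ! i)) (fst (\<pi>1 ! t)) (snd (\<pi>1 ! t))"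
    proof (rule res_step_cong)
      fix i assume "i \<in> premise_idx (snd (\<pi>1 ! t))"
      then have "i < a" using l1[OF ta] ta by auto
      then show "fst (\<pi> ! i) = fst (\<pi>1 ! i)" using n1 by simp
    qed
    then show ?thesis using l1[OF ta] n1[OF ta] by simp
  next
    fix t' assume t': "t' < b" "t = t' + a"
    have "res_step F (\<lambda>i. fst (\<pi> ! (i + a))) (fst (\<pi>2 ! t')) (snd (\<pi>2 ! t')) =
        res_step F (\<lambda>i. fst (\<pi>2 ! i)) (fst (\<pi>2 ! t')) (snd (\<pi>2 ! t'))"
    proof (rule res_step_cong)
      fix i assume "i \<in> premise_idx (snd (\<pi>2 ! t'))"
      then have "i < b" using l2[OF t'(1)] t'(1) by auto
      then show "fst (\<pi> ! (i + a)) = fst (\<pi>2 ! i)" using n2 by simp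
    qed
    then show ?thesis using l2[OF t'(1)] by (simp add: t'(2) n2[OF t'(1)] premise_shift res_step_shift)
  next
    assume "t = a + b"
    then show ?thesis using r(1) r(2)[of "\<lambda>i. fst (\<pi> ! i)"] D1 D2 C(1) ab by (simp add: n3)
  qed
  have space: "card (fst (\<pi> ! t)) \<le> w \<and> res_space_at \<pi> t \<le> max s1 (max (s2 + 1) 3)" if t: "t < a + b + 1" for t
  proof (rule range[OF t])
    assume ta: "t < a"
    let ?S = "live \<pi>1 t \<union> {t}"
    have "res_space_at \<pi> t \<le> s1"
    proof (rule res_space_at_le[of _ _ ?S])
      show "live \<pi> t \<subseteq> ?S"
      proof
        fix i assume "i \<in> live \<pi> t"
        then obtain j where j: "i \<le> t" "t \<le> j" "j < a + b + 1" "i \<in> premise_idx (snd (\<pi> ! j))"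
          by (auto simp: len)
        show "i \<in> ?S"
        proof (rule range[OF j(3)])
          assume "j < a"
          then show ?thesis using j n1 by (auto simp: a_def)
        next
          fix j' assume "j' < b" "j = j' + a"
          then show ?thesis using j n2 ta by (auto simp: premise_shift)
        next
          assume "j = a + b"
          then have "i = a - 1 \<or> i = a + b - 1" using j r(1) n3 by simp
          then show ?thesis using j(1) ta ab by auto
        qed
      qed
      show "card ?S \<le> s1" using p1(3)[of t] ta by (simp add: res_space_at_def a_def)
    qed auto
    then show ?thesis using p1(3)[of t] ta n1[OF ta] by (simp add: a_def)
  next
    fix t' assume t': "t' < b" "t = t' + a"
    let ?S2 = "live \<pi>2 t' \<union> {t'}"
    let ?S = "insert (a - 1) ((\<lambda>i. i + a) ` ?S2)"
    have "res_space_at \<pi> t \<le> s2 + 1"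
    proof (rule res_space_at_le[of _ _ ?S])
      show "live \<pi> t \<subseteq> ?S"
      proof
        fix i assume "i \<in> live \<pi> t"
        then obtain j where j: "i \<le> t" "t \<le> j" "j < a + b + 1" "i \<in> premise_idx (snd (\<pi> ! j))"
          by (auto simp: len)
        show "i \<in> ?S"
        proof (rule range[OF j(3)])
          assume "j < a"
          then show ?thesis using j t' by simp
        next
          fix j' assume j': "j' < b" "j = j' + a"
          then obtain i' where i': "i = i' + a" "i' \<in> premise_idx (snd (\<pi>2 ! j'))"
            using j n2 by (auto simp: premise_shift)
          then have "i' \<in> ?S2" using j j' t' by (auto simp: b_def)
          then show ?thesis using i' by blast
        next
          assume "j = a + b"
          then have "i = a - 1 \<or> i = a + b - 1" using j r(1) n3 by simp
          then show ?thesis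
          proof
            assume i: "i = a + b - 1"
            then have "i = t' + a" using j(1) t' by linarith
            then show ?thesis by blast
          qed simp
        qed
      qed
      show "t \<in> ?S" using t' by blast
      show "finite ?S" by simp
      have "card ?S \<le> Suc (card ((\<lambda>i. i + a) ` ?S2))" by (simp add: card_insert_le_m1 card_insert_if)
      also have "card ((\<lambda>i. i + a) ` ?S2) = card ?S2" by (rule card_image) (simp add: inj_on_def)
      also have "card ?S2 \<le> s2" using p2(3)[of t'] t' by (simp add: res_space_at_def b_def)
      finally show "card ?S \<le> s2 + 1" by simp
    qed
    then show ?thesis using p2(3)[of t'] t' n2[OF t'(1)] by (simp add: b_def)
  next
    assume t: "t = a + b"
    have "res_space_at \<pi> t \<le> 3"
    proof (rule res_space_at_le[of _ _ "set [a - 1, a + b - 1, t]"])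
      show "live \<pi> t \<subseteq> set [a - 1, a + b - 1, t]"
      proof
        fix i assume "i \<in> live \<pi> t"
        then obtain j where j: "t \<le> j" "j < a + b + 1" "i \<in> premise_idx (snd (\<pi> ! j))" by (auto simp: len)
        then have "j = a + b" using t by simp
        then show "i \<in> set [a - 1, a + b - 1, t]" using j(3) r(1) n3 by auto
      qed
      show "card (set [a - 1, a + b - 1, t]) \<le> 3" using card_length[of "[a - 1, a + b - 1, t]"] by simp
    qed simp_all
    then show ?thesis using C(2) by (simp add: t n3)
  qed
  have "res_derivation F C \<pi>" using line len unfolding res_derivation_def by (simp add: \<pi>_def)
  moreover have "length \<pi> \<le> n1 + n2 + 1" using p1(2) p2(2) by (simp add: len a_def b_def)
  ultimately show ?thesis using space unfolding derivable_def by (intro exI[of _ \<pi>]) (simp add: len)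
qed

lemma derivable_resolve:
  assumes "derivable F w s1 n1 (insert (Pos x) A)" "derivable F w s2 n2 (insert (Neg x) B)" "card (A \<union> B) \<le> w"
  shows "derivable F w (max s1 (max (s2 + 1) 3)) (n1 + n2 + 1) (A \<union> B)"
proof (rule derivable_combine[OF assms(1,2) _ assms(3)])
  show "finite (A \<union> B)" using derivable_finite[OF assms(1)] derivable_finite[OF assms(2)] by simp
  show "\<exists>r. premise_idx r = {i, j} \<and> (\<forall>D. D i = insert (Pos x) A \<longrightarrow> D j = insert (Neg x) B \<longrightarrow> res_step F D (A \<union> B) r)" for i j
    by (intro exI[of _ "Resolve i j"]) auto
qed

text \<open>The order matters for space: the premise derived first is not charged the extra
  clause.\<close>

lemma derivable_resolve':
  assumes "derivable F w s1 n1 (insert (Neg x) B)" "derivable F w s2 n2 (insert (Pos x) A)" "card (A \<union> B) \<le> w"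
  shows "derivable F w (max s1 (max (s2 + 1) 3)) (n1 + n2 + 1) (A \<union> B)"
proof (rule derivable_combine[OF assms(1,2) _ assms(3)])
  show "finite (A \<union> B)" using derivable_finite[OF assms(1)] derivable_finite[OF assms(2)] by simp
  show "\<exists>r. premise_idx r = {i, j} \<and> (\<forall>D. D i = insert (Neg x) B \<longrightarrow> D j = insert (Pos x) A \<longrightarrow> res_step F D (A \<union> B) r)" for i j
    by (intro exI[of _ "Resolve j i"]) auto
qed

text \<open>The two literals made false by the decision that row \<open>r\<close> points to
  \<open>v\<close> and answers \<open>b\<close>. In the row of a base variable, 0 stands for true
  and any other answer for false; in the row of a base clause, \<open>b\<close> is the literal
  claimed to be true.\<close>

definition decision :: "nat \<Rightarrow> nat \<Rightarrow> nat \<times> nat \<Rightarrow> nat clause" where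
  "decision k r vb = (case vb of (v, b) \<Rightarrow>
     {Neg (pv r v), if r < k then (if b = 0 then Neg (yv r v 0) else Pos (yv r v 0)) else Neg (yv r v b)})"

text \<open>The decision tree that asks all rows in turn for pointer and answer, read from the
  leaves to the root: a node at depth \<open>r\<close> becomes the clause \<open>ctx f r\<close>
  with at most \<open>2 * r\<close> literals. Each level adds 2 to the space and a factor linear in
  \<open>m\<close> to the size.\<close>

theorem lifted_cnf_refutable:
  fixes k M m :: nat
  assumes h: "\<And>g j. g < M \<Longrightarrow> j < 3 \<Longrightarrow> h g j < k"
    and unsat: "\<And>A. \<exists>g<M. A \<inter> h g ` {..<3} = \<sigma> g" and k: "1 \<le> k"
  defines "w \<equiv> 2 * (k + M) + 3"
  shows "derivable (lifted_cnf k M h \<sigma> m) w w (5 * (20 * (m + 1)) ^ (k + M)) {}"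
proof -
  let ?F = "lifted_cnf k M h \<sigma> m"
  define R where "R = k + M"
  define ctx where "ctx f r = (\<Union>i<r. decision k i (f i))" for f :: "nat \<Rightarrow> nat \<times> nat" and r
  have F: "finite C \<and> card C \<le> 3" if "C \<in> ?F" for C
    using three_cnf_lifted_cnf that by (auto simp: three_cnf_def)
  have ax: "derivable ?F w 1 1 C" if "C \<in> ?F" for C
    using F[OF that] by (intro derivable_axiom that) (auto simp: w_def)
  have ctx: "finite (ctx f r)" "card (ctx f r) \<le> 2 * r" for f r
  proof -
    have dec: "finite (decision k i vb)" "card (decision k i vb) \<le> 2" for i vb
      by (auto simp: decision_def card_insert_if split: prod.splits)
    show "finite (ctx f r)" using dec by (simp add: ctx_def)
    have "card (ctx f r) \<le> (\<Sum>i<r. card (decision k i (f i)))" unfolding ctx_def by (rule card_UN_le) simp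
    also have "\<dots> \<le> (\<Sum>i<r. 2)" by (rule sum_mono) (rule dec)
    finally show "card (ctx f r) \<le> 2 * r" by simp
  qed
  have w_ctx: "card (set ls \<union> ctx f r) \<le> w" if "r \<le> R" "length ls \<le> 3" for ls f r
  proof -
    have "card (set ls \<union> ctx f r) \<le> length ls + 2 * r"
      using card_Un_le[of "set ls" "ctx f r"] card_length[of ls] ctx(2)[of f r] by linarith
    then show ?thesis using that by (simp add: w_def R_def)
  qed
  have "\<forall>f. (\<forall>i<r. fst (f i) < m \<and> snd (f i) < 3) \<longrightarrow>
      derivable ?F w (3 + 2 * (R - r)) (5 * (20 * (m + 1)) ^ (R - r)) (ctx f r)" if "r \<le> R" for r
    using that
  proof (induction rule: inc_induct)
    case base
    show ?case
    proof (intro allI impI)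
      fix f :: "nat \<Rightarrow> nat \<times> nat" assume f: "\<forall>i<R. fst (f i) < m \<and> snd (f i) < 3"
      \<comment> \<open>The answers of the variable rows form a base assignment, which falsifies
        some base clause \<open>g\<close>; yet the row of \<open>g\<close> claims that its literal
        \<open>j\<close> is true. The implication between these two places, split by its
        \<open>TV\<close> variable, refutes the claim.\<close>
      obtain g where g: "g < M" "{i. i < k \<and> snd (f i) = 0} \<inter> h g ` {..<3} = \<sigma> g"
        using unsat[of "{i. i < k \<and> snd (f i) = 0}"] by blast
      define v where "v = fst (f (k + g))"
      define j where "j = snd (f (k + g))"
      define i where "i = h g j"
      define v' where "v' = fst (f i)"
      have j: "j < 3" "v < m" using f g(1) by (auto simp: j_def v_def R_def)
      have i: "i < k" using h[OF g(1) j(1)] by (simp add: i_def)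
      have v': "v' < m" using f i by (simp add: v'_def R_def)
      have i\<sigma>: "i \<in> \<sigma> g \<longleftrightarrow> snd (f i) = 0"
        unfolding g(2)[symmetric] using i j(1) by (auto simp: i_def)
      let ?l = "(if i \<in> \<sigma> g then Neg else Pos) (yv i v' 0)"
      have w: "card (insert l (ctx f R)) \<le> w" for l
        using w_ctx[of R "[l]" f] by simp
      have "decision k (k + g) (f (k + g)) \<subseteq> ctx f R" using g(1) by (force simp: ctx_def R_def)
      then have sub1: "{Neg (pv (k + g) v), Neg (yv (k + g) v j)} \<subseteq> ctx f R"
        by (simp add: decision_def v_def j_def split: prod.splits)
      have "decision k i (f i) \<subseteq> ctx f R" using i by (force simp: ctx_def R_def)
      then have sub2: "{Neg (pv i v'), ?l} \<subseteq> ctx f R"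
        using i i\<sigma> by (cases "f i"; cases "snd (f i) = 0") (simp_all add: decision_def v'_def)
      have d1: "derivable ?F w 2 2 (insert (Pos (tv g j v v')) (ctx f R))"
        by (rule derivable_axiom_weaken[OF pair_in_lifted_cnf[OF g(1) j v'] _ _ w])
           (use sub1 sub2 ctx(1) in \<open>simp_all add: i_def\<close>)
      have d2: "derivable ?F w 2 2 (insert (Neg (tv g j v v')) (ctx f R))"
        by (rule derivable_axiom_weaken[OF agree_in_lifted_cnf[OF g(1) j v'] _ _ w])
           (use sub1 sub2 ctx(1) in \<open>simp_all add: i_def\<close>)
      have "derivable ?F w (max 2 (max (2 + 1) 3)) (2 + 2 + 1) (ctx f R \<union> ctx f R)"
        by (rule derivable_resolve[OF d1 d2]) (use w_ctx[of R "[]" f] in simp)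
      then have "derivable ?F w (max 2 (max (2 + 1) 3)) (2 + 2 + 1) (ctx f R)" by simp
      then show "derivable ?F w (3 + 2 * (R - R)) (5 * (20 * (m + 1)) ^ (R - R)) (ctx f R)"
        by (rule derivable_mono) simp_all
    qed
  next
    case (step r)
    show ?case
    proof (intro allI impI)
      fix f :: "nat \<Rightarrow> nat \<times> nat" assume f: "\<forall>i<r. fst (f i) < m \<and> snd (f i) < 3"
      define s where "s = 3 + 2 * (R - Suc r)"
      define n where "n = 5 * (20 * (m + 1)) ^ (R - Suc r)"
      define D where "D = ctx f r"
      have n1: "1 \<le> n" by (simp add: n_def)
      have s3: "3 \<le> s" by (simp add: s_def)
      have rR: "r < R" using step by simp
      have wD: "card (set ls \<union> D) \<le> w" if "length ls \<le> 3" for ls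
        unfolding D_def using w_ctx[of r ls f] rR that by simp
      have child: "derivable ?F w s n (decision k r (v, b) \<union> D)" if "v < m" "b < 3" for v b
      proof -
        let ?f = "f(r := (v, b))"
        have "ctx ?f (Suc r) = decision k r (v, b) \<union> D"
          by (auto simp: ctx_def D_def lessThan_Suc)
        moreover have "\<forall>i<Suc r. fst (?f i) < m \<and> snd (?f i) < 3" using f that by (simp add: less_Suc_eq)
        then have "derivable ?F w s n (ctx ?f (Suc r))" using step.IH unfolding s_def n_def by blast
        ultimately show ?thesis by simp
      qed
      \<comment> \<open>The bounds come from clause rows: size \<open>3 * n + 4\<close> counts three
        children, the choice clause and three resolvents, and the extra unit of space holds the
        current resolvent while the next child is derived.\<close>
      have place: "derivable ?F w (s + 1) (3 * n + 4) (insert (Neg (pv r v)) D)" if v: "v < m" for v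
      proof -
        let ?D = "insert (Neg (pv r v)) D"
        have wD': "card (set ls \<union> ?D) \<le> w" if "length ls \<le> 2" for ls
        proof -
          have "set ls \<union> ?D = set (Neg (pv r v) # ls) \<union> D" by simp
          then show ?thesis using wD[of "Neg (pv r v) # ls"] that by simp
        qed
        show ?thesis
        proof (cases "r < k")
          case True
          have c0: "derivable ?F w s n (insert (Neg (yv r v 0)) ?D)"
            using child[OF v, of 0] True by (simp add: decision_def insert_commute)
          have c1: "derivable ?F w s n (insert (Pos (yv r v 0)) ?D)"
            using child[OF v, of 1] True by (simp add: decision_def insert_commute)
          have "derivable ?F w (max s (max (s + 1) 3)) (n + n + 1) (?D \<union> ?D)"
            by (rule derivable_resolve[OF c1 c0]) (use wD'[of "[]"] in simp)
          then have "derivable ?F w (max s (max (s + 1) 3)) (n + n + 1) ?D" by simp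
          then show ?thesis by (rule derivable_mono) (use s3 in auto)
        next
          case False
          have c: "derivable ?F w s n (insert (Neg (yv r v b)) ?D)" if "b < 3" for b
            using child[OF v that] False by (simp add: decision_def insert_commute)
          obtain g where g: "r = k + g" "g < M" using False rR R_def
            by (metis add_less_cancel_left le_Suc_ex not_less)
          have "{Pos (yv r v 0), Pos (yv r v 1), Pos (yv r v 2)} \<in> ?F"
            unfolding lifted_cnf_def g(1) using g(2) v by auto
          then have a: "derivable ?F w 1 1 (insert (Pos (yv r v 0)) {Pos (yv r v 1), Pos (yv r v 2)})" by (rule ax)
          have d00: "derivable ?F w (max 1 (max (s + 1) 3)) (1 + n + 1) ({Pos (yv r v 1), Pos (yv r v 2)} \<union> ?D)"
            by (rule derivable_resolve[OF a c]) (use wD'[of "[Pos (yv r v 1), Pos (yv r v 2)]"] in simp_all)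
          have d0: "derivable ?F w (s + 1) (n + 2) (insert (Pos (yv r v 1)) ({Pos (yv r v 2)} \<union> ?D))"
          proof -
            have "{Pos (yv r v 1), Pos (yv r v 2)} \<union> ?D = insert (Pos (yv r v 1)) ({Pos (yv r v 2)} \<union> ?D)" by blast
            moreover have "max 1 (max (s + 1) 3) = s + 1" using s3 by simp
            moreover have "1 + n + 1 = n + 2" by simp
            ultimately show ?thesis using d00 by (simp only:)
          qed
          have d10: "derivable ?F w (max (s + 1) (max (s + 1) 3)) (n + 2 + n + 1) (({Pos (yv r v 2)} \<union> ?D) \<union> ?D)"
            by (rule derivable_resolve[OF d0 c]) (use wD'[of "[Pos (yv r v 2)]"] in simp_all)
          have d1: "derivable ?F w (s + 1) (2 * n + 3) (insert (Pos (yv r v 2)) ?D)"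
          proof -
            have "({Pos (yv r v 2)} \<union> ?D) \<union> ?D = insert (Pos (yv r v 2)) ?D" by blast
            moreover have "max (s + 1) (max (s + 1) 3) = s + 1" using s3 by simp
            moreover have "n + 2 + n + 1 = 2 * n + 3" by simp
            ultimately show ?thesis using d10 by (simp only:)
          qed
          have "derivable ?F w (max (s + 1) (max (s + 1) 3)) (2 * n + 3 + n + 1) (?D \<union> ?D)"
            by (rule derivable_resolve[OF d1 c]) (use wD'[of "[]"] in simp_all)
          moreover have "max (s + 1) (max (s + 1) 3) = s + 1" using s3 by simp
          moreover have "2 * n + 3 + n + 1 = 3 * n + 4" by simp
          ultimately show ?thesis by (simp only: Un_absorb)
        qed
      qed
      \<comment> \<open>Going down from \<open>v = m\<close>, the clause accumulated so far is
        derived first each time, so the space does not grow with \<open>m\<close>. A step costs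
        \<open>3 * n + 7\<close>: one axiom, the clause for the place, and two resolvents.\<close>
      have chain: "derivable ?F w (s + 2) (2 + (m - v) * (3 * n + 7)) (insert (Neg (evar r v)) D)" if "v \<le> m" for v
        using that
      proof (induction rule: inc_induct)
        case base
        have "{Neg (evar r m)} \<in> ?F" unfolding lifted_cnf_def using rR by (auto simp: R_def)
        then have "derivable ?F w 2 2 (insert (Neg (evar r m)) D)"
          by (rule derivable_axiom_weaken) (use wD[of "[Neg (evar r m)]"] ctx(1) in \<open>auto simp: D_def\<close>)
        then show ?case by (rule derivable_mono) auto
      next
        case (step v)
        have "{Pos (evar r (Suc v)), Neg (evar r v), Pos (pv r v)} \<in> ?F"
          unfolding lifted_cnf_def using rR step.hyps by (auto simp: R_def insert_commute)
        then have a: "derivable ?F w 1 1 (insert (Pos (evar r (Suc v))) {Pos (pv r v), Neg (evar r v)})"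
          by (intro ax) (simp add: insert_commute)
        have "derivable ?F w (max (s + 2) (max (1 + 1) 3)) (2 + (m - Suc v) * (3 * n + 7) + 1 + 1) ({Pos (pv r v), Neg (evar r v)} \<union> D)"
          by (rule derivable_resolve'[OF step.IH a]) (use wD[of "[Pos (pv r v), Neg (evar r v)]"] in simp)
        then have d: "derivable ?F w (s + 2) (2 + (m - Suc v) * (3 * n + 7) + 2) (insert (Pos (pv r v)) (insert (Neg (evar r v)) D))"
          using s3 by simp
        have "derivable ?F w (max (s + 2) (max (s + 1 + 1) 3)) (2 + (m - Suc v) * (3 * n + 7) + 2 + (3 * n + 4) + 1) (insert (Neg (evar r v)) D \<union> D)"
          by (rule derivable_resolve[OF d place]) (use step.hyps wD[of "[Neg (evar r v)]"] in simp_all)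
        moreover have "insert (Neg (evar r v)) D \<union> D = insert (Neg (evar r v)) D" by blast
        moreover have "max (s + 2) (max (s + 1 + 1) 3) = s + 2" using s3 by simp
        moreover have "2 + (m - Suc v) * (3 * n + 7) + 2 + (3 * n + 4) + 1 = 2 + (m - v) * (3 * n + 7)"
        proof -
          have "m - v = Suc (m - Suc v)" using step.hyps by simp
          then show ?thesis by simp
        qed
        ultimately show ?case by (simp only:)
      qed
      have "{Pos (evar r 0)} \<in> ?F" unfolding lifted_cnf_def using rR by (auto simp: R_def)
      then have a: "derivable ?F w 1 1 (insert (Pos (evar r 0)) {})" by (rule ax)
      have "derivable ?F w (max (s + 2) (max (1 + 1) 3)) (2 + (m - 0) * (3 * n + 7) + 1 + 1) ({} \<union> D)"
        by (rule derivable_resolve'[OF chain[of 0] a]) (use wD[of "[]"] in simp_all)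
      then have "derivable ?F w (max (s + 2) (max (1 + 1) 3)) (2 + (m - 0) * (3 * n + 7) + 1 + 1) D" by simp
      then show "derivable ?F w (3 + 2 * (R - r)) (5 * (20 * (m + 1)) ^ (R - r)) (ctx f r)"
        unfolding D_def
      proof (rule derivable_mono)
        have Rr: "R - r = Suc (R - Suc r)" using rR by simp
        show "max (s + 2) (max (1 + 1) 3) \<le> 3 + 2 * (R - r)" unfolding Rr by (simp add: s_def)
        have "2 + (m - 0) * (3 * n + 7) + 1 + 1 = 4 + m * (3 * n + 7)" by simp
        also have "\<dots> \<le> 4 * n + m * (3 * n + 7 * n)" using n1 by (intro add_mono mult_le_mono) auto
        also have "\<dots> \<le> 20 * (m + 1) * n" by (simp add: algebra_simps)
        also have "\<dots> = 5 * (20 * (m + 1)) ^ (R - r)" unfolding Rr n_def by simp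
        finally show "2 + (m - 0) * (3 * n + 7) + 1 + 1 \<le> 5 * (20 * (m + 1)) ^ (R - r)" .
      qed
    qed
  qed
  from this[of 0] have "derivable ?F w (3 + 2 * R) (5 * (20 * (m + 1)) ^ R) (ctx (\<lambda>_. (0, 0)) 0)" by simp
  moreover have "ctx (\<lambda>_. (0, 0)) 0 = {}" by (simp add: ctx_def)
  ultimately show ?thesis by (simp add: w_def R_def add.commute)
qed

section \<open>Choice of parameters\<close>

lemma card_lifted_cnf:
  assumes "1 \<le> m"
  shows "card (lifted_cnf k (6 * k) h \<sigma> m) \<le> 63 * (k * m ^ 2)"
proof -
  let ?R = "k + 6 * k" and ?M = "6 * k"
  have un: "card (A \<union> B) \<le> a + b" if "card A \<le> a" "card B \<le> b" for A B :: "nat cnf" and a b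
    using card_Un_le[of A B] that by linarith
  have "card (lifted_cnf k ?M h \<sigma> m) \<le> ?R + ?R + ?R * m + ?M * m + ?M * (3 * (m * m)) + ?M * (3 * (m * m))"
    unfolding lifted_cnf_def by (intro un) (rule card_image_le[THEN order_trans]; simp add: card_cartesian_product)+
  also have "\<dots> \<le> 7 * k * m ^ 2 + 7 * k * m ^ 2 + 7 * k * m ^ 2 + 6 * k * m ^ 2 + 18 * k * m ^ 2 + 18 * k * m ^ 2"
  proof -
    have "1 \<le> m ^ 2" "m \<le> m ^ 2" using assms by (simp_all add: power2_eq_square)
    then have "k \<le> k * m ^ 2" "k * m \<le> k * m ^ 2" by simp_all
    moreover have "?R * m = 7 * (k * m)" "?M * m = 6 * (k * m)" "?M * (3 * (m * m)) = 18 * (k * m ^ 2)"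
      by (simp_all add: power2_eq_square)
    ultimately show ?thesis by linarith
  qed
  also have "\<dots> = 63 * (k * m ^ 2)" by simp
  finally show ?thesis .
qed

lemma card_vars_le:
  assumes "three_cnf F"
  shows "card (vars F) \<le> 3 * card F"
proof -
  have "card (vars F) \<le> (\<Sum>C\<in>F. card (var ` C))"
    unfolding vars_def using assms by (intro card_UN_le) (simp add: three_cnf_def)
  also have "\<dots> \<le> (\<Sum>C\<in>F. 3)"
  proof (rule sum_mono)
    fix C assume "C \<in> F"
    then have "finite C" "card C \<le> 3" using assms by (simp_all add: three_cnf_def)
    then show "card (var ` C) \<le> 3" using card_image_le[of C var] by linarith
  qed
  finally show ?thesis by simp
qed

text \<open>\<open>u\<close> will be \<open>w n\<close>. The constant \<open>K\<close> is
  independent of \<open>u\<close>, and the system is chosen independently of \<open>m\<close>, so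
  only \<open>m\<close> has to be adapted to \<open>n\<close>. The exponent of 2 is
  \<open>k + M + u\<close> with \<open>k = K * u\<close> and \<open>M = 6 * k\<close>.\<close>

lemma hard_formulas_exist:
  "\<exists>K\<ge>1. \<forall>u\<ge>1. \<exists>h \<sigma>. \<forall>m.
     derivable (lifted_cnf (K * u) (6 * (K * u)) h \<sigma> m) (14 * (K * u) + 3) (14 * (K * u) + 3)
       (5 * (20 * (m + 1)) ^ (7 * (K * u))) {} \<and>
     (\<forall>\<pi>. res_refutation (lifted_cnf (K * u) (6 * (K * u)) h \<sigma> m) \<pi> \<longrightarrow> m ^ u \<le> res_size \<pi> * 2 ^ ((7 * K + 1) * u)) \<and>
     (\<forall>\<pi> :: (nat lit, 'f::field) mpoly list.
        pcr_refutation (lifted_cnf (K * u) (6 * (K * u)) h \<sigma> m) \<pi> \<longrightarrow> m ^ u \<le> pcr_size \<pi> * 2 ^ ((7 * K + 1) * u)) \<and>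
     (\<forall>\<pi>. sa_refutation (lifted_cnf (K * u) (6 * (K * u)) h \<sigma> m) \<pi> \<longrightarrow> m ^ u \<le> sa_size \<pi> * 2 ^ ((7 * K + 1) * u))"
  (is "\<exists>K\<ge>1. \<forall>u\<ge>1. ?hard K u")
\<comment> \<open>The lower bounds are used with \<open>q = 18 * u\<close>, hence with expansion up
  to \<open>36 * u\<close>, and \<open>expander_exists\<close> then asks for
  \<open>k \<ge> 2 * 648 ^ 4 * (36 * u)\<close>.\<close>
proof (rule exI[of _ "72 * 648 ^ 4"], intro conjI allI impI)
  fix u :: nat assume u: "1 \<le> u"
  define k where "k = 72 * 648 ^ 4 * u"
  have k: "1 \<le> k" "2 * 648 ^ 4 * (36 * u) \<le> k" using u by (simp_all add: k_def)
  obtain h :: "nat \<Rightarrow> nat \<Rightarrow> nat" where h: "\<And>g j. g < 6 * k \<Longrightarrow> j < 3 \<Longrightarrow> h g j < k"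
    and ex: "\<And>I. I \<subseteq> {..<6 * k} \<Longrightarrow> card I \<le> 36 * u \<Longrightarrow> card I \<le> 2 * card (boundary (\<lambda>g. h g ` {..<3}) I)"
  proof (rule expander_exists[OF k(2,1)])
    fix h :: "nat \<Rightarrow> nat \<Rightarrow> nat"
    assume h: "\<And>g j. g < 6 * k \<Longrightarrow> j < 3 \<Longrightarrow> h g j < k"
      "\<And>I. I \<subseteq> {..<6 * k} \<Longrightarrow> card I \<le> 36 * u \<Longrightarrow> card I \<le> 2 * card (boundary (\<lambda>g. h g ` {..<3}) I)"
    show thesis by (rule that[OF h])
  qed
  have N: "h g ` {..<3} \<subseteq> {..<k} \<and> card (h g ` {..<3}) \<le> 3" if "g < 6 * k" for g
    using h[OF that] card_image_le[of "{..<3::nat}" "h g"] by auto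
  obtain \<sigma> where \<sigma>: "\<And>g. \<sigma> g \<subseteq> h g ` {..<3}" "\<And>A. \<exists>g<6 * k. A \<inter> h g ` {..<3} = \<sigma> g"
  proof (rule unsat_signs_exist[of k "\<lambda>g. h g ` {..<3}", OF N k(1)])
    fix \<sigma> assume \<sigma>: "\<And>g. \<sigma> g \<subseteq> h g ` {..<3}" "\<And>A. \<exists>g<6 * k. A \<inter> h g ` {..<3} = \<sigma> g"
    show thesis by (rule that[OF \<sigma>])
  qed
  have lower: "(\<forall>\<pi>. res_refutation (lifted_cnf k (6 * k) h \<sigma> m) \<pi> \<longrightarrow> m ^ u \<le> res_size \<pi> * 2 ^ (k + 6 * k + u)) \<and>
     (\<forall>\<pi> :: (nat lit, 'f) mpoly list.
        pcr_refutation (lifted_cnf k (6 * k) h \<sigma> m) \<pi> \<longrightarrow> m ^ u \<le> pcr_size \<pi> * 2 ^ (k + 6 * k + u)) \<and>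
     (\<forall>\<pi>. sa_refutation (lifted_cnf k (6 * k) h \<sigma> m) \<pi> \<longrightarrow> m ^ u \<le> sa_size \<pi> * 2 ^ (k + 6 * k + u))" for m
  proof -
    interpret lifted_system k "6 * k" "18 * u" h \<sigma> m u
      by unfold_locales (use N ex h \<sigma>(1) k(1) u in auto)
    show ?thesis using resolution_lower_bound pcr_lower_bound sa_lower_bound by blast
  qed
  have upper: "derivable (lifted_cnf k (6 * k) h \<sigma> m) (2 * (k + 6 * k) + 3) (2 * (k + 6 * k) + 3)
       (5 * (20 * (m + 1)) ^ (k + 6 * k)) {}" for m
    by (rule lifted_cnf_refutable[OF h \<sigma>(2) k(1)])
  have e: "k + 6 * k + u = (7 * (72 * 648 ^ 4) + 1) * u" "k + 6 * k = 7 * k" "2 * (7 * k) + 3 = 14 * k + 3"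
    by (simp_all add: k_def)
  show "?hard (72 * 648 ^ 4) u"
    using lower upper unfolding e(1) unfolding e(2) unfolding e(3) unfolding k_def by blast
qed simp

lemma eventually_powr_ge:
  fixes B :: real
  assumes a: "0 < a"
  shows "\<forall>\<^sub>F n in sequentially. B \<le> real n powr a"
proof -
  define x where "x = max 1 B powr (1 / a)"
  have "\<forall>\<^sub>F n in sequentially. nat \<lceil>x\<rceil> \<le> n" by (rule eventually_ge_at_top)
  then show ?thesis
  proof (rule eventually_mono)
    fix n :: nat assume "nat \<lceil>x\<rceil> \<le> n"
    then have "x \<le> real n" by linarith
    then have "x powr a \<le> real n powr a" using a by (intro powr_mono2) (auto simp: x_def)
    moreover have "x powr a = max 1 B" using a by (simp add: x_def powr_powr)
    ultimately show "B \<le> real n powr a" by simp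
  qed
qed

theorem theorem1p1:
  fixes w :: "nat \<Rightarrow> nat" and c :: real
  assumes w_pos: "\<forall>\<^sub>F n in sequentially. 1 \<le> w n"
    and c: "0 < c" "c < 1/2"
    and w_bound: "(\<lambda>n. real (w n)) \<in> O(\<lambda>n. real n powr c)"
  shows "\<exists>F :: nat \<Rightarrow> nat cnf.
    (\<forall>n. three_cnf (F n)) \<and>
    (\<lambda>n. real (card (F n))) \<in> O(\<lambda>n. real (w n) * real n) \<and>
    (\<lambda>n. real (card (vars (F n)))) \<in> O(\<lambda>n. real n) \<and>
    (\<exists>\<pi> :: nat \<Rightarrow> nat res_proof.
       (\<forall>n. res_refutation (F n) (\<pi> n)) \<and>
       (\<exists>K>0. \<forall>\<^sub>F n in sequentially. real (res_size (\<pi> n)) \<le> real n powr (K * real (w n))) \<and>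
       (\<lambda>n. real (res_width (\<pi> n))) \<in> O(\<lambda>n. real (w n)) \<and>
       (\<lambda>n. real (res_space (\<pi> n))) \<in> O(\<lambda>n. real (w n))) \<and>
    (\<exists>\<delta>>0. \<forall>\<^sub>F n in sequentially.
       (\<forall>\<pi> :: nat res_proof. res_refutation (F n) \<pi> \<longrightarrow>
          real n powr (\<delta> * real (w n)) \<le> real (res_size \<pi>)) \<and>
       (\<forall>\<pi> :: (nat lit, 'k::field) mpoly list. pcr_refutation (F n) \<pi> \<longrightarrow>
          real n powr (\<delta> * real (w n)) \<le> real (pcr_size \<pi>)) \<and>
       (\<forall>\<pi> :: nat sa_proof. sa_refutation (F n) \<pi> \<longrightarrow>
          real n powr (\<delta> * real (w n)) \<le> real (sa_size \<pi>)))"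
proof -
  obtain K and h :: "nat \<Rightarrow> nat \<Rightarrow> nat \<Rightarrow> nat" and \<sigma> where K: "1 \<le> K"
    and up: "\<And>u m. 1 \<le> u \<Longrightarrow>
      derivable (lifted_cnf (K * u) (6 * (K * u)) (h u) (\<sigma> u) m) (14 * (K * u) + 3) (14 * (K * u) + 3)
       (5 * (20 * (m + 1)) ^ (7 * (K * u))) {}"
    and lo_res: "\<And>u m \<pi>. 1 \<le> u \<Longrightarrow> res_refutation (lifted_cnf (K * u) (6 * (K * u)) (h u) (\<sigma> u) m) \<pi> \<Longrightarrow>
      m ^ u \<le> res_size \<pi> * 2 ^ ((7 * K + 1) * u)"
    and lo_pcr: "\<And>u m. \<And>\<pi> :: (nat lit, 'k) mpoly list. 1 \<le> u \<Longrightarrow> pcr_refutation (lifted_cnf (K * u) (6 * (K * u)) (h u) (\<sigma> u) m) \<pi> \<Longrightarrow>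
      m ^ u \<le> pcr_size \<pi> * 2 ^ ((7 * K + 1) * u)"
    and lo_sa: "\<And>u m \<pi>. 1 \<le> u \<Longrightarrow> sa_refutation (lifted_cnf (K * u) (6 * (K * u)) (h u) (\<sigma> u) m) \<pi> \<Longrightarrow>
      m ^ u \<le> sa_size \<pi> * 2 ^ ((7 * K + 1) * u)"
    using hard_formulas_exist[where 'f = 'k] by metis
  \<comment> \<open>the largest number of places with \<open>K * w n * (m n)\<^sup>2 \<le> n\<close>\<close>
  define m where "m n = nat \<lfloor>sqrt (real n / real (K * w n))\<rfloor>" for n
  define good where "good n \<longleftrightarrow> 1 \<le> w n \<and> 1 \<le> m n" for n
  \<comment> \<open>the finitely many other \<open>n\<close> get the trivially unsatisfiable formula\<close>
  define F where "F n = (if good n then lifted_cnf (K * w n) (6 * (K * w n)) (h (w n)) (\<sigma> (w n)) (m n) else {{}})" for n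
  have F3: "three_cnf (F n)" for n
    unfolding F_def using three_cnf_lifted_cnf by (simp add: three_cnf_def)
  have km: "K * w n * m n ^ 2 \<le> n" if "good n" for n
  proof -
    have pos: "0 < real (K * w n)" using that K by (simp add: good_def)
    have "real (m n) \<le> sqrt (real n / real (K * w n))" by (simp add: m_def)
    then have "real (m n) ^ 2 \<le> real n / real (K * w n)"
      using power_mono[of "real (m n)" "sqrt (real n / real (K * w n))" 2] pos by simp
    then have "real (K * w n) * real (m n) ^ 2 \<le> real n" using pos by (simp add: field_simps)
    then have "real (K * w n * m n ^ 2) \<le> real n" by simp
    then show ?thesis by (simp only: of_nat_le_iff)
  qed
  have cardF: "card (F n) \<le> 63 * n" if "good n" for n
  proof -
    have "card (F n) \<le> 63 * (K * w n * m n ^ 2)"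
      using card_lifted_cnf[of "m n" "K * w n"] that by (simp add: F_def good_def)
    then show ?thesis using km[OF that] by linarith
  qed
  have m_le: "m n \<le> n" if "good n" for n
  proof -
    have "m n * 1 \<le> m n * (K * w n * m n)" using that K by (intro mult_le_mono2) (simp add: good_def)
    also have "\<dots> = K * w n * m n ^ 2" by (simp add: power2_eq_square)
    finally show ?thesis using km[OF that] by linarith
  qed
  obtain B where B: "0 < B" "\<forall>\<^sub>F n in sequentially. norm (real (w n)) \<le> B * norm (real n powr c)"
    using landau_o.bigE[OF w_bound] by blast
  have "\<forall>\<^sub>F n in sequentially. 1 + 4 * (real K * B) \<le> real n powr (1/8)"
    by (rule eventually_powr_ge) simp
  then have m_ge: "\<forall>\<^sub>F n in sequentially. real n powr (1/8) \<le> real (m n)"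
    using B(2) w_pos eventually_ge_at_top[of 1]
  proof eventually_elim
    case (elim n)
    \<comment> \<open>Since \<open>c < 1/2\<close>, the bound on \<open>w n\<close> gives
      \<open>w n \<le> B * x ^ 4\<close>, while \<open>n = x ^ 8\<close>. The square of
      \<open>x + 1\<close>, where the 1 makes up for the floor in \<open>m n\<close>, is at most
      \<open>4 * x ^ 2\<close>, and the remaining factor \<open>x ^ 2\<close> outgrows
      \<open>4 * K * B\<close>.\<close>
    define x where "x = real n powr (1/8)"
    have KB: "0 < real K * B" using K B(1) by simp
    have x: "1 + 4 * (real K * B) \<le> x" using elim(1) by (simp add: x_def)
    have x1: "1 \<le> x" using x KB by linarith
    have n: "1 \<le> real n" using elim(4) by simp
    have "real n powr c \<le> real n powr (1/2)" using n c by (intro powr_mono) auto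
    also have "\<dots> = x ^ 4" using n by (simp add: x_def powr_realpow[symmetric] powr_powr)
    finally have "B * real n powr c \<le> B * x ^ 4" using B(1) by (intro mult_left_mono) auto
    moreover have "real (w n) \<le> B * real n powr c" using elim(2) by simp
    ultimately have "real (w n) \<le> B * x ^ 4" by linarith
    then have kw: "real (K * w n) \<le> real K * B * x ^ 4" using K by (simp add: mult.assoc mult_left_mono)
    have pos: "0 < real (K * w n)" using elim(3) K by simp
    have n8: "real n = x ^ 8" using n by (simp add: x_def powr_realpow[symmetric] powr_powr)
    have "(x + 1) ^ 2 \<le> (2 * x) ^ 2" using x1 by (intro power_mono) auto
    then have "real (K * w n) * (x + 1) ^ 2 \<le> (real K * B * x ^ 4) * (4 * x ^ 2)"
      using kw pos by (intro mult_mono) (auto simp: power_mult_distrib)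
    also have "\<dots> = (4 * (real K * B)) * x ^ 6" by (simp add: power_add[symmetric])
    also have "\<dots> \<le> x ^ 2 * x ^ 6"
    proof (rule mult_right_mono)
      have "x * 1 \<le> x * x" using x1 by (intro mult_left_mono) auto
      then show "4 * (real K * B) \<le> x ^ 2" using x by (simp add: power2_eq_square)
    qed (use x1 in simp)
    also have "\<dots> = real n" by (simp add: n8 power_add[symmetric])
    finally have "(x + 1) ^ 2 \<le> real n / real (K * w n)" using pos by (simp add: field_simps)
    then have "x + 1 \<le> sqrt (real n / real (K * w n))" by (rule real_le_rsqrt)
    then have "x \<le> real (m n)" unfolding m_def by linarith
    then show ?case by (simp add: x_def)
  qed
  have good: "\<forall>\<^sub>F n in sequentially. good n"
    using w_pos m_ge eventually_ge_at_top[of 1]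
  proof eventually_elim
    case (elim n)
    have "1 \<le> real n powr (1/8)" using elim(3) by (intro ge_one_powr_ge_zero) auto
    then have "1 \<le> m n" using elim(2) by linarith
    then show ?case using elim(1) by (simp add: good_def)
  qed
  have "\<exists>\<pi>. res_refutation (F n) \<pi> \<and> (good n \<longrightarrow> length \<pi> \<le> 5 * (20 * (m n + 1)) ^ (7 * (K * w n)) \<and>
      res_width \<pi> \<le> 14 * (K * w n) + 3 \<and> res_space \<pi> \<le> 14 * (K * w n) + 3)" for n
  proof (cases "good n")
    case True
    have "derivable (F n) (14 * (K * w n) + 3) (14 * (K * w n) + 3) (5 * (20 * (m n + 1)) ^ (7 * (K * w n))) {}"
      using up[of "w n" "m n"] True by (simp add: F_def good_def)
    then obtain \<pi> where \<pi>: "res_refutation (F n) \<pi>" "length \<pi> \<le> 5 * (20 * (m n + 1)) ^ (7 * (K * w n))"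
      "\<And>t. t < length \<pi> \<Longrightarrow> card (fst (\<pi> ! t)) \<le> 14 * (K * w n) + 3 \<and> res_space_at \<pi> t \<le> 14 * (K * w n) + 3"
      unfolding derivable_def res_refutation_def by blast
    have "{..<length \<pi>} \<noteq> {}" using \<pi>(1) by (auto simp: res_refutation_def res_derivation_def)
    then have "res_width \<pi> \<le> 14 * (K * w n) + 3" "res_space \<pi> \<le> 14 * (K * w n) + 3"
      unfolding res_width_def res_space_def using \<pi>(3) by (simp_all add: Max_le_iff)
    then show ?thesis using \<pi>(1,2) by blast
  next
    case False
    then have "res_refutation (F n) [({}, Axiom)]"
      by (simp add: F_def res_refutation_def res_derivation_def)
    then show ?thesis using False by blast
  qed
  then obtain \<pi> where \<pi>: "\<And>n. res_refutation (F n) (\<pi> n)"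
    "\<And>n. good n \<Longrightarrow> length (\<pi> n) \<le> 5 * (20 * (m n + 1)) ^ (7 * (K * w n))"
    "\<And>n. good n \<Longrightarrow> res_width (\<pi> n) \<le> 14 * (K * w n) + 3"
    "\<And>n. good n \<Longrightarrow> res_space (\<pi> n) \<le> 14 * (K * w n) + 3" by metis
  have size: "\<forall>\<^sub>F n in sequentially. real (res_size (\<pi> n)) \<le> real n powr (real (2 + 14 * K) * real (w n))"
    using good eventually_ge_at_top[of 40]
  proof eventually_elim
    case (elim n)
    \<comment> \<open>From \<open>n = 40\<close> on, the base \<open>20 * (m n + 1)\<close> is at
      most \<open>n ^ 2\<close>; the factor 5 is also absorbed by \<open>n ^ 2\<close>, and
      \<open>1 \<le> w n\<close> puts this into an exponent linear in \<open>w n\<close>.\<close>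
    have n40: "40 * n \<le> n ^ 2" using elim(2) by (simp add: power2_eq_square)
    then have n2: "5 \<le> n ^ 2" "20 * n + 20 \<le> n ^ 2" using elim(2) by linarith+
    have "20 * (m n + 1) \<le> 20 * n + 20" using m_le[OF elim(1)] by simp
    also note n2(2)
    finally have "5 * (20 * (m n + 1)) ^ (7 * (K * w n)) \<le> n ^ 2 * (n ^ 2) ^ (7 * (K * w n))"
      by (intro mult_le_mono power_mono n2(1)) simp_all
    also have "\<dots> = n ^ (2 + 14 * (K * w n))" by (simp add: power_mult[symmetric] power_add[symmetric])
    also have "\<dots> \<le> n ^ ((2 + 14 * K) * w n)"
      using elim by (intro power_increasing) (auto simp: good_def algebra_simps)
    finally have "res_size (\<pi> n) \<le> n ^ ((2 + 14 * K) * w n)"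
      using \<pi>(2)[OF elim(1)] by (simp add: res_size_def)
    then have "real (res_size (\<pi> n)) \<le> real (n ^ ((2 + 14 * K) * w n))" by (simp only: of_nat_le_iff)
    also have "\<dots> = real n powr real ((2 + 14 * K) * w n)" 
      unfolding of_nat_power by (rule powr_realpow[symmetric]) (use elim(2) in simp)
    also have "real ((2 + 14 * K) * w n) = real (2 + 14 * K) * real (w n)" by (rule of_nat_mult)
    finally show ?case .
  qed
  have linear: "f \<in> O(\<lambda>n. real (w n))" if "\<And>n. good n \<Longrightarrow> f n \<le> real (14 * (K * w n) + 3)" "\<And>n. 0 \<le> f n" for f
  proof (rule bigoI[of _ "real (14 * K + 3)"])
    show "\<forall>\<^sub>F n in sequentially. norm (f n) \<le> real (14 * K + 3) * norm (real (w n))"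
      using good
    proof eventually_elim
      case (elim n)
      have "14 * (K * w n) + 3 \<le> (14 * K + 3) * w n" using elim by (simp add: good_def algebra_simps)
      then have "real (14 * (K * w n) + 3) \<le> real ((14 * K + 3) * w n)" by (simp only: of_nat_le_iff)
      then show ?case using that(1)[OF elim] that(2)[of n] by (simp only: of_nat_mult real_norm_def abs_of_nonneg of_nat_0_le_iff)
    qed
  qed
  define b where "b = (2::real) ^ (7 * K + 1)"
  \<comment> \<open>\<open>m n\<close> is at least \<open>n powr (1/8)\<close>. Half of this
    exponent pays for the loss \<open>b\<close> per unit of \<open>w n\<close>, the other half
    remains and gives \<open>\<delta> = 1/16\<close>.\<close>
  have lower: "real n powr (1/16 * real (w n)) \<le> real S"
    if S: "m n ^ w n \<le> S * 2 ^ ((7 * K + 1) * w n)" and n: "1 \<le> n" "b \<le> real n powr (1/16)" "real n powr (1/8) \<le> real (m n)" for n S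
  proof -
    have b0: "0 < b" by (simp add: b_def)
    have "b * real n powr (1/16) \<le> real n powr (1/16) * real n powr (1/16)"
      using n(2) by (intro mult_right_mono) auto
    also have "\<dots> = real n powr (1/8)" by (simp add: powr_add[symmetric])
    finally have "b * real n powr (1/16) \<le> real (m n)" using n(3) by simp
    then have "(b * real n powr (1/16)) ^ w n \<le> real (m n) ^ w n" using b0 by (intro power_mono) auto
    also have "\<dots> \<le> real S * b ^ w n"
    proof -
      have "real (m n ^ w n) \<le> real (S * 2 ^ ((7 * K + 1) * w n))" using S by (simp only: of_nat_le_iff)
      then show ?thesis by (simp only: b_def of_nat_mult of_nat_power of_nat_numeral power_mult)
    qed
    finally have "b ^ w n * (real n powr (1/16)) ^ w n \<le> b ^ w n * real S"
      by (simp add: power_mult_distrib mult.commute)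
    then have "(real n powr (1/16)) ^ w n \<le> real S" using b0 by simp
    moreover have "(real n powr (1/16)) ^ w n = real n powr (1/16 * real (w n))"
      using n(1) by (simp add: powr_realpow[symmetric] powr_powr)
    ultimately show ?thesis by simp
  qed
  have "\<forall>\<^sub>F n in sequentially. b \<le> real n powr (1/16)" by (rule eventually_powr_ge) simp
  then have lower_ev: "\<forall>\<^sub>F n in sequentially. good n \<and> 1 \<le> n \<and> b \<le> real n powr (1/16) \<and> real n powr (1/8) \<le> real (m n)"
    using good eventually_ge_at_top[of 1] m_ge
    by eventually_elim auto
  show ?thesis
  proof (intro exI[of _ F] conjI allI F3)
    show "(\<lambda>n. real (card (F n))) \<in> O(\<lambda>n. real (w n) * real n)"
    proof (rule bigoI[of _ 63])
      show "\<forall>\<^sub>F n in sequentially. norm (real (card (F n))) \<le> 63 * norm (real (w n) * real n)"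
        using good
      proof eventually_elim
        case (elim n)
        have "card (F n) \<le> 63 * n" by (rule cardF[OF elim])
        also have "\<dots> \<le> 63 * (w n * n)" using elim by (simp add: good_def)
        finally have "real (card (F n)) \<le> real (63 * (w n * n))" by (simp only: of_nat_le_iff)
        then show ?case by simp
      qed
    qed
    show "(\<lambda>n. real (card (vars (F n)))) \<in> O(\<lambda>n. real n)"
    proof (rule bigoI[of _ 189])
      show "\<forall>\<^sub>F n in sequentially. norm (real (card (vars (F n)))) \<le> 189 * norm (real n)"
        using good
      proof eventually_elim
        case (elim n)
        have "card (vars (F n)) \<le> 189 * n" using card_vars_le[OF F3, of n] cardF[OF elim] by linarith
        then have "real (card (vars (F n))) \<le> real (189 * n)" by (simp only: of_nat_le_iff)
        then show ?case by simp
      qed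
    qed
    show "\<exists>\<pi>. (\<forall>n. res_refutation (F n) (\<pi> n)) \<and>
       (\<exists>K>0. \<forall>\<^sub>F n in sequentially. real (res_size (\<pi> n)) \<le> real n powr (K * real (w n))) \<and>
       (\<lambda>n. real (res_width (\<pi> n))) \<in> O(\<lambda>n. real (w n)) \<and>
       (\<lambda>n. real (res_space (\<pi> n))) \<in> O(\<lambda>n. real (w n))"
    proof (intro exI[of _ \<pi>] conjI allI \<pi>(1))
      show "\<exists>K>0. \<forall>\<^sub>F n in sequentially. real (res_size (\<pi> n)) \<le> real n powr (K * real (w n))"
        using size by (intro exI[of _ "real (2 + 14 * K)"]) simp
      show "(\<lambda>n. real (res_width (\<pi> n))) \<in> O(\<lambda>n. real (w n))"
        by (rule linear) (use \<pi>(3) in \<open>simp_all only: of_nat_le_iff of_nat_0_le_iff\<close>)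
      show "(\<lambda>n. real (res_space (\<pi> n))) \<in> O(\<lambda>n. real (w n))"
        by (rule linear) (use \<pi>(4) in \<open>simp_all only: of_nat_le_iff of_nat_0_le_iff\<close>)
    qed
    show "\<exists>\<delta>>0. \<forall>\<^sub>F n in sequentially.
       (\<forall>\<pi> :: nat res_proof. res_refutation (F n) \<pi> \<longrightarrow>
          real n powr (\<delta> * real (w n)) \<le> real (res_size \<pi>)) \<and>
       (\<forall>\<pi> :: (nat lit, 'k::field) mpoly list. pcr_refutation (F n) \<pi> \<longrightarrow>
          real n powr (\<delta> * real (w n)) \<le> real (pcr_size \<pi>)) \<and>
       (\<forall>\<pi> :: nat sa_proof. sa_refutation (F n) \<pi> \<longrightarrow>
          real n powr (\<delta> * real (w n)) \<le> real (sa_size \<pi>))"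
      (is "\<exists>\<delta>>0. \<forall>\<^sub>F n in sequentially. ?hard \<delta> n")
    proof (intro exI[of _ "1/16"] conjI)
      show "\<forall>\<^sub>F n in sequentially. ?hard (1/16) n"
        using lower_ev
      proof (rule eventually_mono)
        fix n assume n: "good n \<and> 1 \<le> n \<and> b \<le> real n powr (1/16) \<and> real n powr (1/8) \<le> real (m n)"
        have u: "1 \<le> w n" using n by (simp add: good_def)
        have Fn: "F n = lifted_cnf (K * w n) (6 * (K * w n)) (h (w n)) (\<sigma> (w n)) (m n)" using n by (simp add: F_def)
        have low: "real n powr (1/16 * real (w n)) \<le> real S" if "m n ^ w n \<le> S * 2 ^ ((7 * K + 1) * w n)" for S
          using lower[OF that] n by blast
        show "?hard (1/16) n"
          unfolding Fn
          by (intro conjI allI impI; rule low) (erule lo_res[OF u], erule lo_pcr[OF u], erule lo_sa[OF u])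
      qed
    qed simp
  qed
qed

end
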